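(* Let $\mathscr{J}$ be a system of arities in a symmetric monoidal closed category $\mathscr{V}$ such that $\mathscr{V}_0$ has pullbacks, let $\mathscr{C}$ be a $\mathscr{J}$-admissible $\mathscr{V}$-category, and let $(\mathscr{T},\mathscr{U},D)$ be a bifold algebra in $\mathscr{C}$. Then $D$ is right-commutant if and only if its transpose $D_{r\ell}:\mathscr{U}\to[\mathscr{T},\mathscr{C}]_{\mathscr{J}}$ is fully faithful. Similarly, $D$ is left-commutant if and only if its transpose $D_{\ell r}:\mathscr{T}\to[\mathscr{U},\mathscr{C}]_{\mathscr{J}}$ is fully faithful.
   Context: Base setting. $\mathscr{V}$ is a symmetric monoidal closed category with unit object $I$ and underlying ordinary category $\mathscr{V}_0$. By universe enlargement, $\mathscr{V}$ is a full subcategory of a symmetric monoidal closed category $\mathscr{V}'$ that is complete and cocomplete relative to a universe in which everything considered is small, with $\mathscr{V}\hookrightarrow\mathscr{V}'$ preserving all limits that exist in $\mathscr{V}$; $\mathscr{V}$-functor categories exist as $\mathscr{V}'$-categories. A system of arities is a fully faithful symmetric strong monoidal $\mathscr{V}$-functor $\mathscr{J}\to\mathscr{V}$, written as the inclusion of a full sub-$\mathscr{V}$-category containing $I$ and closed under $\otimes$ ($\mathscr{J}$ need not be small). A $\mathscr{J}$-cotensor in a $\mathscr{V}$-category is a cotensor $[J,C]$ with $J\in\mathrm{ob}\,\mathscr{J}$; $\mathscr{V}$-categories with $\mathscr{J}$-cotensors are equipped with designated ones, with $[I,C]=C$ (and identity counit). A $\mathscr{J}$-theory is a $\mathscr{V}$-category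 $\mathscr{T}$ equipped with an identity-on-objects $\mathscr{V}$-functor $\tau:\mathscr{J}^{\mathrm{op}}\to\mathscr{T}$ that preserves $\mathscr{J}$-cotensors; equivalently, $\mathrm{ob}\,\mathscr{T}=\mathrm{ob}\,\mathscr{J}$ and each object $J$ is equipped with a morphism $J\to\mathscr{T}(J,I)$ exhibiting $J$ as a cotensor $[J,I]$ in $\mathscr{T}$, which for $J=I$ is the identity on $I$. A morphism of $\mathscr{J}$-theories is a $\mathscr{V}$-functor commuting with the structure $\mathscr{V}$-functors $\tau$. For a $\mathscr{V}$-category $\mathscr{C}$ with $\mathscr{J}$-cotensors, a $\mathscr{T}$-algebra in $\mathscr{C}$ is a $\mathscr{V}$-functor $A:\mathscr{T}\to\mathscr{C}$ preserving $\mathscr{J}$-cotensors; its carrier is $|A|=A(I)$. $\mathscr{T}\text{-}\mathrm{Alg}(\mathscr{C})=[\mathscr{T},\mathscr{C}]_{\mathscr{J}}$ is the full sub-$\mathscr{V}'$-category of $[\mathscr{T},\mathscr{C}]$ on the $\mathscr{T}$-algebras; for a morphism $f$ in it, $|f|=f_I$. $\mathscr{C}$ is $\mathscr{J}$-admissible if it has $\mathscr{J}$-cotensors and for every $\mathscr{J}$-theory $\mathscr{T}$ the ends defining the hom-objects of $\mathscr{T}\text{-}\mathrm{Alg}(\mathscr{C})$ exist in $\mathscr{V}$ (so it is a $\mathscr{V}$-category). $\mathscr{J}$-cotensors in $\mathscr{T}\text{-}\mathrm{Alg}(\mathscr{C})$ are pointwise, with designated ones chosen so that evaluation at $I$ sends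 them to the designated ones in $\mathscr{C}$. Algebras on an object. An algebra in $\mathscr{C}$ is a pair $(\mathscr{T},A)$ (also written $A$) with $\mathscr{T}$ a $\mathscr{J}$-theory and $A$ a $\mathscr{T}$-algebra in $\mathscr{C}$. For an object $C$ of $\mathscr{C}$, $\mathrm{Alg}(C)$ is the category whose objects are algebras with carrier $C$, where a morphism $(M,f):(\mathscr{T},A)\to(\mathscr{U},B)$ consists of a morphism of $\mathscr{J}$-theories $M:\mathscr{T}\to\mathscr{U}$ and an isomorphism $f:A\to BM$ of $\mathscr{T}$-algebras with $|f|=1_C$. Commutants. The commutant of $(\mathscr{T},A)$ is the algebra $(\mathscr{T},A)^\perp=(\mathscr{T}^\perp_A,A^\perp)$ (written $A^\perp$), where $\mathscr{T}^\perp_A$ is the $\mathscr{J}$-theory with $\mathscr{T}^\perp_A(J,K)=\mathscr{T}\text{-}\mathrm{Alg}(\mathscr{C})([J,A],[K,A])$ for $J,K\in\mathrm{ob}\,\mathscr{J}$, with composition and identities as in $\mathscr{T}\text{-}\mathrm{Alg}(\mathscr{C})$ and structure morphisms $J\to\mathscr{T}\text{-}\mathrm{Alg}(\mathscr{C})([J,A],A)$ the cotensor counits, and $A^\perp:\mathscr{T}^\perp_A\to\mathscr{C}$ is the algebra on $|A|$ given on objects by $J\mapsto[J,|A|]$ and on homs by evaluation at $I$. Bifold algebras. For $\mathscr{J}$-theories $\mathscr{T},\mathscr{U}$, a $(\mathscr{T},\mathscr{U})$-algebra in $\mathscr{C}$ is a $\mathscr{V}$-functor $D:\mathscr{T}\otimes\mathscr{U}\to\mathscr{C}$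 preserving $\mathscr{J}$-cotensors in each variable separately. A bifold algebra is a triple $(\mathscr{T},\mathscr{U},D)$ with $D$ such; its carrier is $|D|=D(I,I)$. Its left face is the algebra $(\mathscr{T},D_\ell)$ with $D_\ell=D(-,I)$, and its right face is $(\mathscr{U},D_r)$ with $D_r=D(I,-)$. The transposes $D_{\ell r}:\mathscr{T}\to[\mathscr{U},\mathscr{C}]_{\mathscr{J}}$ and $D_{r\ell}:\mathscr{U}\to[\mathscr{T},\mathscr{C}]_{\mathscr{J}}$ are the $\mathscr{V}$-functors with $(D_{\ell r}J)K=D(J,K)=(D_{r\ell}K)J$, $\mathscr{V}$-naturally in $J\in\mathscr{T}$, $K\in\mathscr{U}$. With $C=|D|$, $D$ is right-commutant if $D_r\cong D_\ell^\perp$ in $\mathrm{Alg}(C)$, and left-commutant if $D_\ell\cong D_r^\perp$ in $\mathrm{Alg}(C)$. *)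

theory Defs
  imports Main "HOL-Library.FuncSet"
begin

section \<open>Symmetric monoidal closed categories\<close>

text \<open>The objects of the base category are the elements of a type and its arrows are the elements
  of another type. Composition is unconstrained on pairs that are not composable.
  \<open>Ihom X Y\<close> is the internal hom \<open>[X, Y]\<close>, with evaluation \<open>Ev X Y : [X, Y] \<otimes> X \<rightarrow> Y\<close>.\<close>

record ('o, 'm) smc =
  Dom :: "'m \<Rightarrow> 'o"
  Cod :: "'m \<Rightarrow> 'o"
  Idn :: "'o \<Rightarrow> 'm" ("\<one>\<index>")
  Cmp :: "'m \<Rightarrow> 'm \<Rightarrow> 'm" (infixr "\<cdot>\<index>" 60)
  TenO :: "'o \<Rightarrow> 'o \<Rightarrow> 'o" (infixr "\<otimes>\<index>" 75)
  TenA :: "'m \<Rightarrow> 'm \<Rightarrow> 'm" (infixr "\<odot>\<index>" 75)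
  Unt :: "'o" ("\<I>\<index>")
  Asc :: "'o \<Rightarrow> 'o \<Rightarrow> 'o \<Rightarrow> 'm"
  Lun :: "'o \<Rightarrow> 'm"
  Run :: "'o \<Rightarrow> 'm"
  Sym :: "'o \<Rightarrow> 'o \<Rightarrow> 'm"
  Ihom :: "'o \<Rightarrow> 'o \<Rightarrow> 'o"
  Ev :: "'o \<Rightarrow> 'o \<Rightarrow> 'm"

definition hom :: "('o, 'm) smc \<Rightarrow> 'o \<Rightarrow> 'o \<Rightarrow> 'm set" where
  "hom V X Y = {f. Dom V f = X \<and> Cod V f = Y}"

definition inverse_arrows :: "('o, 'm) smc \<Rightarrow> 'm \<Rightarrow> 'm \<Rightarrow> bool" where
  "inverse_arrows V f g \<longleftrightarrow>
     Dom V g = Cod V f \<and> Cod V g = Dom V f \<and>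
     Cmp V g f = Idn V (Dom V f) \<and> Cmp V f g = Idn V (Cod V f)"

definition iso :: "('o, 'm) smc \<Rightarrow> 'm \<Rightarrow> bool" where
  "iso V f \<longleftrightarrow> (\<exists>g. inverse_arrows V f g)"

definition inv_arr :: "('o, 'm) smc \<Rightarrow> 'm \<Rightarrow> 'm" where
  "inv_arr V f = (THE g. inverse_arrows V f g)"

locale symmetric_monoidal_closed =
  fixes V :: "('o, 'm) smc" (structure)
  assumes id_hom: "\<one> X \<in> hom V X X"
    and comp_hom: "\<lbrakk>f \<in> hom V X Y; g \<in> hom V Y Z\<rbrakk> \<Longrightarrow> g \<cdot> f \<in> hom V X Z"
    and comp_id: "f \<in> hom V X Y \<Longrightarrow> f \<cdot> \<one> X = f"
    and id_comp: "f \<in> hom V X Y \<Longrightarrow> \<one> Y \<cdot> f = f"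
    and comp_assoc: "\<lbrakk>f \<in> hom V W X; g \<in> hom V X Y; h \<in> hom V Y Z\<rbrakk>
           \<Longrightarrow> (h \<cdot> g) \<cdot> f = h \<cdot> (g \<cdot> f)"
    and ten_hom: "\<lbrakk>f \<in> hom V X Y; g \<in> hom V X' Y'\<rbrakk> \<Longrightarrow> f \<odot> g \<in> hom V (X \<otimes> X') (Y \<otimes> Y')"
    and ten_id: "\<one> X \<odot> \<one> Y = \<one> (X \<otimes> Y)"
    and ten_comp: "\<lbrakk>f \<in> hom V X Y; g \<in> hom V Y Z; f' \<in> hom V X' Y'; g' \<in> hom V Y' Z'\<rbrakk>
           \<Longrightarrow> (g \<cdot> f) \<odot> (g' \<cdot> f') = (g \<odot> g') \<cdot> (f \<odot> f')"
    and asc_hom: "Asc V X Y Z \<in> hom V ((X \<otimes> Y) \<otimes> Z) (X \<otimes> (Y \<otimes> Z))"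
    and asc_iso: "iso V (Asc V X Y Z)"
    and asc_nat: "\<lbrakk>f \<in> hom V X X'; g \<in> hom V Y Y'; h \<in> hom V Z Z'\<rbrakk>
           \<Longrightarrow> Asc V X' Y' Z' \<cdot> ((f \<odot> g) \<odot> h) = (f \<odot> (g \<odot> h)) \<cdot> Asc V X Y Z"
    and lun_hom: "Lun V X \<in> hom V (\<I> \<otimes> X) X"
    and lun_iso: "iso V (Lun V X)"
    and lun_nat: "f \<in> hom V X Y \<Longrightarrow> Lun V Y \<cdot> (\<one> \<I> \<odot> f) = f \<cdot> Lun V X"
    and run_hom: "Run V X \<in> hom V (X \<otimes> \<I>) X"
    and run_iso: "iso V (Run V X)"
    and run_nat: "f \<in> hom V X Y \<Longrightarrow> Run V Y \<cdot> (f \<odot> \<one> \<I>) = f \<cdot> Run V X"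
    and pentagon: "(\<one> W \<odot> Asc V X Y Z) \<cdot> Asc V W (X \<otimes> Y) Z \<cdot> (Asc V W X Y \<odot> \<one> Z)
           = Asc V W X (Y \<otimes> Z) \<cdot> Asc V (W \<otimes> X) Y Z"
    and triangle: "(\<one> X \<odot> Lun V Y) \<cdot> Asc V X \<I> Y = Run V X \<odot> \<one> Y"
    and sym_hom: "Sym V X Y \<in> hom V (X \<otimes> Y) (Y \<otimes> X)"
    and sym_nat: "\<lbrakk>f \<in> hom V X X'; g \<in> hom V Y Y'\<rbrakk>
           \<Longrightarrow> Sym V X' Y' \<cdot> (f \<odot> g) = (g \<odot> f) \<cdot> Sym V X Y"
    and sym_sym: "Sym V Y X \<cdot> Sym V X Y = \<one> (X \<otimes> Y)"
    and hexagon: "Asc V Y Z X \<cdot> Sym V X (Y \<otimes> Z) \<cdot> Asc V X Y Z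
           = (\<one> Y \<odot> Sym V X Z) \<cdot> Asc V Y X Z \<cdot> (Sym V X Y \<odot> \<one> Z)"
    and ev_hom: "Ev V X Y \<in> hom V (Ihom V X Y \<otimes> X) Y"
    and ev_universal: "f \<in> hom V (Z \<otimes> X) Y
           \<Longrightarrow> \<exists>!g. g \<in> hom V Z (Ihom V X Y) \<and> Ev V X Y \<cdot> (g \<odot> \<one> X) = f"

definition is_pullback :: "('o, 'm) smc \<Rightarrow> 'm \<Rightarrow> 'm \<Rightarrow> 'm \<Rightarrow> 'm \<Rightarrow> bool" where
  "is_pullback V f g p q \<longleftrightarrow>
     Dom V p = Dom V q \<and> Cod V p = Dom V f \<and> Cod V q = Dom V g \<and>
     Cmp V f p = Cmp V g q \<and>
     (\<forall>X. \<forall>a \<in> hom V X (Dom V f). \<forall>b \<in> hom V X (Dom V g). Cmp V f a = Cmp V g b \<longrightarrow>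
        (\<exists>!h. h \<in> hom V X (Dom V p) \<and> Cmp V p h = a \<and> Cmp V q h = b))"

definition has_pullbacks :: "('o, 'm) smc \<Rightarrow> bool" where
  "has_pullbacks V \<longleftrightarrow> (\<forall>f g. Cod V f = Cod V g \<longrightarrow> (\<exists>p q. is_pullback V f g p q))"

section \<open>Enriched categories and functors\<close>

text \<open>\<open>Jd X a : I \<rightarrow> X(a, a)\<close> is the identity element and
  \<open>Mu X a b c : X(b, c) \<otimes> X(a, b) \<rightarrow> X(a, c)\<close> is composition.\<close>

record ('a, 'o, 'm) vcat =
  Obj :: "'a set"
  Hom :: "'a \<Rightarrow> 'a \<Rightarrow> 'o"
  Jd :: "'a \<Rightarrow> 'm"
  Mu :: "'a \<Rightarrow> 'a \<Rightarrow> 'a \<Rightarrow> 'm"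

record ('a, 'b, 'm) vfun =
  Fo :: "'a \<Rightarrow> 'b"
  Fh :: "'a \<Rightarrow> 'a \<Rightarrow> 'm"

text \<open>A \<open>V\<close>-functor is represented by functions that are undefined away from the objects of its
  domain, so that equality of \<open>V\<close>-functors is equality of their representations.\<close>

definition mk_vfun :: "'a set \<Rightarrow> ('a \<Rightarrow> 'b) \<Rightarrow> ('a \<Rightarrow> 'a \<Rightarrow> 'm) \<Rightarrow> ('a, 'b, 'm) vfun" where
  "mk_vfun S p h = \<lparr>Fo = restrict p S,
                     Fh = (\<lambda>a b. if a \<in> S \<and> b \<in> S then h a b else undefined)\<rparr>"

text \<open>In the next block \<open>V\<close> is an implicit first argument of every constant.\<close>

context
  fixes V :: "('o, 'm) smc" (structure)
begin

definition curry_arr :: "'o \<Rightarrow> 'o \<Rightarrow> 'o \<Rightarrow> 'm \<Rightarrow> 'm" where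
  "curry_arr Z X Y f = (THE g. g \<in> hom V Z (Ihom V X Y) \<and> Ev V X Y \<cdot> (g \<odot> \<one> X) = f)"

definition mid4 :: "'o \<Rightarrow> 'o \<Rightarrow> 'o \<Rightarrow> 'o \<Rightarrow> 'm" where
  \<comment> \<open>\<open>(W \<otimes> X) \<otimes> (Y \<otimes> Z) \<rightarrow> (W \<otimes> Y) \<otimes> (X \<otimes> Z)\<close>\<close>
  "mid4 W X Y Z =
     inv_arr V (Asc V W Y (X \<otimes> Z)) \<cdot>
     (\<one> W \<odot> (Asc V Y X Z \<cdot> (Sym V X Y \<odot> \<one> Z) \<cdot> inv_arr V (Asc V X Y Z))) \<cdot>
     Asc V W X (Y \<otimes> Z)"

definition vcategory :: "('a, 'o, 'm, 'z) vcat_scheme \<Rightarrow> bool" where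
  "vcategory X \<longleftrightarrow>
     (\<forall>a \<in> Obj X. Jd X a \<in> hom V \<I> (Hom X a a)) \<and>
     (\<forall>a \<in> Obj X. \<forall>b \<in> Obj X. \<forall>c \<in> Obj X.
        Mu X a b c \<in> hom V (Hom X b c \<otimes> Hom X a b) (Hom X a c)) \<and>
     (\<forall>a \<in> Obj X. \<forall>b \<in> Obj X. \<forall>c \<in> Obj X. \<forall>d \<in> Obj X.
        Mu X a b d \<cdot> (Mu X b c d \<odot> \<one> (Hom X a b)) =
        Mu X a c d \<cdot> (\<one> (Hom X c d) \<odot> Mu X a b c) \<cdot> Asc V (Hom X c d) (Hom X b c) (Hom X a b)) \<and>
     (\<forall>a \<in> Obj X. \<forall>b \<in> Obj X.
        Mu X a b b \<cdot> (Jd X b \<odot> \<one> (Hom X a b)) = Lun V (Hom X a b) \<and>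
        Mu X a a b \<cdot> (\<one> (Hom X a b) \<odot> Jd X a) = Run V (Hom X a b))"

definition vfunctor ::
    "('a, 'o, 'm, 'y) vcat_scheme \<Rightarrow> ('b, 'o, 'm, 'z) vcat_scheme \<Rightarrow> ('a, 'b, 'm) vfun \<Rightarrow> bool" where
  "vfunctor X Y F \<longleftrightarrow>
     F = mk_vfun (Obj X) (Fo F) (Fh F) \<and>
     (\<forall>a \<in> Obj X. Fo F a \<in> Obj Y) \<and>
     (\<forall>a \<in> Obj X. \<forall>b \<in> Obj X. Fh F a b \<in> hom V (Hom X a b) (Hom Y (Fo F a) (Fo F b))) \<and>
     (\<forall>a \<in> Obj X. Fh F a a \<cdot> Jd X a = Jd Y (Fo F a)) \<and>
     (\<forall>a \<in> Obj X. \<forall>b \<in> Obj X. \<forall>c \<in> Obj X.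
        Fh F a c \<cdot> Mu X a b c = Mu Y (Fo F a) (Fo F b) (Fo F c) \<cdot> (Fh F b c \<odot> Fh F a b))"

definition fully_faithful ::
    "('a, 'o, 'm, 'y) vcat_scheme \<Rightarrow> ('b, 'o, 'm, 'z) vcat_scheme \<Rightarrow> ('a, 'b, 'm) vfun \<Rightarrow> bool" where
  "fully_faithful X Y F \<longleftrightarrow>
     vfunctor X Y F \<and> (\<forall>a \<in> Obj X. \<forall>b \<in> Obj X. iso V (Fh F a b))"

definition vfun_id :: "('a, 'o, 'm, 'y) vcat_scheme \<Rightarrow> ('a, 'a, 'm) vfun" where
  "vfun_id X = mk_vfun (Obj X) (\<lambda>a. a) (\<lambda>a b. \<one> (Hom X a b))"

definition vfun_comp ::
    "('a, 'o, 'm, 'y) vcat_scheme \<Rightarrow> ('b, 'c, 'm) vfun \<Rightarrow> ('a, 'b, 'm) vfun \<Rightarrow> ('a, 'c, 'm) vfun" where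
  \<comment> \<open>\<open>G \<circ> F\<close>, where \<open>X\<close> is the domain of \<open>F\<close>\<close>
  "vfun_comp X G F =
     mk_vfun (Obj X) (\<lambda>a. Fo G (Fo F a)) (\<lambda>a b. Fh G (Fo F a) (Fo F b) \<cdot> Fh F a b)"

definition opposite :: "('a, 'o, 'm) vcat \<Rightarrow> ('a, 'o, 'm) vcat" where
  "opposite X = \<lparr>Obj = Obj X, Hom = (\<lambda>a b. Hom X b a), Jd = Jd X,
                  Mu = (\<lambda>a b c. Mu X c b a \<cdot> Sym V (Hom X c b) (Hom X b a))\<rparr>"

definition self_enriched :: "('o, 'o, 'm) vcat" where
  "self_enriched =
     \<lparr>Obj = UNIV,
      Hom = Ihom V,
      Jd = (\<lambda>X. curry_arr \<I> X X (Lun V X)),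
      Mu = (\<lambda>X Y Z. curry_arr (Ihom V Y Z \<otimes> Ihom V X Y) X Z
              (Ev V Y Z \<cdot> (\<one> (Ihom V Y Z) \<odot> Ev V X Y) \<cdot> Asc V (Ihom V Y Z) (Ihom V X Y) X))\<rparr>"

definition tensor_vcat ::
    "('a, 'o, 'm, 'y) vcat_scheme \<Rightarrow> ('b, 'o, 'm, 'z) vcat_scheme \<Rightarrow> ('a \<times> 'b, 'o, 'm) vcat" where
  "tensor_vcat X Y =
     \<lparr>Obj = Obj X \<times> Obj Y,
      Hom = (\<lambda>(a, b) (a', b'). Hom X a a' \<otimes> Hom Y b b'),
      Jd = (\<lambda>(a, b). (Jd X a \<odot> Jd Y b) \<cdot> inv_arr V (Lun V \<I>)),
      Mu = (\<lambda>(a, b) (a', b') (a'', b'').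
              (Mu X a a' a'' \<odot> Mu Y b b' b'') \<cdot>
              mid4 (Hom X a' a'') (Hom Y b' b'') (Hom X a a') (Hom Y b b'))\<rparr>"

text \<open>For \<open>D : X \<otimes> Y \<rightarrow> Z\<close>, these are the partial \<open>V\<close>-functors \<open>D(-, b)\<close> and \<open>D(a, -)\<close>.\<close>

definition fix_right ::
    "('a, 'o, 'm, 'y) vcat_scheme \<Rightarrow> ('b, 'o, 'm, 'z) vcat_scheme \<Rightarrow> ('a \<times> 'b, 'c, 'm) vfun \<Rightarrow> 'b
      \<Rightarrow> ('a, 'c, 'm) vfun" where
  "fix_right X Y D b = mk_vfun (Obj X) (\<lambda>a. Fo D (a, b))
     (\<lambda>a a'. Fh D (a, b) (a', b) \<cdot> (\<one> (Hom X a a') \<odot> Jd Y b) \<cdot> inv_arr V (Run V (Hom X a a')))"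

definition fix_left ::
    "('a, 'o, 'm, 'y) vcat_scheme \<Rightarrow> ('b, 'o, 'm, 'z) vcat_scheme \<Rightarrow> ('a \<times> 'b, 'c, 'm) vfun \<Rightarrow> 'a
      \<Rightarrow> ('b, 'c, 'm) vfun" where
  "fix_left X Y D a = mk_vfun (Obj Y) (\<lambda>b. Fo D (a, b))
     (\<lambda>b b'. Fh D (a, b) (a, b') \<cdot> (Jd X a \<odot> \<one> (Hom Y b b')) \<cdot> inv_arr V (Lun V (Hom Y b b')))"

section \<open>Enriched natural transformations and functor categories\<close>

text \<open>A family \<open>\<alpha> a : Z \<rightarrow> Y(F a, G a)\<close> that is extraordinarily \<open>V\<close>-natural in \<open>a\<close>. The condition is
  stated as an equality of arrows \<open>X(a, b) \<otimes> Z \<rightarrow> Y(F a, G b)\<close>, the transpose of the equality of arrows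
  \<open>Z \<rightarrow> [X(a, b), Y(F a, G b)]\<close> that defines an end.\<close>

definition vnat_family ::
    "('a, 'o, 'm, 'y) vcat_scheme \<Rightarrow> ('b, 'o, 'm, 'z) vcat_scheme \<Rightarrow> ('a, 'b, 'm) vfun
      \<Rightarrow> ('a, 'b, 'm) vfun \<Rightarrow> 'o \<Rightarrow> ('a \<Rightarrow> 'm) \<Rightarrow> bool" where
  "vnat_family X Y F G Z \<alpha> \<longleftrightarrow>
     (\<forall>a \<in> Obj X. \<alpha> a \<in> hom V Z (Hom Y (Fo F a) (Fo G a))) \<and>
     (\<forall>a \<in> Obj X. \<forall>b \<in> Obj X.
        Mu Y (Fo F a) (Fo F b) (Fo G b) \<cdot> (\<alpha> b \<odot> Fh F a b) \<cdot> Sym V (Hom X a b) Z =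
        Mu Y (Fo F a) (Fo G a) (Fo G b) \<cdot> (Fh G a b \<odot> \<alpha> a))"

text \<open>\<open>E\<close> with projections \<open>\<pi>\<close> is the end of \<open>Y(F a, G a)\<close> over \<open>a\<close> in \<open>X\<close>.\<close>

definition is_end ::
    "('a, 'o, 'm, 'y) vcat_scheme \<Rightarrow> ('b, 'o, 'm, 'z) vcat_scheme \<Rightarrow> ('a, 'b, 'm) vfun
      \<Rightarrow> ('a, 'b, 'm) vfun \<Rightarrow> 'o \<Rightarrow> ('a \<Rightarrow> 'm) \<Rightarrow> bool" where
  "is_end X Y F G E \<pi> \<longleftrightarrow>
     vnat_family X Y F G E \<pi> \<and>
     (\<forall>Z \<alpha>. vnat_family X Y F G Z \<alpha> \<longrightarrow>
        (\<exists>!h. h \<in> hom V Z E \<and> (\<forall>a \<in> Obj X. \<pi> a \<cdot> h = \<alpha> a)))"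

definition some_end ::
    "('a, 'o, 'm, 'y) vcat_scheme \<Rightarrow> ('b, 'o, 'm, 'z) vcat_scheme \<Rightarrow> ('a, 'b, 'm) vfun
      \<Rightarrow> ('a, 'b, 'm) vfun \<Rightarrow> 'o \<times> ('a \<Rightarrow> 'm)" where
  "some_end X Y F G = (SOME (E, \<pi>). is_end X Y F G E \<pi>)"

definition EndOb ::
    "('a, 'o, 'm, 'y) vcat_scheme \<Rightarrow> ('b, 'o, 'm, 'z) vcat_scheme \<Rightarrow> ('a, 'b, 'm) vfun
      \<Rightarrow> ('a, 'b, 'm) vfun \<Rightarrow> 'o" where
  "EndOb X Y F G = fst (some_end X Y F G)"

definition EndPr ::
    "('a, 'o, 'm, 'y) vcat_scheme \<Rightarrow> ('b, 'o, 'm, 'z) vcat_scheme \<Rightarrow> ('a, 'b, 'm) vfun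
      \<Rightarrow> ('a, 'b, 'm) vfun \<Rightarrow> 'a \<Rightarrow> 'm" where
  "EndPr X Y F G = snd (some_end X Y F G)"

definition end_arr ::
    "('a, 'o, 'm, 'y) vcat_scheme \<Rightarrow> ('b, 'o, 'm, 'z) vcat_scheme \<Rightarrow> ('a, 'b, 'm) vfun
      \<Rightarrow> ('a, 'b, 'm) vfun \<Rightarrow> 'o \<Rightarrow> ('a \<Rightarrow> 'm) \<Rightarrow> 'm" where
  \<comment> \<open>the arrow into the end induced by a \<open>V\<close>-natural family\<close>
  "end_arr X Y F G Z \<alpha> =
     (THE h. h \<in> hom V Z (EndOb X Y F G) \<and> (\<forall>a \<in> Obj X. EndPr X Y F G a \<cdot> h = \<alpha> a))"

text \<open>The full sub-\<open>V\<close>-category of \<open>[X, Y]\<close> on a set \<open>S\<close> of \<open>V\<close>-functors, when the ends defining its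
  hom-objects exist in \<open>V\<close>.\<close>

definition functor_vcat ::
    "('a, 'o, 'm, 'y) vcat_scheme \<Rightarrow> ('b, 'o, 'm, 'z) vcat_scheme \<Rightarrow> ('a, 'b, 'm) vfun set
      \<Rightarrow> (('a, 'b, 'm) vfun, 'o, 'm) vcat" where
  "functor_vcat X Y S =
     \<lparr>Obj = S,
      Hom = EndOb X Y,
      Jd = (\<lambda>F. end_arr X Y F F \<I> (\<lambda>a. Jd Y (Fo F a))),
      Mu = (\<lambda>F G H. end_arr X Y F H (EndOb X Y G H \<otimes> EndOb X Y F G)
              (\<lambda>a. Mu Y (Fo F a) (Fo G a) (Fo H a) \<cdot> (EndPr X Y G H a \<odot> EndPr X Y F G a)))\<rparr>"

definition vnat ::
    "('a, 'o, 'm, 'y) vcat_scheme \<Rightarrow> ('b, 'o, 'm, 'z) vcat_scheme \<Rightarrow> ('a, 'b, 'm) vfun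
      \<Rightarrow> ('a, 'b, 'm) vfun \<Rightarrow> ('a \<Rightarrow> 'm) \<Rightarrow> bool" where
  \<comment> \<open>\<open>V\<close>-natural transformations \<open>F \<rightarrow> G\<close>\<close>
  "vnat X Y F G f \<longleftrightarrow> f \<in> extensional (Obj X) \<and> vnat_family X Y F G \<I> f"

definition vnat_id ::
    "('a, 'o, 'm, 'y) vcat_scheme \<Rightarrow> ('b, 'o, 'm, 'z) vcat_scheme \<Rightarrow> ('a, 'b, 'm) vfun
      \<Rightarrow> 'a \<Rightarrow> 'm" where
  "vnat_id X Y F = (\<lambda>a \<in> Obj X. Jd Y (Fo F a))"

definition vnat_comp ::
    "('a, 'o, 'm, 'y) vcat_scheme \<Rightarrow> ('b, 'o, 'm, 'z) vcat_scheme \<Rightarrow> ('a, 'b, 'm) vfun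
      \<Rightarrow> ('a, 'b, 'm) vfun \<Rightarrow> ('a, 'b, 'm) vfun \<Rightarrow> ('a \<Rightarrow> 'm) \<Rightarrow> ('a \<Rightarrow> 'm) \<Rightarrow> 'a \<Rightarrow> 'm" where
  \<comment> \<open>\<open>g \<circ> f\<close> for \<open>f : F \<rightarrow> G\<close> and \<open>g : G \<rightarrow> H\<close>\<close>
  "vnat_comp X Y F G H g f =
     (\<lambda>a \<in> Obj X. Mu Y (Fo F a) (Fo G a) (Fo H a) \<cdot> (g a \<odot> f a) \<cdot> inv_arr V (Lun V \<I>))"

definition vnat_iso ::
    "('a, 'o, 'm, 'y) vcat_scheme \<Rightarrow> ('b, 'o, 'm, 'z) vcat_scheme \<Rightarrow> ('a, 'b, 'm) vfun
      \<Rightarrow> ('a, 'b, 'm) vfun \<Rightarrow> ('a \<Rightarrow> 'm) \<Rightarrow> bool" where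
  "vnat_iso X Y F G f \<longleftrightarrow>
     vnat X Y F G f \<and>
     (\<exists>g. vnat X Y G F g \<and>
        vnat_comp X Y F G F g f = vnat_id X Y F \<and>
        vnat_comp X Y G F G f g = vnat_id X Y G)"

section \<open>Cotensors\<close>

text \<open>\<open>\<gamma> : K \<rightarrow> X(p, c)\<close> exhibits \<open>p\<close> as a cotensor \<open>[K, c]\<close> in \<open>X\<close>: the induced arrows
  \<open>X(b, p) \<rightarrow> [K, X(b, c)]\<close> are invertible.\<close>

definition is_cotensor ::
    "('a, 'o, 'm, 'y) vcat_scheme \<Rightarrow> 'o \<Rightarrow> 'a \<Rightarrow> 'a \<Rightarrow> 'm \<Rightarrow> bool" where
  "is_cotensor X K c p \<gamma> \<longleftrightarrow>
     c \<in> Obj X \<and> p \<in> Obj X \<and> \<gamma> \<in> hom V K (Hom X p c) \<and>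
     (\<forall>b \<in> Obj X.
        iso V (curry_arr (Hom X b p) K (Hom X b c)
                 (Mu X b p c \<cdot> (\<gamma> \<odot> \<one> (Hom X b p)) \<cdot> Sym V (Hom X b p) K)))"

text \<open>For a cotensor \<open>(p, \<gamma>)\<close> as above and \<open>k : Z \<otimes> K \<rightarrow> X(b, c)\<close>, the corresponding arrow
  \<open>Z \<rightarrow> X(b, p)\<close>.\<close>

definition cotensor_arr ::
    "('a, 'o, 'm, 'y) vcat_scheme \<Rightarrow> 'o \<Rightarrow> 'a \<Rightarrow> 'a \<Rightarrow> 'm \<Rightarrow> 'o \<Rightarrow> 'a \<Rightarrow> 'm \<Rightarrow> 'm" where
  "cotensor_arr X K c p \<gamma> Z b k =
     (THE h. h \<in> hom V Z (Hom X b p) \<and> Mu X b p c \<cdot> (\<gamma> \<odot> h) \<cdot> Sym V Z K = k)"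

definition preserves_cotensors ::
    "'o set \<Rightarrow> ('a, 'o, 'm, 'y) vcat_scheme \<Rightarrow> ('b, 'o, 'm, 'z) vcat_scheme
      \<Rightarrow> ('a, 'b, 'm) vfun \<Rightarrow> bool" where
  "preserves_cotensors J X Y F \<longleftrightarrow>
     (\<forall>K \<in> J. \<forall>c p \<gamma>. is_cotensor X K c p \<gamma> \<longrightarrow>
        is_cotensor Y K (Fo F c) (Fo F p) (Fh F p c \<cdot> \<gamma>))"

end

text \<open>\<open>V\<close>-categories with designated cotensors \<open>Cot C K c = [K, c]\<close> and counits
  \<open>Cun C K c : K \<rightarrow> C([K, c], c)\<close>.\<close>

record ('c, 'o, 'm) cvcat = "('c, 'o, 'm) vcat" +
  Cot :: "'o \<Rightarrow> 'c \<Rightarrow> 'c"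
  Cun :: "'o \<Rightarrow> 'c \<Rightarrow> 'm"

definition has_cotensors :: "('o, 'm) smc \<Rightarrow> 'o set \<Rightarrow> ('c, 'o, 'm) cvcat \<Rightarrow> bool" where
  "has_cotensors V J C \<longleftrightarrow>
     (\<forall>K \<in> J. \<forall>c \<in> Obj C. is_cotensor V C K c (Cot C K c) (Cun C K c)) \<and>
     (\<forall>c \<in> Obj C. Cot C (Unt V) c = c \<and> Cun C (Unt V) c = Jd C c)"

section \<open>Theories and algebras\<close>

text \<open>The set \<open>J\<close> determines a full sub-\<open>V\<close>-category of \<open>V\<close>, whose inclusion is then a fully
  faithful symmetric strong monoidal \<open>V\<close>-functor.\<close>

definition system_of_arities :: "('o, 'm) smc \<Rightarrow> 'o set \<Rightarrow> bool" where
  "system_of_arities V J \<longleftrightarrow> Unt V \<in> J \<and> (\<forall>X \<in> J. \<forall>Y \<in> J. TenO V X Y \<in> J)"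

record ('o, 'm) jtheory = "('o, 'o, 'm) vcat" +
  Str :: "('o, 'o, 'm) vfun"

type_synonym ('c, 'o, 'm) algebra = "('o, 'm) jtheory \<times> ('o, 'c, 'm) vfun"

context
  fixes V :: "('o, 'm) smc" (structure) and J :: "'o set"
begin

definition arities_op :: "('o, 'o, 'm) vcat" where
  "arities_op = opposite V ((self_enriched V)\<lparr>Obj := J\<rparr>)"

definition is_theory :: "('o, 'm) jtheory \<Rightarrow> bool" where
  "is_theory T \<longleftrightarrow>
     vcategory V T \<and> Obj T = J \<and>
     vfunctor V arities_op T (Str T) \<and> (\<forall>K \<in> J. Fo (Str T) K = K) \<and>
     preserves_cotensors V J arities_op T (Str T)"

definition theory_morphism :: "('o, 'm) jtheory \<Rightarrow> ('o, 'm) jtheory \<Rightarrow> ('o, 'o, 'm) vfun \<Rightarrow> bool" where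
  "theory_morphism T U M \<longleftrightarrow> vfunctor V T U M \<and> vfun_comp V arities_op M (Str T) = Str U"

definition is_algebra :: "('o, 'm) jtheory \<Rightarrow> ('c, 'o, 'm) cvcat \<Rightarrow> ('o, 'c, 'm) vfun \<Rightarrow> bool" where
  "is_algebra T C A \<longleftrightarrow> vfunctor V T C A \<and> preserves_cotensors V J T C A"

definition Alg :: "('o, 'm) jtheory \<Rightarrow> ('c, 'o, 'm) cvcat \<Rightarrow> (('o, 'c, 'm) vfun, 'o, 'm) vcat" where
  "Alg T C = functor_vcat V T C {A. is_algebra T C A}"

definition admissible :: "('c, 'o, 'm) cvcat \<Rightarrow> bool" where
  "admissible C \<longleftrightarrow>
     vcategory V C \<and> has_cotensors V J C \<and>
     (\<forall>T A B. is_theory T \<longrightarrow> is_algebra T C A \<longrightarrow> is_algebra T C B \<longrightarrow>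
        (\<exists>E \<pi>. is_end V T C A B E \<pi>))"

definition carrier :: "('o, 'c, 'm) vfun \<Rightarrow> 'c" where
  "carrier A = Fo A \<I>"

subsection \<open>The category of algebras on an object\<close>

definition algebras_on :: "('c, 'o, 'm) cvcat \<Rightarrow> 'c \<Rightarrow> ('c, 'o, 'm) algebra set" where
  "algebras_on C c = {(T, A). is_theory T \<and> is_algebra T C A \<and> carrier A = c}"

definition algebra_hom ::
    "('c, 'o, 'm) cvcat \<Rightarrow> 'c \<Rightarrow> ('c, 'o, 'm) algebra \<Rightarrow> ('c, 'o, 'm) algebra
      \<Rightarrow> (('o, 'o, 'm) vfun \<times> ('o \<Rightarrow> 'm)) set" where
  "algebra_hom C c = (\<lambda>(T, A) (U, B).
     {(M, f). theory_morphism T U M \<and> vnat_iso V T C A (vfun_comp V T B M) f \<and> f \<I> = Jd C c})"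

definition algebra_id ::
    "('c, 'o, 'm) cvcat \<Rightarrow> ('c, 'o, 'm) algebra \<Rightarrow> ('o, 'o, 'm) vfun \<times> ('o \<Rightarrow> 'm)" where
  "algebra_id C = (\<lambda>(T, A). (vfun_id V T, vnat_id T C A))"

definition algebra_comp ::
    "('c, 'o, 'm) cvcat \<Rightarrow> ('c, 'o, 'm) algebra \<Rightarrow> ('c, 'o, 'm) algebra \<Rightarrow> ('c, 'o, 'm) algebra
      \<Rightarrow> ('o, 'o, 'm) vfun \<times> ('o \<Rightarrow> 'm) \<Rightarrow> ('o, 'o, 'm) vfun \<times> ('o \<Rightarrow> 'm)
      \<Rightarrow> ('o, 'o, 'm) vfun \<times> ('o \<Rightarrow> 'm)" where
  \<comment> \<open>\<open>(N, g) \<circ> (M, f) = (N M, (g M) \<circ> f)\<close>\<close>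
  "algebra_comp C = (\<lambda>(T, A) (U, B) (W, E) (N, g) (M, f).
     (vfun_comp V T N M,
      vnat_comp V T C A (vfun_comp V T B M) (vfun_comp V T E (vfun_comp V T N M))
        (\<lambda>K \<in> Obj T. g (Fo M K)) f))"

definition algebra_isomorphic ::
    "('c, 'o, 'm) cvcat \<Rightarrow> 'c \<Rightarrow> ('c, 'o, 'm) algebra \<Rightarrow> ('c, 'o, 'm) algebra \<Rightarrow> bool" where
  "algebra_isomorphic C c P Q \<longleftrightarrow>
     P \<in> algebras_on C c \<and> Q \<in> algebras_on C c \<and>
     (\<exists>\<phi> \<in> algebra_hom C c P Q. \<exists>\<psi> \<in> algebra_hom C c Q P.
        algebra_comp C P Q P \<psi> \<phi> = algebra_id C P \<and>
        algebra_comp C Q P Q \<phi> \<psi> = algebra_id C Q)"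

subsection \<open>Commutants\<close>

text \<open>The action of \<open>[K, -]\<close> on hom-objects, \<open>C(c, d) \<rightarrow> C([K, c], [K, d])\<close>.\<close>

definition cotensor_map :: "('c, 'o, 'm) cvcat \<Rightarrow> 'o \<Rightarrow> 'c \<Rightarrow> 'c \<Rightarrow> 'm" where
  "cotensor_map C K c d =
     cotensor_arr V C K d (Cot C K d) (Cun C K d) (Hom C c d) (Cot C K c)
       (Mu C (Cot C K c) c d \<cdot> (\<one> (Hom C c d) \<odot> Cun C K c))"

text \<open>The pointwise cotensor \<open>[K, A]\<close> of an algebra, formed from the designated cotensors of \<open>C\<close>;
  evaluation at \<open>I\<close> sends it to the designated cotensor of the carrier.\<close>

definition alg_cot ::
    "('o, 'm) jtheory \<Rightarrow> ('c, 'o, 'm) cvcat \<Rightarrow> 'o \<Rightarrow> ('o, 'c, 'm) vfun \<Rightarrow> ('o, 'c, 'm) vfun" where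
  "alg_cot T C K A = mk_vfun (Obj T) (\<lambda>X. Cot C K (Fo A X))
     (\<lambda>X Y. cotensor_map C K (Fo A X) (Fo A Y) \<cdot> Fh A X Y)"

definition alg_cun ::
    "('o, 'm) jtheory \<Rightarrow> ('c, 'o, 'm) cvcat \<Rightarrow> 'o \<Rightarrow> ('o, 'c, 'm) vfun \<Rightarrow> 'm" where
  "alg_cun T C K A = end_arr V T C (alg_cot T C K A) A K (\<lambda>X. Cun C K (Fo A X))"

text \<open>The structure \<open>V\<close>-functor of the commutant theory acts on homs by the arrows
  \<open>[Y, X] \<rightarrow> Alg([X, A], [Y, A])\<close> whose transposes are
  \<open>[Y, X] \<otimes> Y \<rightarrow> X \<rightarrow> Alg([X, A], A)\<close>, evaluation followed by the cotensor counit. It is the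
  identity-on-objects \<open>V\<close>-functor whose structure arrows \<open>X \<rightarrow> Alg([X, A], A)\<close> are the counits.\<close>

definition commutant_theory ::
    "('c, 'o, 'm) cvcat \<Rightarrow> ('c, 'o, 'm) algebra \<Rightarrow> ('o, 'm) jtheory" where
  "commutant_theory C = (\<lambda>(T, A).
     \<lparr>Obj = J,
      Hom = (\<lambda>X Y. Hom (Alg T C) (alg_cot T C X A) (alg_cot T C Y A)),
      Jd = (\<lambda>X. Jd (Alg T C) (alg_cot T C X A)),
      Mu = (\<lambda>X Y Z. Mu (Alg T C) (alg_cot T C X A) (alg_cot T C Y A) (alg_cot T C Z A)),
      Str = mk_vfun J (\<lambda>X. X)
        (\<lambda>X Y. cotensor_arr V (Alg T C) Y A (alg_cot T C Y A) (alg_cun T C Y A)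
                 (Ihom V Y X) (alg_cot T C X A) (alg_cun T C X A \<cdot> Ev V Y X))\<rparr>)"

definition commutant :: "('c, 'o, 'm) cvcat \<Rightarrow> ('c, 'o, 'm) algebra \<Rightarrow> ('c, 'o, 'm) algebra" where
  "commutant C = (\<lambda>(T, A).
     (commutant_theory C (T, A),
      mk_vfun J (\<lambda>X. Cot C X (carrier A))
        (\<lambda>X Y. EndPr V T C (alg_cot T C X A) (alg_cot T C Y A) \<I>)))"

subsection \<open>Bifold algebras\<close>

definition bifold_algebra ::
    "('c, 'o, 'm) cvcat \<Rightarrow> ('o, 'm) jtheory \<Rightarrow> ('o, 'm) jtheory \<Rightarrow> ('o \<times> 'o, 'c, 'm) vfun \<Rightarrow> bool" where
  "bifold_algebra C T U D \<longleftrightarrow>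
     is_theory T \<and> is_theory U \<and> vfunctor V (tensor_vcat V T U) C D \<and>
     (\<forall>Y \<in> Obj U. preserves_cotensors V J T C (fix_right V T U D Y)) \<and>
     (\<forall>X \<in> Obj T. preserves_cotensors V J U C (fix_left V T U D X))"

definition bicarrier :: "('o \<times> 'o, 'c, 'm) vfun \<Rightarrow> 'c" where
  "bicarrier D = Fo D (\<I>, \<I>)"

definition left_face ::
    "('o, 'm) jtheory \<Rightarrow> ('o, 'm) jtheory \<Rightarrow> ('o \<times> 'o, 'c, 'm) vfun \<Rightarrow> ('c, 'o, 'm) algebra" where
  "left_face T U D = (T, fix_right V T U D \<I>)"

definition right_face ::
    "('o, 'm) jtheory \<Rightarrow> ('o, 'm) jtheory \<Rightarrow> ('o \<times> 'o, 'c, 'm) vfun \<Rightarrow> ('c, 'o, 'm) algebra" where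
  "right_face T U D = (U, fix_left V T U D \<I>)"

text \<open>The transposes \<open>D_{lr} : T \<rightarrow> [U, C]_J\<close> and \<open>D_{rl} : U \<rightarrow> [T, C]_J\<close>.\<close>

definition transpose_lr ::
    "('c, 'o, 'm) cvcat \<Rightarrow> ('o, 'm) jtheory \<Rightarrow> ('o, 'm) jtheory \<Rightarrow> ('o \<times> 'o, 'c, 'm) vfun
      \<Rightarrow> ('o, ('o, 'c, 'm) vfun, 'm) vfun" where
  "transpose_lr C T U D = mk_vfun (Obj T) (fix_left V T U D)
     (\<lambda>X X'. end_arr V U C (fix_left V T U D X) (fix_left V T U D X') (Hom T X X')
                (\<lambda>Y. Fh (fix_right V T U D Y) X X'))"

definition transpose_rl ::
    "('c, 'o, 'm) cvcat \<Rightarrow> ('o, 'm) jtheory \<Rightarrow> ('o, 'm) jtheory \<Rightarrow> ('o \<times> 'o, 'c, 'm) vfun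
      \<Rightarrow> ('o, ('o, 'c, 'm) vfun, 'm) vfun" where
  "transpose_rl C T U D = mk_vfun (Obj U) (fix_right V T U D)
     (\<lambda>Y Y'. end_arr V T C (fix_right V T U D Y) (fix_right V T U D Y') (Hom U Y Y')
                (\<lambda>X. Fh (fix_left V T U D X) Y Y'))"

definition right_commutant ::
    "('c, 'o, 'm) cvcat \<Rightarrow> ('o, 'm) jtheory \<Rightarrow> ('o, 'm) jtheory \<Rightarrow> ('o \<times> 'o, 'c, 'm) vfun \<Rightarrow> bool" where
  "right_commutant C T U D \<longleftrightarrow>
     algebra_isomorphic C (bicarrier D) (right_face T U D) (commutant C (left_face T U D))"

definition left_commutant ::
    "('c, 'o, 'm) cvcat \<Rightarrow> ('o, 'm) jtheory \<Rightarrow> ('o, 'm) jtheory \<Rightarrow> ('o \<times> 'o, 'c, 'm) vfun \<Rightarrow> bool" where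
  "left_commutant C T U D \<longleftrightarrow>
     algebra_isomorphic C (bicarrier D) (left_face T U D) (commutant C (right_face T U D))"

end

end

theory Submission
  imports Defs
begin

text \<open>Write \<open>A = D(-, \<I>)\<close>. Since \<open>D(X, -)\<close> preserves cotensors, \<open>D(X, Y)\<close> is a cotensor of \<open>A X\<close> by \<open>Y\<close>,
  which gives isomorphisms \<open>\<phi> : D(X, Y) \<rightarrow> [Y, A X]\<close>, natural in \<open>X\<close> and trivial for \<open>Y = \<I>\<close>.
  Conjugation by \<open>\<phi>\<close> turns the transpose of \<open>D\<close> into an identity-on-objects functor from \<open>U\<close> to the
  theory of the commutant of \<open>A\<close>. It commutes with the structure functors, and it is invertible
  if and only if the transpose is fully faithful. If it is invertible, then it transports the theory
  structure of \<open>U\<close>, and together with \<open>\<phi>\<close> at \<open>X = \<I>\<close> it is an isomorphism from the right face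
  to the commutant. Conversely, let \<open>(M, f)\<close> be any such isomorphism. Compatibility with the cotensor
  counits forces \<open>f\<close> to be \<open>\<phi>\<close> at \<open>X = \<I>\<close>, hence \<open>M\<close> agrees with the comparison functor after evaluation
  at \<open>\<I>\<close>, and this evaluation is monic on hom-objects of algebras.\<close>

text \<open>That \<open>\<phi>\<close> is trivial at \<open>Y = \<I>\<close> matters because a
  morphism of algebras on an object must be the identity on carriers; the designated cotensors with
  \<open>[\<I>, c] = c\<close> make this possible. Evaluation at \<open>\<I>\<close> is monic
  because every object of a theory is a cotensor of \<open>\<I>\<close>, so naturality along the
  counits recovers all components from that one. The theory axioms of the commutant have different
  sources in the two directions: an isomorphism of algebras has an algebra as its target by
  definition, while an invertible comparison carries the axioms over from \<open>U\<close>.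
  Transport also shows that the pointwise cotensor \<open>[Y, A]\<close> is an algebra, namely the
  conjugate of \<open>D(-, Y)\<close> by \<open>\<phi>\<close>. Hom-objects of algebras are ends
  fixed by choice, so conjugate functors have hom-objects that are isomorphic but need not be equal;
  the comparison has to pass through that isomorphism. The claim about the other transpose is the
  same claim with \<open>T\<close> and \<open>U\<close> exchanged.\<close>

lemma in_hom_iff: "f \<in> hom V X Y \<longleftrightarrow> Dom V f = X \<and> Cod V f = Y"
  by (simp add: hom_def)

section \<open>Typing and normal forms of composites\<close>

context symmetric_monoidal_closed
begin

lemma dom_cod_simps [simp]:
  "Dom V (\<one> X) = X" "Cod V (\<one> X) = X"
  "Dom V (f \<odot> g) = Dom V f \<otimes> Dom V g" "Cod V (f \<odot> g) = Cod V f \<otimes> Cod V g"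
  "Dom V (Asc V X Y Z) = (X \<otimes> Y) \<otimes> Z" "Cod V (Asc V X Y Z) = X \<otimes> (Y \<otimes> Z)"
  "Dom V (Lun V X) = \<I> \<otimes> X" "Cod V (Lun V X) = X"
  "Dom V (Run V X) = X \<otimes> \<I>" "Cod V (Run V X) = X"
  "Dom V (Sym V X Y) = X \<otimes> Y" "Cod V (Sym V X Y) = Y \<otimes> X"
  "Dom V (Ev V X Y) = Ihom V X Y \<otimes> X" "Cod V (Ev V X Y) = Y"
  using id_hom[of X] ten_hom[of f "Dom V f" "Cod V f" g "Dom V g" "Cod V g"] asc_hom[of X Y Z]
    lun_hom[of X] run_hom[of X] sym_hom[of X Y] ev_hom[of X Y]
  by (simp_all add: in_hom_iff)

lemma dom_cod_comp [simp]:
  assumes "Cod V f = Dom V g"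
  shows "Dom V (g \<cdot> f) = Dom V f" "Cod V (g \<cdot> f) = Cod V g"
  using comp_hom[of f "Dom V f" "Cod V f" g "Cod V g"] assms by (simp_all add: in_hom_iff)

lemma comp_assoc' [simp]:
  "\<lbrakk>Cod V f = Dom V g; Cod V g = Dom V h\<rbrakk> \<Longrightarrow> (h \<cdot> g) \<cdot> f = h \<cdot> g \<cdot> f"
  using comp_assoc[of f "Dom V f" "Cod V f" g "Cod V g" h "Cod V h"] by (simp add: in_hom_iff)

lemma comp_id' [simp]: "Dom V f = X \<Longrightarrow> f \<cdot> \<one> X = f"
  using comp_id[of f X "Cod V f"] by (simp add: in_hom_iff)

lemma id_comp' [simp]: "Cod V f = X \<Longrightarrow> \<one> X \<cdot> f = f"
  using id_comp[of f "Dom V f" X] by (simp add: in_hom_iff)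

lemma ten_merge [simp]:
  assumes "Cod V f = Dom V g" "Cod V f' = Dom V g'"
  shows "(g \<odot> g') \<cdot> (f \<odot> f') = (g \<cdot> f) \<odot> (g' \<cdot> f')"
  using assms ten_comp[of f "Dom V f" "Cod V f" g "Cod V g" f' "Dom V f'" "Cod V f'" g' "Cod V g'"]
  by (simp add: in_hom_iff)

text \<open>Composites are kept nested to the right, where a known equation
  \<open>g \<cdot> f = k\<close> no longer matches once something is precomposed. This lemma and the
  next apply such an equation at the head of a longer chain.\<close>

lemma comp_reassoc:
  assumes "g \<cdot> f = k" "Cod V f = Dom V g" "Cod V h = Dom V f"
  shows "g \<cdot> f \<cdot> h = k \<cdot> h"
  using assms comp_assoc' by metis

lemma comp_reassoc2:
  assumes "g \<cdot> f = k \<cdot> l" "Cod V f = Dom V g" "Cod V h = Dom V f"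
    "Cod V l = Dom V k" "Cod V h = Dom V l"
  shows "g \<cdot> f \<cdot> h = k \<cdot> l \<cdot> h"
  using assms comp_assoc' by metis

lemma ten_merge_comp [simp]:
  assumes "Cod V f = Dom V g" "Cod V f' = Dom V g'" "Cod V h = Dom V f \<otimes> Dom V f'"
  shows "(g \<odot> g') \<cdot> (f \<odot> f') \<cdot> h = ((g \<cdot> f) \<odot> (g' \<cdot> f')) \<cdot> h"
  using assms by - (rule comp_reassoc, simp_all)

declare ten_id [simp]

text \<open>Reading the objects off the arrow removes the typing premise, so naturality can be
  instantiated by giving \<open>f\<close> alone.\<close>

lemma lun_nat': "Lun V (Cod V f) \<cdot> (\<one> \<I> \<odot> f) = f \<cdot> Lun V (Dom V f)"
  using lun_nat[of f "Dom V f" "Cod V f"] by (simp add: in_hom_iff)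

lemma run_nat': "Run V (Cod V f) \<cdot> (f \<odot> \<one> \<I>) = f \<cdot> Run V (Dom V f)"
  using run_nat[of f "Dom V f" "Cod V f"] by (simp add: in_hom_iff)

lemma asc_nat': "Asc V (Cod V f) (Cod V g) (Cod V h) \<cdot> ((f \<odot> g) \<odot> h)
    = (f \<odot> (g \<odot> h)) \<cdot> Asc V (Dom V f) (Dom V g) (Dom V h)"
  using asc_nat[of f "Dom V f" "Cod V f" g "Dom V g" "Cod V g" h "Dom V h" "Cod V h"]
  by (simp add: in_hom_iff)

lemma sym_nat': "Sym V (Cod V f) (Cod V g) \<cdot> (f \<odot> g) = (g \<odot> f) \<cdot> Sym V (Dom V f) (Dom V g)"
  using sym_nat[of f "Dom V f" "Cod V f" g "Dom V g" "Cod V g"] by (simp add: in_hom_iff)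

section \<open>Isomorphisms\<close>

lemma inverse_arrows_unique:
  assumes "inverse_arrows V f g" "inverse_arrows V f h"
  shows "g = h"
  using assms comp_id'[of g "Cod V f"] id_comp'[of h "Dom V f"] comp_assoc'[of h f g]
  unfolding inverse_arrows_def by metis

lemma inv_arrI: "inverse_arrows V f g \<Longrightarrow> inv_arr V f = g"
  unfolding inv_arr_def using inverse_arrows_unique by blast

lemma inverse_arrows_inv_arr: "iso V f \<Longrightarrow> inverse_arrows V f (inv_arr V f)"
  unfolding iso_def using inv_arrI by auto

lemma inv_arr_simps [simp]:
  assumes "iso V f"
  shows "Dom V (inv_arr V f) = Cod V f" "Cod V (inv_arr V f) = Dom V f"
    "inv_arr V f \<cdot> f = \<one> (Dom V f)" "f \<cdot> inv_arr V f = \<one> (Cod V f)"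
  using inverse_arrows_inv_arr[OF assms] by (auto simp: inverse_arrows_def)

lemma inv_arr_comp [simp]:
  assumes "iso V f"
  shows "Cod V h = Dom V f \<Longrightarrow> inv_arr V f \<cdot> f \<cdot> h = h"
    "Cod V h = Cod V f \<Longrightarrow> f \<cdot> inv_arr V f \<cdot> h = h"
  using assms by (simp_all add: comp_reassoc[OF inv_arr_simps(3)] comp_reassoc[OF inv_arr_simps(4)])

declare asc_iso [simp] lun_iso [simp] run_iso [simp]

lemma isoI:
  assumes "Dom V g = Cod V f" "Cod V g = Dom V f" "g \<cdot> f = \<one> (Dom V f)" "f \<cdot> g = \<one> (Cod V f)"
  shows "iso V f"
  using assms by (auto simp: iso_def inverse_arrows_def)

lemma iso_id [simp]: "iso V (\<one> X)"
  by (rule isoI[of "\<one> X"]) simp_all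

lemma iso_inv_arr [simp]: "iso V f \<Longrightarrow> iso V (inv_arr V f)"
  by (rule isoI[of f]) simp_all

lemma iso_comp [simp]:
  assumes "iso V f" "iso V g" "Cod V f = Dom V g"
  shows "iso V (g \<cdot> f)"
  by (rule isoI[of "inv_arr V f \<cdot> inv_arr V g"]) (use assms in simp_all)

lemma iso_sym [simp]: "iso V (Sym V X Y)"
  by (rule isoI[of "Sym V Y X"]) (simp_all add: sym_sym)

lemma iso_ten [simp]: "\<lbrakk>iso V f; iso V g\<rbrakk> \<Longrightarrow> iso V (f \<odot> g)"
  by (rule isoI[of "inv_arr V f \<odot> inv_arr V g"]) simp_all

lemma iso_cancel_left:
  assumes "m \<cdot> f = m \<cdot> g" "iso V m" "Cod V f = Dom V m" "Cod V g = Dom V m"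
  shows "f = g"
  using assms inv_arr_comp(1) by metis

lemma iso_cancel_right:
  assumes "f \<cdot> m = g \<cdot> m" "iso V m" "Dom V f = Cod V m" "Dom V g = Cod V m"
  shows "f = g"
proof -
  have "(f \<cdot> m) \<cdot> inv_arr V m = (g \<cdot> m) \<cdot> inv_arr V m" using assms by simp
  then show ?thesis using assms(2-) by simp
qed

lemma comp_inv_right:
  assumes "f \<cdot> m = g" "iso V m" "Dom V f = Cod V m"
  shows "f = g \<cdot> inv_arr V m"
  using assms by auto

lemma inv_arr_sym [simp]: "inv_arr V (Sym V X Y) = Sym V Y X"
  by (rule inv_arrI) (simp add: inverse_arrows_def sym_sym)

lemma sym_sym_comp [simp]:
  "Sym V Y X \<cdot> Sym V X Y = \<one> (X \<otimes> Y)"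
  "Cod V h = X \<otimes> Y \<Longrightarrow> Sym V Y X \<cdot> Sym V X Y \<cdot> h = h"
  using inv_arr_comp(1)[of "Sym V X Y" h] by (simp_all add: sym_sym)

section \<open>Coherence of the unit\<close>

text \<open>Naturality of the invertible \<open>Lun\<close> recovers \<open>f\<close> from
  \<open>\<one> \<I> \<odot> f\<close>. The coherence laws below are proved after tensoring with
  \<open>\<I>\<close>, where the pentagon or the hexagon becomes applicable.\<close>

lemma unit_ten_cancel: "\<lbrakk>\<one> \<I> \<odot> f = \<one> \<I> \<odot> g; Dom V f = Dom V g; Cod V f = Cod V g\<rbrakk> \<Longrightarrow> f = g"
  using lun_nat'[of f] lun_nat'[of g] by - (rule iso_cancel_right[of f "Lun V (Dom V f)" g], simp_all)

lemma ten_unit_cancel: "\<lbrakk>f \<odot> \<one> \<I> = g \<odot> \<one> \<I>; Dom V f = Dom V g; Cod V f = Cod V g\<rbrakk> \<Longrightarrow> f = g"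
  using run_nat'[of f] run_nat'[of g] by - (rule iso_cancel_right[of f "Run V (Dom V f)" g], simp_all)

text \<open>Kelly's argument: after tensoring with \<open>\<I>\<close> on the left, the pentagon for
  \<open>\<I>, \<I>, X, Y\<close> reduces the claim to two instances of the axiom
  \<open>triangle\<close>.\<close>

lemma lun_asc: "Lun V (X \<otimes> Y) \<cdot> Asc V \<I> X Y = Lun V X \<odot> \<one> Y"
proof (rule unit_ten_cancel)
  let ?a = "Asc V \<I> (\<I> \<otimes> X) Y" and ?b = "Asc V \<I> \<I> X \<odot> \<one> Y"
  have "(\<one> \<I> \<odot> (Lun V (X \<otimes> Y) \<cdot> Asc V \<I> X Y)) \<cdot> ?a \<cdot> ?b
      = (\<one> \<I> \<odot> Lun V (X \<otimes> Y)) \<cdot> ((\<one> \<I> \<odot> Asc V \<I> X Y) \<cdot> ?a \<cdot> ?b)" by simp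
  also have "\<dots> = ((\<one> \<I> \<odot> Lun V (X \<otimes> Y)) \<cdot> Asc V \<I> \<I> (X \<otimes> Y)) \<cdot> Asc V (\<I> \<otimes> \<I>) X Y"
    by (simp only: pentagon) simp
  also have "\<dots> = (Run V \<I> \<odot> (\<one> X \<odot> \<one> Y)) \<cdot> Asc V (\<I> \<otimes> \<I>) X Y"
    by (simp only: triangle) simp
  also have "\<dots> = Asc V \<I> X Y \<cdot> ((Run V \<I> \<odot> \<one> X) \<odot> \<one> Y)"
    using asc_nat'[of "Run V \<I>" "\<one> X" "\<one> Y"] by simp
  also have "\<dots> = Asc V \<I> X Y \<cdot> ((\<one> \<I> \<odot> Lun V X) \<odot> \<one> Y) \<cdot> ?b"
    by (simp add: triangle)
  also have "\<dots> = (\<one> \<I> \<odot> (Lun V X \<odot> \<one> Y)) \<cdot> ?a \<cdot> ?b"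
    using asc_nat'[of "\<one> \<I>" "Lun V X" "\<one> Y"] by - (rule comp_reassoc2, simp_all)
  finally show "\<one> \<I> \<odot> (Lun V (X \<otimes> Y) \<cdot> Asc V \<I> X Y) = \<one> \<I> \<odot> (Lun V X \<odot> \<one> Y)"
    by (rule iso_cancel_right) simp_all
qed simp_all

text \<open>The mirror image, with the pentagon for \<open>X, Y, \<I>, \<I>\<close>.\<close>

lemma run_asc: "(\<one> X \<odot> Run V Y) \<cdot> Asc V X Y \<I> = Run V (X \<otimes> Y)"
proof (rule ten_unit_cancel)
  let ?a = "Asc V X Y \<I>" and ?b = "Asc V X (Y \<otimes> \<I>) \<I>"
  have "?a \<cdot> (((\<one> X \<odot> Run V Y) \<cdot> ?a) \<odot> \<one> \<I>) = ?a \<cdot> ((\<one> X \<odot> Run V Y) \<odot> \<one> \<I>) \<cdot> (?a \<odot> \<one> \<I>)"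
    by simp
  also have "\<dots> = (\<one> X \<odot> (Run V Y \<odot> \<one> \<I>)) \<cdot> ?b \<cdot> (?a \<odot> \<one> \<I>)"
    using asc_nat'[of "\<one> X" "Run V Y" "\<one> \<I>"] by - (rule comp_reassoc2, simp_all)
  also have "\<dots> = (\<one> X \<odot> (\<one> Y \<odot> Lun V \<I>)) \<cdot> ((\<one> X \<odot> Asc V Y \<I> \<I>) \<cdot> ?b \<cdot> (?a \<odot> \<one> \<I>))"
    by (simp add: triangle)
  also have "\<dots> = (\<one> X \<odot> (\<one> Y \<odot> Lun V \<I>)) \<cdot> Asc V X Y (\<I> \<otimes> \<I>) \<cdot> Asc V (X \<otimes> Y) \<I> \<I>"
    by (simp only: pentagon)
  also have "\<dots> = ?a \<cdot> ((\<one> X \<odot> \<one> Y) \<odot> Lun V \<I>) \<cdot> Asc V (X \<otimes> Y) \<I> \<I>"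
    using asc_nat'[of "\<one> X" "\<one> Y" "Lun V \<I>"] by - (rule comp_reassoc2, simp_all)
  also have "\<dots> = ?a \<cdot> (Run V (X \<otimes> Y) \<odot> \<one> \<I>)"
    by (simp add: triangle)
  finally show "((\<one> X \<odot> Run V Y) \<cdot> ?a) \<odot> \<one> \<I> = Run V (X \<otimes> Y) \<odot> \<one> \<I>"
    by (rule iso_cancel_left) simp_all
qed simp_all

text \<open>Naturality of \<open>Lun\<close> at \<open>Lun V \<I>\<close> identifies
  \<open>Lun\<close> of \<open>\<I> \<otimes> \<I>\<close> with
  \<open>\<one> \<I> \<odot> Lun V \<I>\<close>. Then \<open>lun_asc\<close> and
  \<open>triangle\<close> compute the same composite.\<close>

lemma lun_unit_eq_run_unit: "Lun V \<I> = Run V \<I>"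
proof (rule ten_unit_cancel)
  have "Lun V (\<I> \<otimes> \<I>) = \<one> \<I> \<odot> Lun V \<I>"
    using lun_nat'[of "Lun V \<I>"] by - (rule iso_cancel_left[of "Lun V \<I>"], simp_all)
  then show "Lun V \<I> \<odot> \<one> \<I> = Run V \<I> \<odot> \<one> \<I>"
    using lun_asc[of \<I> \<I>] triangle[of \<I> \<I>] by simp
qed simp_all

text \<open>The hexagon for \<open>X, \<I>, \<I>\<close>, with the unit laws removing the
  associators.\<close>

lemma lun_sym: "Lun V X \<cdot> Sym V X \<I> = Run V X"
proof (rule ten_unit_cancel)
  have "Sym V X \<I> \<cdot> ((Lun V X \<cdot> Sym V X \<I>) \<odot> \<one> \<I>) = Sym V X \<I> \<cdot> (Lun V X \<odot> \<one> \<I>) \<cdot> (Sym V X \<I> \<odot> \<one> \<I>)"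
    by simp
  also have "\<dots> = Sym V X \<I> \<cdot> Lun V (X \<otimes> \<I>) \<cdot> Asc V \<I> X \<I> \<cdot> (Sym V X \<I> \<odot> \<one> \<I>)"
    by (simp add: comp_reassoc[OF lun_asc])
  also have "\<dots> = Lun V (\<I> \<otimes> X) \<cdot> ((\<one> \<I> \<odot> Sym V X \<I>) \<cdot> Asc V \<I> X \<I> \<cdot> (Sym V X \<I> \<odot> \<one> \<I>))"
    using lun_nat'[of "Sym V X \<I>"] by - (rule comp_reassoc2, simp_all)
  also have "\<dots> = (Lun V (\<I> \<otimes> X) \<cdot> Asc V \<I> \<I> X) \<cdot> Sym V X (\<I> \<otimes> \<I>) \<cdot> Asc V X \<I> \<I>"
    by (subst hexagon[symmetric]) simp
  also have "\<dots> = (Lun V \<I> \<odot> \<one> X) \<cdot> Sym V X (\<I> \<otimes> \<I>) \<cdot> Asc V X \<I> \<I>"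
    by (simp only: lun_asc)
  also have "\<dots> = Sym V X \<I> \<cdot> (\<one> X \<odot> Lun V \<I>) \<cdot> Asc V X \<I> \<I>"
    using sym_nat'[of "\<one> X" "Lun V \<I>"] by - (rule comp_reassoc2, simp_all)
  also have "\<dots> = Sym V X \<I> \<cdot> (Run V X \<odot> \<one> \<I>)"
    by (simp add: triangle)
  finally show "(Lun V X \<cdot> Sym V X \<I>) \<odot> \<one> \<I> = Run V X \<odot> \<one> \<I>"
    by (rule iso_cancel_left) simp_all
qed simp_all

section \<open>The middle-four interchange\<close>

text \<open>The core of \<open>mid4\<close>, which is \<open>\<one> W \<odot> swap3 X Y Z\<close>
  between two associators. Splitting it off allows naturality and the unit laws to be proved in two
  layers.\<close>

definition swap3 :: "'o \<Rightarrow> 'o \<Rightarrow> 'o \<Rightarrow> 'm" where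
  "swap3 X Y Z = Asc V Y X Z \<cdot> (Sym V X Y \<odot> \<one> Z) \<cdot> inv_arr V (Asc V X Y Z)"

lemma swap3_simps [simp]:
  "Dom V (swap3 X Y Z) = X \<otimes> (Y \<otimes> Z)" "Cod V (swap3 X Y Z) = Y \<otimes> (X \<otimes> Z)"
  by (simp_all add: swap3_def)

lemma mid4_eq:
  "mid4 V W X Y Z = inv_arr V (Asc V W Y (X \<otimes> Z)) \<cdot> (\<one> W \<odot> swap3 X Y Z) \<cdot> Asc V W X (Y \<otimes> Z)"
  by (simp add: mid4_def swap3_def)

lemma mid4_simps [simp]:
  "Dom V (mid4 V W X Y Z) = (W \<otimes> X) \<otimes> (Y \<otimes> Z)" "Cod V (mid4 V W X Y Z) = (W \<otimes> Y) \<otimes> (X \<otimes> Z)"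
  by (simp_all add: mid4_eq)

lemma inv_nat:
  assumes "m' \<cdot> f = g \<cdot> m" "iso V m" "iso V m'"
    "Cod V f = Dom V m'" "Dom V f = Dom V m" "Cod V m = Dom V g" "Cod V g = Cod V m'"
  shows "inv_arr V m' \<cdot> g = f \<cdot> inv_arr V m"
proof (rule iso_cancel_right)
  have "(inv_arr V m' \<cdot> g) \<cdot> m = inv_arr V m' \<cdot> m' \<cdot> f"
    using assms by simp
  then show "(inv_arr V m' \<cdot> g) \<cdot> m = (f \<cdot> inv_arr V m) \<cdot> m"
    using assms(2-) by simp
qed (use assms in simp_all)

lemma inv_asc_nat: "inv_arr V (Asc V (Cod V f) (Cod V g) (Cod V h)) \<cdot> (f \<odot> (g \<odot> h))
    = ((f \<odot> g) \<odot> h) \<cdot> inv_arr V (Asc V (Dom V f) (Dom V g) (Dom V h))"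
  by (rule inv_nat) (simp_all add: asc_nat')

lemma inv_lun_nat: "inv_arr V (Lun V (Cod V f)) \<cdot> f = (\<one> \<I> \<odot> f) \<cdot> inv_arr V (Lun V (Dom V f))"
  by (rule inv_nat) (simp_all add: lun_nat')

lemma inv_run_nat: "inv_arr V (Run V (Cod V f)) \<cdot> f = (f \<odot> \<one> \<I>) \<cdot> inv_arr V (Run V (Dom V f))"
  by (rule inv_nat) (simp_all add: run_nat')

lemma swap3_nat: "swap3 (Cod V f) (Cod V g) (Cod V h) \<cdot> (f \<odot> (g \<odot> h))
    = (g \<odot> (f \<odot> h)) \<cdot> swap3 (Dom V f) (Dom V g) (Dom V h)"
proof -
  have "swap3 (Cod V f) (Cod V g) (Cod V h) \<cdot> (f \<odot> (g \<odot> h)) =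
      Asc V (Cod V g) (Cod V f) (Cod V h) \<cdot> (Sym V (Cod V f) (Cod V g) \<odot> \<one> (Cod V h))
        \<cdot> ((f \<odot> g) \<odot> h) \<cdot> inv_arr V (Asc V (Dom V f) (Dom V g) (Dom V h))"
    by (simp add: swap3_def inv_asc_nat)
  also have "\<dots> = Asc V (Cod V g) (Cod V f) (Cod V h) \<cdot> ((g \<odot> f) \<odot> h)
      \<cdot> (Sym V (Dom V f) (Dom V g) \<odot> \<one> (Dom V h)) \<cdot> inv_arr V (Asc V (Dom V f) (Dom V g) (Dom V h))"
    by (simp add: sym_nat')
  also have "\<dots> = (g \<odot> (f \<odot> h)) \<cdot> Asc V (Dom V g) (Dom V f) (Dom V h)
      \<cdot> (Sym V (Dom V f) (Dom V g) \<odot> \<one> (Dom V h)) \<cdot> inv_arr V (Asc V (Dom V f) (Dom V g) (Dom V h))"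
    by (rule comp_reassoc2) (simp_all add: asc_nat')
  finally show ?thesis by (simp add: swap3_def)
qed

lemma mid4_nat: "mid4 V (Cod V f) (Cod V g) (Cod V h) (Cod V k) \<cdot> ((f \<odot> g) \<odot> (h \<odot> k))
    = ((f \<odot> h) \<odot> (g \<odot> k)) \<cdot> mid4 V (Dom V f) (Dom V g) (Dom V h) (Dom V k)"
proof -
  have "mid4 V (Cod V f) (Cod V g) (Cod V h) (Cod V k) \<cdot> ((f \<odot> g) \<odot> (h \<odot> k)) =
     inv_arr V (Asc V (Cod V f) (Cod V h) (Cod V g \<otimes> Cod V k)) \<cdot> (\<one> (Cod V f) \<odot> swap3 (Cod V g) (Cod V h) (Cod V k))
     \<cdot> (f \<odot> (g \<odot> (h \<odot> k))) \<cdot> Asc V (Dom V f) (Dom V g) (Dom V h \<otimes> Dom V k)"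
    using asc_nat'[of f g "h \<odot> k"] by (simp add: mid4_eq)
  also have "\<dots> = inv_arr V (Asc V (Cod V f) (Cod V h) (Cod V g \<otimes> Cod V k)) \<cdot> (f \<odot> (h \<odot> (g \<odot> k)))
     \<cdot> (\<one> (Dom V f) \<odot> swap3 (Dom V g) (Dom V h) (Dom V k)) \<cdot> Asc V (Dom V f) (Dom V g) (Dom V h \<otimes> Dom V k)"
    by (simp add: swap3_nat)
  also have "\<dots> = ((f \<odot> h) \<odot> (g \<odot> k)) \<cdot> inv_arr V (Asc V (Dom V f) (Dom V h) (Dom V g \<otimes> Dom V k))
     \<cdot> (\<one> (Dom V f) \<odot> swap3 (Dom V g) (Dom V h) (Dom V k)) \<cdot> Asc V (Dom V f) (Dom V g) (Dom V h \<otimes> Dom V k)"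
    using inv_asc_nat[of f h "g \<odot> k"] by - (rule comp_reassoc2, simp_all)
  finally show ?thesis by (simp add: mid4_eq)
qed

lemma lun_asc_inv: "(Lun V X \<odot> \<one> Y) \<cdot> inv_arr V (Asc V \<I> X Y) = Lun V (X \<otimes> Y)"
  by (simp flip: lun_asc)

lemma run_asc_inv: "Run V (X \<otimes> Y) \<cdot> inv_arr V (Asc V X Y \<I>) = \<one> X \<odot> Run V Y"
  by (simp flip: run_asc)

lemma triangle_inv: "(Run V X \<odot> \<one> Y) \<cdot> inv_arr V (Asc V X \<I> Y) = \<one> X \<odot> Lun V Y"
  by (simp flip: triangle)

lemma swap3_unit_1: "(\<one> Y \<odot> Lun V Z) \<cdot> swap3 \<I> Y Z = Lun V (Y \<otimes> Z)"
proof -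
  have "Run V Y \<cdot> Sym V \<I> Y = Lun V Y"
    by (simp flip: lun_sym)
  then show ?thesis
    by (simp add: swap3_def comp_reassoc[OF triangle] lun_asc_inv)
qed

lemma swap3_unit_2: "Lun V (X \<otimes> Z) \<cdot> swap3 X \<I> Z = \<one> X \<odot> Lun V Z"
  by (simp add: swap3_def comp_reassoc[OF lun_asc] lun_sym triangle_inv)

lemma swap3_unit_3: "(\<one> Y \<odot> Run V X) \<cdot> swap3 X Y \<I> = Sym V X Y \<cdot> (\<one> X \<odot> Run V Y)"
proof -
  have "(\<one> Y \<odot> Run V X) \<cdot> swap3 X Y \<I> =
      Run V (Y \<otimes> X) \<cdot> (Sym V X Y \<odot> \<one> \<I>) \<cdot> inv_arr V (Asc V X Y \<I>)"
    by (simp add: swap3_def comp_reassoc[OF run_asc])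
  also have "\<dots> = Sym V X Y \<cdot> Run V (X \<otimes> Y) \<cdot> inv_arr V (Asc V X Y \<I>)"
    using run_nat'[of "Sym V X Y"] by - (rule comp_reassoc2, simp_all)
  finally show ?thesis by (simp add: run_asc_inv)
qed

text \<open>The digits in the names of these four laws are the positions filled by
  \<open>\<I>\<close>. Positions 2, 3 and 1, 4 occur when partial functors in different variables
  are composed, positions 2, 4 and 1, 3 when composing in one variable.\<close>

lemma mid4_units_23: "(Run V W \<odot> Lun V Z) \<cdot> mid4 V W \<I> \<I> Z = Run V W \<odot> Lun V Z"
proof -
  have "(Run V W \<odot> Lun V Z) \<cdot> mid4 V W \<I> \<I> Z =
    (\<one> W \<odot> Lun V Z) \<cdot> ((Run V W \<odot> \<one> (\<I> \<otimes> Z)) \<cdot> inv_arr V (Asc V W \<I> (\<I> \<otimes> Z)))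
      \<cdot> (\<one> W \<odot> swap3 \<I> \<I> Z) \<cdot> Asc V W \<I> (\<I> \<otimes> Z)"
    by (simp add: mid4_eq)
  also have "\<dots> = (\<one> W \<odot> (Lun V Z \<cdot> Lun V (\<I> \<otimes> Z) \<cdot> swap3 \<I> \<I> Z)) \<cdot> Asc V W \<I> (\<I> \<otimes> Z)"
    by (simp only: triangle_inv) simp
  also have "\<dots> = (\<one> W \<odot> Lun V Z) \<cdot> (\<one> W \<odot> Lun V (\<I> \<otimes> Z)) \<cdot> Asc V W \<I> (\<I> \<otimes> Z)"
    using lun_nat'[of "Lun V Z"] by (simp add: swap3_unit_2)
  also have "\<dots> = Run V W \<odot> Lun V Z"
    by (simp only: triangle) simp
  finally show ?thesis .
qed

lemma mid4_units_14: "(Lun V Y \<odot> Run V X) \<cdot> mid4 V \<I> X Y \<I> = Sym V X Y \<cdot> (Lun V X \<odot> Run V Y)"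
proof -
  have "(Lun V Y \<odot> Run V X) \<cdot> mid4 V \<I> X Y \<I> =
    (\<one> Y \<odot> Run V X) \<cdot> ((Lun V Y \<odot> \<one> (X \<otimes> \<I>)) \<cdot> inv_arr V (Asc V \<I> Y (X \<otimes> \<I>)))
      \<cdot> (\<one> \<I> \<odot> swap3 X Y \<I>) \<cdot> Asc V \<I> X (Y \<otimes> \<I>)"
    by (simp add: mid4_eq)
  also have "\<dots> = (\<one> Y \<odot> Run V X) \<cdot> (Lun V (Y \<otimes> (X \<otimes> \<I>))
      \<cdot> (\<one> \<I> \<odot> swap3 X Y \<I>)) \<cdot> Asc V \<I> X (Y \<otimes> \<I>)"
    by (simp only: lun_asc_inv) simp
  also have "\<dots> = ((\<one> Y \<odot> Run V X) \<cdot> swap3 X Y \<I>) \<cdot> Lun V (X \<otimes> (Y \<otimes> \<I>)) \<cdot> Asc V \<I> X (Y \<otimes> \<I>)"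
    using lun_nat'[of "swap3 X Y \<I>"] by simp
  finally show ?thesis by (simp only: lun_asc swap3_unit_3) simp
qed

lemma mid4_units_24: "Run V (W \<otimes> Y) \<cdot> (\<one> (W \<otimes> Y) \<odot> Lun V \<I>) \<cdot> mid4 V W \<I> Y \<I> = Run V W \<odot> Run V Y"
proof -
  have "(\<one> (W \<otimes> Y) \<odot> Lun V \<I>) \<cdot> mid4 V W \<I> Y \<I> =
     inv_arr V (Asc V W Y \<I>) \<cdot> (\<one> W \<odot> (\<one> Y \<odot> Lun V \<I>)) \<cdot> (\<one> W \<odot> swap3 \<I> Y \<I>) \<cdot> Asc V W \<I> (Y \<otimes> \<I>)"
    unfolding mid4_eq using inv_asc_nat[of "\<one> W" "\<one> Y" "Lun V \<I>"]
    by - (subst comp_reassoc2[symmetric], simp_all)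
  also have "\<dots> = inv_arr V (Asc V W Y \<I>) \<cdot> (Run V W \<odot> \<one> (Y \<otimes> \<I>))"
    by (simp add: swap3_unit_1 triangle)
  finally have "Run V (W \<otimes> Y) \<cdot> (\<one> (W \<otimes> Y) \<odot> Lun V \<I>) \<cdot> mid4 V W \<I> Y \<I> =
    (Run V (W \<otimes> Y) \<cdot> inv_arr V (Asc V W Y \<I>)) \<cdot> (Run V W \<odot> \<one> (Y \<otimes> \<I>))" by simp
  then show ?thesis by (simp only: run_asc_inv) simp
qed

lemma mid4_units_13: "Lun V (X \<otimes> Z) \<cdot> (Lun V \<I> \<odot> \<one> (X \<otimes> Z)) \<cdot> mid4 V \<I> X \<I> Z = Lun V X \<odot> Lun V Z"
proof -
  have "(Lun V \<I> \<odot> \<one> (X \<otimes> Z)) \<cdot> mid4 V \<I> X \<I> Z =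
    ((Lun V \<I> \<odot> \<one> (X \<otimes> Z)) \<cdot> inv_arr V (Asc V \<I> \<I> (X \<otimes> Z))) \<cdot> (\<one> \<I> \<odot> swap3 X \<I> Z) \<cdot> Asc V \<I> X (\<I> \<otimes> Z)"
    by (simp add: mid4_eq)
  also have "\<dots> = (Lun V (\<I> \<otimes> (X \<otimes> Z)) \<cdot> (\<one> \<I> \<odot> swap3 X \<I> Z)) \<cdot> Asc V \<I> X (\<I> \<otimes> Z)"
    by (simp only: lun_asc_inv) simp
  also have "\<dots> = swap3 X \<I> Z \<cdot> Lun V (X \<otimes> (\<I> \<otimes> Z)) \<cdot> Asc V \<I> X (\<I> \<otimes> Z)"
    using lun_nat'[of "swap3 X \<I> Z"] by simp
  also have "\<dots> = swap3 X \<I> Z \<cdot> (Lun V X \<odot> \<one> (\<I> \<otimes> Z))"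
    by (simp only: lun_asc)
  finally show ?thesis using comp_reassoc[OF swap3_unit_2[of X Z]] by simp
qed

section \<open>Composition of generalized elements of hom-objects\<close>

text \<open>Generalized elements \<open>g : W \<rightarrow> X(b, c)\<close> and \<open>f : Z \<rightarrow> X(a, b)\<close> compose to
  \<open>W \<otimes> Z \<rightarrow> X(a, c)\<close>. When one of the two has domain \<open>\<I>\<close>, the unit isomorphism is absorbed into the
  composite. The resulting left and right actions by elements are strictly associative and unital, so
  that most later computations involve no coherence isomorphisms other than symmetries.\<close>

definition mul :: "('a, 'o, 'm, 'z) vcat_scheme \<Rightarrow> 'a \<Rightarrow> 'a \<Rightarrow> 'a \<Rightarrow> 'm \<Rightarrow> 'm \<Rightarrow> 'm" where
  "mul X a b c g f = Mu X a b c \<cdot> (g \<odot> f)"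

definition lact :: "('a, 'o, 'm, 'z) vcat_scheme \<Rightarrow> 'a \<Rightarrow> 'a \<Rightarrow> 'a \<Rightarrow> 'm \<Rightarrow> 'm \<Rightarrow> 'm" where
  "lact X a b c u f = mul X a b c u f \<cdot> inv_arr V (Lun V (Dom V f))"

definition ract :: "('a, 'o, 'm, 'z) vcat_scheme \<Rightarrow> 'a \<Rightarrow> 'a \<Rightarrow> 'a \<Rightarrow> 'm \<Rightarrow> 'm \<Rightarrow> 'm" where
  "ract X a b c f v = mul X a b c f v \<cdot> inv_arr V (Run V (Dom V f))"

lemma vcategory_simps [simp]:
  assumes "vcategory V X"
  shows "a \<in> Obj X \<Longrightarrow> Dom V (Jd X a) = \<I>"
    "a \<in> Obj X \<Longrightarrow> Cod V (Jd X a) = Hom X a a"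
    "\<lbrakk>a \<in> Obj X; b \<in> Obj X; c \<in> Obj X\<rbrakk> \<Longrightarrow> Dom V (Mu X a b c) = Hom X b c \<otimes> Hom X a b"
    "\<lbrakk>a \<in> Obj X; b \<in> Obj X; c \<in> Obj X\<rbrakk> \<Longrightarrow> Cod V (Mu X a b c) = Hom X a c"
  using assms by (auto simp: vcategory_def in_hom_iff)

lemma vcategory_assoc:
  assumes "vcategory V X" "a \<in> Obj X" "b \<in> Obj X" "c \<in> Obj X" "d \<in> Obj X"
  shows "Mu X a b d \<cdot> (Mu X b c d \<odot> \<one> (Hom X a b)) =
        Mu X a c d \<cdot> (\<one> (Hom X c d) \<odot> Mu X a b c) \<cdot> Asc V (Hom X c d) (Hom X b c) (Hom X a b)"
  using assms unfolding vcategory_def by blast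

lemma vcategory_unit:
  assumes "vcategory V X" "a \<in> Obj X" "b \<in> Obj X"
  shows "Mu X a b b \<cdot> (Jd X b \<odot> \<one> (Hom X a b)) = Lun V (Hom X a b)"
    "Mu X a a b \<cdot> (\<one> (Hom X a b) \<odot> Jd X a) = Run V (Hom X a b)"
  using assms unfolding vcategory_def by blast+

lemma mul_simps [simp]:
  assumes "vcategory V X" "a \<in> Obj X" "b \<in> Obj X" "c \<in> Obj X"
    "Cod V g = Hom X b c" "Cod V f = Hom X a b"
  shows "Dom V (mul X a b c g f) = Dom V g \<otimes> Dom V f" "Cod V (mul X a b c g f) = Hom X a c"
    "\<lbrakk>Cod V k = Dom V g; Cod V l = Dom V f\<rbrakk>
       \<Longrightarrow> mul X a b c g f \<cdot> (k \<odot> l) = mul X a b c (g \<cdot> k) (f \<cdot> l)"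
    "\<lbrakk>Cod V k = Dom V g; Cod V l = Dom V f; Cod V h = Dom V k \<otimes> Dom V l\<rbrakk>
       \<Longrightarrow> mul X a b c g f \<cdot> (k \<odot> l) \<cdot> h = mul X a b c (g \<cdot> k) (f \<cdot> l) \<cdot> h"
  using assms by (simp_all add: mul_def)

lemma lact_simps [simp]:
  assumes "vcategory V X" "a \<in> Obj X" "b \<in> Obj X" "c \<in> Obj X"
    "Cod V u = Hom X b c" "Cod V f = Hom X a b" "Dom V u = \<I>"
  shows "Dom V (lact X a b c u f) = Dom V f" "Cod V (lact X a b c u f) = Hom X a c"
  using assms by (simp_all add: lact_def)

lemma ract_simps [simp]:
  assumes "vcategory V X" "a \<in> Obj X" "b \<in> Obj X" "c \<in> Obj X"
    "Cod V f = Hom X b c" "Cod V v = Hom X a b" "Dom V v = \<I>"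
  shows "Dom V (ract X a b c f v) = Dom V f" "Cod V (ract X a b c f v) = Hom X a c"
  using assms by (simp_all add: ract_def)

lemma lact_comp [simp]:
  assumes "vcategory V X" "a \<in> Obj X" "b \<in> Obj X" "c \<in> Obj X"
    "Cod V u = Hom X b c" "Cod V f = Hom X a b" "Dom V u = \<I>" "Cod V k = Dom V f"
  shows "lact X a b c u f \<cdot> k = lact X a b c u (f \<cdot> k)"
  using assms inv_lun_nat[of k] by (simp add: lact_def)

lemma ract_comp [simp]:
  assumes "vcategory V X" "a \<in> Obj X" "b \<in> Obj X" "c \<in> Obj X"
    "Cod V f = Hom X b c" "Cod V v = Hom X a b" "Dom V v = \<I>" "Cod V k = Dom V f"
  shows "ract X a b c f v \<cdot> k = ract X a b c (f \<cdot> k) v"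
  using assms inv_run_nat[of k] by (simp add: ract_def)

lemma mul_assoc:
  assumes "vcategory V X" "a \<in> Obj X" "b \<in> Obj X" "c \<in> Obj X" "d \<in> Obj X"
    "Cod V h = Hom X c d" "Cod V g = Hom X b c" "Cod V f = Hom X a b"
  shows "mul X a b d (mul X b c d h g) f
    = mul X a c d h (mul X a b c g f) \<cdot> Asc V (Dom V h) (Dom V g) (Dom V f)"
proof -
  have "mul X a b d (mul X b c d h g) f
      = (Mu X a b d \<cdot> (Mu X b c d \<odot> \<one> (Hom X a b))) \<cdot> ((h \<odot> g) \<odot> f)"
    using assms by (simp add: mul_def)
  also have "\<dots> = Mu X a c d \<cdot> (\<one> (Hom X c d) \<odot> Mu X a b c)
      \<cdot> Asc V (Hom X c d) (Hom X b c) (Hom X a b) \<cdot> ((h \<odot> g) \<odot> f)"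
    using assms by (simp add: vcategory_assoc)
  also have "\<dots> = Mu X a c d \<cdot> (\<one> (Hom X c d) \<odot> Mu X a b c)
      \<cdot> (h \<odot> (g \<odot> f)) \<cdot> Asc V (Dom V h) (Dom V g) (Dom V f)"
    using asc_nat'[of h g f] assms by simp
  finally show ?thesis using assms by (simp add: mul_def)
qed

lemma mul_assoc_inv:
  assumes "vcategory V X" "a \<in> Obj X" "b \<in> Obj X" "c \<in> Obj X" "d \<in> Obj X"
    "Cod V h = Hom X c d" "Cod V g = Hom X b c" "Cod V f = Hom X a b"
  shows "mul X a c d h (mul X a b c g f)
    = mul X a b d (mul X b c d h g) f \<cdot> inv_arr V (Asc V (Dom V h) (Dom V g) (Dom V f))"
  using assms by (simp add: mul_assoc)

text \<open>This law and the two after it cancel the associator in \<open>mul_lact\<close>,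
  \<open>mul_ract\<close> and \<open>mul_ract_lact\<close> respectively.\<close>

lemma inv_lun_asc: "Asc V \<I> X Y \<cdot> (inv_arr V (Lun V X) \<odot> \<one> Y) = inv_arr V (Lun V (X \<otimes> Y))"
proof (rule iso_cancel_left)
  show "Lun V (X \<otimes> Y) \<cdot> Asc V \<I> X Y \<cdot> (inv_arr V (Lun V X) \<odot> \<one> Y)
      = Lun V (X \<otimes> Y) \<cdot> inv_arr V (Lun V (X \<otimes> Y))"
    by (simp add: comp_reassoc[OF lun_asc])
qed simp_all

lemma inv_run_asc: "inv_arr V (Asc V X Y \<I>) \<cdot> (\<one> X \<odot> inv_arr V (Run V Y)) = inv_arr V (Run V (X \<otimes> Y))"
proof (rule iso_cancel_left)
  show "Run V (X \<otimes> Y) \<cdot> inv_arr V (Asc V X Y \<I>) \<cdot> (\<one> X \<odot> inv_arr V (Run V Y))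
      = Run V (X \<otimes> Y) \<cdot> inv_arr V (Run V (X \<otimes> Y))"
    by (simp add: comp_reassoc[OF run_asc_inv])
qed simp_all

lemma inv_triangle: "Asc V X \<I> Y \<cdot> (inv_arr V (Run V X) \<odot> \<one> Y) = \<one> X \<odot> inv_arr V (Lun V Y)"
proof (rule iso_cancel_left)
  show "(\<one> X \<odot> Lun V Y) \<cdot> Asc V X \<I> Y \<cdot> (inv_arr V (Run V X) \<odot> \<one> Y)
      = (\<one> X \<odot> Lun V Y) \<cdot> (\<one> X \<odot> inv_arr V (Lun V Y))"
    by (simp add: comp_reassoc[OF triangle])
qed simp_all

lemma mul_lact:
  assumes "vcategory V X" "a \<in> Obj X" "b \<in> Obj X" "c \<in> Obj X" "d \<in> Obj X"
    "Cod V u = Hom X c d" "Cod V g = Hom X b c" "Cod V f = Hom X a b" "Dom V u = \<I>"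
  shows "mul X a b d (lact X b c d u g) f = lact X a c d u (mul X a b c g f)"
proof -
  have "mul X a b d (lact X b c d u g) f
     = mul X a b d (mul X b c d u g) f \<cdot> (inv_arr V (Lun V (Dom V g)) \<odot> \<one> (Dom V f))"
    using assms by (simp add: lact_def)
  also have "\<dots> = mul X a c d u (mul X a b c g f) \<cdot> Asc V \<I> (Dom V g) (Dom V f)
      \<cdot> (inv_arr V (Lun V (Dom V g)) \<odot> \<one> (Dom V f))"
    using assms by (subst mul_assoc) simp_all
  finally show ?thesis using assms by (simp add: inv_lun_asc lact_def)
qed

lemma mul_ract:
  assumes "vcategory V X" "a \<in> Obj X" "b \<in> Obj X" "c \<in> Obj X" "d \<in> Obj X"
    "Cod V g = Hom X c d" "Cod V f = Hom X b c" "Cod V v = Hom X a b" "Dom V v = \<I>"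
  shows "mul X a c d g (ract X a b c f v) = ract X a b d (mul X b c d g f) v"
proof -
  have "mul X a c d g (ract X a b c f v)
     = mul X a c d g (mul X a b c f v) \<cdot> (\<one> (Dom V g) \<odot> inv_arr V (Run V (Dom V f)))"
    using assms by (simp add: ract_def)
  also have "\<dots> = mul X a b d (mul X b c d g f) v \<cdot> inv_arr V (Asc V (Dom V g) (Dom V f) \<I>)
      \<cdot> (\<one> (Dom V g) \<odot> inv_arr V (Run V (Dom V f)))"
    using assms by (subst mul_assoc_inv) simp_all
  finally show ?thesis using assms by (simp add: inv_run_asc ract_def)
qed

lemma mul_ract_lact:
  assumes "vcategory V X" "a \<in> Obj X" "b \<in> Obj X" "c \<in> Obj X" "d \<in> Obj X"
    "Cod V g = Hom X c d" "Cod V v = Hom X b c" "Cod V f = Hom X a b" "Dom V v = \<I>"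
  shows "mul X a b d (ract X b c d g v) f = mul X a c d g (lact X a b c v f)"
proof -
  have "mul X a b d (ract X b c d g v) f
     = mul X a b d (mul X b c d g v) f \<cdot> (inv_arr V (Run V (Dom V g)) \<odot> \<one> (Dom V f))"
    using assms by (simp add: ract_def)
  also have "\<dots> = mul X a c d g (mul X a b c v f) \<cdot> Asc V (Dom V g) \<I> (Dom V f)
      \<cdot> (inv_arr V (Run V (Dom V g)) \<odot> \<one> (Dom V f))"
    using assms by (subst mul_assoc) simp_all
  also have "\<dots> = mul X a c d g (mul X a b c v f) \<cdot> (\<one> (Dom V g) \<odot> inv_arr V (Lun V (Dom V f)))"
    by (simp add: inv_triangle)
  finally show ?thesis using assms by (simp add: lact_def)
qed

lemma lact_lact:
  assumes "vcategory V X" "a \<in> Obj X" "b \<in> Obj X" "c \<in> Obj X" "d \<in> Obj X"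
    "Cod V u = Hom X c d" "Cod V v = Hom X b c" "Cod V f = Hom X a b" "Dom V u = \<I>" "Dom V v = \<I>"
  shows "lact X a c d u (lact X a b c v f) = lact X a b d (lact X b c d u v) f"
proof -
  have "lact X a c d u (lact X a b c v f) = lact X a c d u (mul X a b c v f) \<cdot> inv_arr V (Lun V (Dom V f))"
    using assms by (simp add: lact_def[of X a b c])
  then show ?thesis using assms by (simp add: lact_def[of X a b d] mul_lact)
qed

lemma ract_ract:
  assumes "vcategory V X" "a \<in> Obj X" "b \<in> Obj X" "c \<in> Obj X" "d \<in> Obj X"
    "Cod V f = Hom X c d" "Cod V u = Hom X b c" "Cod V v = Hom X a b" "Dom V u = \<I>" "Dom V v = \<I>"
  shows "ract X a b d (ract X b c d f u) v = ract X a c d f (lact X a b c u v)"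
  using assms by (simp add: ract_def[of X a b d] ract_def[of X a c d] mul_ract_lact)

lemma lact_ract:
  assumes "vcategory V X" "a \<in> Obj X" "b \<in> Obj X" "c \<in> Obj X" "d \<in> Obj X"
    "Cod V u = Hom X c d" "Cod V f = Hom X b c" "Cod V v = Hom X a b" "Dom V u = \<I>" "Dom V v = \<I>"
  shows "lact X a c d u (ract X a b c f v) = ract X a b d (lact X b c d u f) v"
proof -
  have "lact X a c d u (ract X a b c f v) = ract X a b d (mul X b c d u f) v \<cdot> inv_arr V (Lun V (Dom V f))"
    using assms by (simp add: lact_def[of X a c d] mul_ract)
  then show ?thesis using assms by (simp add: lact_def[of X b c d])
qed

text \<open>The two actions remove a factor \<open>\<I>\<close> from
  \<open>\<I> \<otimes> \<I>\<close> by \<open>Run\<close> and by \<open>Lun\<close>, which coincide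
  there.\<close>

lemma ract_eq_lact:
  assumes "Dom V u = \<I>" "Dom V v = \<I>"
  shows "ract X a b c u v = lact X a b c u v"
  using assms by (simp add: lact_def ract_def lun_unit_eq_run_unit)

lemma mul_Jd:
  assumes "vcategory V X" "a \<in> Obj X" "b \<in> Obj X" "Cod V f = Hom X a b"
  shows "mul X a b b (Jd X b) f = f \<cdot> Lun V (Dom V f)" "mul X a a b f (Jd X a) = f \<cdot> Run V (Dom V f)"
proof -
  have "mul X a b b (Jd X b) f = (Mu X a b b \<cdot> (Jd X b \<odot> \<one> (Hom X a b))) \<cdot> (\<one> \<I> \<odot> f)"
    using assms by (simp add: mul_def)
  then show "mul X a b b (Jd X b) f = f \<cdot> Lun V (Dom V f)"
    using assms lun_nat'[of f] by (simp only: vcategory_unit)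
  have "mul X a a b f (Jd X a) = (Mu X a a b \<cdot> (\<one> (Hom X a b) \<odot> Jd X a)) \<cdot> (f \<odot> \<one> \<I>)"
    using assms by (simp add: mul_def)
  then show "mul X a a b f (Jd X a) = f \<cdot> Run V (Dom V f)"
    using assms run_nat'[of f] by (simp only: vcategory_unit)
qed

lemma lact_Jd [simp]:
  assumes "vcategory V X" "a \<in> Obj X" "b \<in> Obj X" "Cod V f = Hom X a b"
  shows "lact X a b b (Jd X b) f = f"
  using assms by (simp add: lact_def mul_Jd)

lemma ract_Jd [simp]:
  assumes "vcategory V X" "a \<in> Obj X" "b \<in> Obj X" "Cod V f = Hom X a b"
  shows "ract X a a b f (Jd X a) = f"
  using assms by (simp add: ract_def mul_Jd)

lemma mul_unit_left:
  assumes "vcategory V X" "a \<in> Obj X" "b \<in> Obj X" "c \<in> Obj X"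
    "Cod V u = Hom X b c" "Cod V f = Hom X a b" "Dom V u = \<I>"
  shows "mul X a b c u f = lact X a b c u f \<cdot> Lun V (Dom V f)"
  using assms by (simp add: lact_def del: lact_comp)

lemma mul_unit_right:
  assumes "vcategory V X" "a \<in> Obj X" "b \<in> Obj X" "c \<in> Obj X"
    "Cod V f = Hom X b c" "Cod V v = Hom X a b" "Dom V v = \<I>"
  shows "mul X a b c f v = ract X a b c f v \<cdot> Run V (Dom V f)"
  using assms by (simp add: ract_def del: ract_comp)

section \<open>Action of functors on generalized elements\<close>

lemma vfunctor_simps [simp]:
  assumes "vfunctor V X Y F"
  shows "a \<in> Obj X \<Longrightarrow> Fo F a \<in> Obj Y"
    "\<lbrakk>a \<in> Obj X; b \<in> Obj X\<rbrakk> \<Longrightarrow> Dom V (Fh F a b) = Hom X a b"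
    "\<lbrakk>a \<in> Obj X; b \<in> Obj X\<rbrakk> \<Longrightarrow> Cod V (Fh F a b) = Hom Y (Fo F a) (Fo F b)"
  using assms by (auto simp: vfunctor_def in_hom_iff)

lemma vfunctor_Jd:
  assumes "vfunctor V X Y F" "a \<in> Obj X"
  shows "Fh F a a \<cdot> Jd X a = Jd Y (Fo F a)"
  using assms by (auto simp: vfunctor_def)

lemma vfunctor_Mu:
  assumes "vfunctor V X Y F" "a \<in> Obj X" "b \<in> Obj X" "c \<in> Obj X"
  shows "Fh F a c \<cdot> Mu X a b c = mul Y (Fo F a) (Fo F b) (Fo F c) (Fh F b c) (Fh F a b)"
  using assms unfolding vfunctor_def mul_def by blast

lemma vfunctor_mul:
  assumes "vfunctor V X Y F" "vcategory V X" "vcategory V Y" "a \<in> Obj X" "b \<in> Obj X" "c \<in> Obj X"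
    "Cod V g = Hom X b c" "Cod V f = Hom X a b"
  shows "Fh F a c \<cdot> mul X a b c g f
    = mul Y (Fo F a) (Fo F b) (Fo F c) (Fh F b c \<cdot> g) (Fh F a b \<cdot> f)"
  using assms by (simp add: mul_def[of X] comp_reassoc[OF vfunctor_Mu])

section \<open>Internal homs and the universal property of cotensors\<close>

lemma curry_arr_props:
  assumes "Dom V f = Z \<otimes> X" "Cod V f = Y"
  shows "Dom V (curry_arr V Z X Y f) = Z" "Cod V (curry_arr V Z X Y f) = Ihom V X Y"
    "Ev V X Y \<cdot> (curry_arr V Z X Y f \<odot> \<one> X) = f"
proof -
  have "\<exists>!g. g \<in> hom V Z (Ihom V X Y) \<and> Ev V X Y \<cdot> (g \<odot> \<one> X) = f"
    using assms ev_universal[of f Z X Y] by (simp add: in_hom_iff)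
  from theI'[OF this] show "Dom V (curry_arr V Z X Y f) = Z" "Cod V (curry_arr V Z X Y f) = Ihom V X Y"
    "Ev V X Y \<cdot> (curry_arr V Z X Y f \<odot> \<one> X) = f"
    by (simp_all add: curry_arr_def in_hom_iff)
qed

declare curry_arr_props(1,2) [simp]

lemma ev_cancel:
  assumes "Ev V X Y \<cdot> (g \<odot> \<one> X) = Ev V X Y \<cdot> (h \<odot> \<one> X)"
    "Dom V g = Dom V h" "Cod V g = Ihom V X Y" "Cod V h = Ihom V X Y"
  shows "g = h"
  using assms ev_universal[of "Ev V X Y \<cdot> (g \<odot> \<one> X)" "Dom V g" X Y] by (auto simp: in_hom_iff)

text \<open>The Yoneda argument. The preimage of the identity is a right inverse, and uniqueness of
  the preimage of \<open>g\<close> itself makes it two-sided.\<close>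

lemma iso_iff_bij:
  "iso V g \<longleftrightarrow> (\<forall>y. Cod V y = Cod V g \<longrightarrow> (\<exists>!x. Dom V x = Dom V y \<and> Cod V x = Dom V g \<and> g \<cdot> x = y))"
proof
  assume i: "iso V g"
  show "\<forall>y. Cod V y = Cod V g \<longrightarrow> (\<exists>!x. Dom V x = Dom V y \<and> Cod V x = Dom V g \<and> g \<cdot> x = y)"
  proof (intro allI impI)
    fix y assume "Cod V y = Cod V g"
    with i show "\<exists>!x. Dom V x = Dom V y \<and> Cod V x = Dom V g \<and> g \<cdot> x = y"
      by (intro ex1I[of _ "inv_arr V g \<cdot> y"]) auto
  qed
next
  assume *: "\<forall>y. Cod V y = Cod V g \<longrightarrow> (\<exists>!x. Dom V x = Dom V y \<and> Cod V x = Dom V g \<and> g \<cdot> x = y)"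
  from *[rule_format, of "\<one> (Cod V g)"] obtain x
    where x: "Dom V x = Cod V g" "Cod V x = Dom V g" "g \<cdot> x = \<one> (Cod V g)" by auto
  have "\<exists>!z. Dom V z = Dom V g \<and> Cod V z = Dom V g \<and> g \<cdot> z = g"
    using *[rule_format, of g] by simp
  moreover have "g \<cdot> x \<cdot> g = g"
    using x by (simp add: comp_reassoc[OF x(3)])
  ultimately have "x \<cdot> g = \<one> (Dom V g)"
    using x by (metis comp_id' dom_cod_comp dom_cod_simps(1,2))
  with x show "iso V g" by (intro isoI)
qed

text \<open>By Yoneda, invertibility of the curried arrow is a bijection on generalized elements,
  and uncurrying turns it into unique factorisation through \<open>\<gamma>\<close>. In this form
  internal homs disappear from all later arguments about cotensors.\<close>

lemma is_cotensor_iff: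
  assumes X: "vcategory V X"
  shows "is_cotensor V X K c p \<gamma> \<longleftrightarrow>
    c \<in> Obj X \<and> p \<in> Obj X \<and> Dom V \<gamma> = K \<and> Cod V \<gamma> = Hom X p c \<and>
    (\<forall>b \<in> Obj X. \<forall>Z k. Dom V k = K \<otimes> Z \<and> Cod V k = Hom X b c \<longrightarrow>
      (\<exists>!h. Dom V h = Z \<and> Cod V h = Hom X b p \<and> mul X b p c \<gamma> h = k))"
proof -
  have "iso V (curry_arr V (Hom X b p) K (Hom X b c)
           (Mu X b p c \<cdot> (\<gamma> \<odot> \<one> (Hom X b p)) \<cdot> Sym V (Hom X b p) K)) \<longleftrightarrow>
      (\<forall>Z k. Dom V k = K \<otimes> Z \<and> Cod V k = Hom X b c \<longrightarrow>
        (\<exists>!h. Dom V h = Z \<and> Cod V h = Hom X b p \<and> mul X b p c \<gamma> h = k))"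
    (is "iso V ?g \<longleftrightarrow> ?R")
    if *: "c \<in> Obj X" "p \<in> Obj X" "Dom V \<gamma> = K" "Cod V \<gamma> = Hom X p c" "b \<in> Obj X" for b
  proof -
    let ?e = "Mu X b p c \<cdot> (\<gamma> \<odot> \<one> (Hom X b p)) \<cdot> Sym V (Hom X b p) K"
    have e: "Dom V ?e = Hom X b p \<otimes> K" "Cod V ?e = Hom X b c" using * X by simp_all
    note g = curry_arr_props[OF e]
    have key: "?g \<cdot> h = y \<longleftrightarrow> mul X b p c \<gamma> h = Ev V K (Hom X b c) \<cdot> (y \<odot> \<one> K) \<cdot> Sym V K (Dom V h)"
      if h: "Cod V h = Hom X b p" "Dom V y = Dom V h" "Cod V y = Ihom V K (Hom X b c)" for h y
    proof -
      have "Ev V K (Hom X b c) \<cdot> ((?g \<cdot> h) \<odot> \<one> K)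
          = (Ev V K (Hom X b c) \<cdot> (?g \<odot> \<one> K)) \<cdot> (h \<odot> \<one> K)"
        using g(1,2) h by simp
      also have "\<dots> = ?e \<cdot> (h \<odot> \<one> K)" by (simp only: g(3))
      also have "\<dots> = mul X b p c \<gamma> h \<cdot> Sym V (Dom V h) K"
        using sym_nat'[of h "\<one> K"] h * X by (simp add: mul_def)
      finally have ev: "Ev V K (Hom X b c) \<cdot> ((?g \<cdot> h) \<odot> \<one> K) = mul X b p c \<gamma> h \<cdot> Sym V (Dom V h) K" .
      show ?thesis
      proof
        assume "?g \<cdot> h = y"
        then have "(mul X b p c \<gamma> h \<cdot> Sym V (Dom V h) K) \<cdot> Sym V K (Dom V h)
            = (Ev V K (Hom X b c) \<cdot> (y \<odot> \<one> K)) \<cdot> Sym V K (Dom V h)" using ev by simp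
        then show "mul X b p c \<gamma> h = Ev V K (Hom X b c) \<cdot> (y \<odot> \<one> K) \<cdot> Sym V K (Dom V h)"
          using h * X by simp
      next
        assume "mul X b p c \<gamma> h = Ev V K (Hom X b c) \<cdot> (y \<odot> \<one> K) \<cdot> Sym V K (Dom V h)"
        then have "mul X b p c \<gamma> h \<cdot> Sym V (Dom V h) K = Ev V K (Hom X b c) \<cdot> (y \<odot> \<one> K)"
          using h by simp
        then show "?g \<cdot> h = y"
          using ev h g(1,2) by - (rule ev_cancel, simp_all)
      qed
    qed
    show ?thesis
    proof
      assume i: "iso V ?g"
      show ?R
      proof (intro allI impI)
        fix Z k assume k: "Dom V k = K \<otimes> Z \<and> Cod V k = Hom X b c"
        \<comment> \<open>The symmetry brings \<open>K\<close> to the right, where \<open>Ev\<close>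
          expects its argument; then \<open>key\<close> translates the equation for \<open>k\<close>
          into one for \<open>y\<close>.\<close>
        define y where "y = curry_arr V Z K (Hom X b c) (k \<cdot> Sym V Z K)"
        have y: "Dom V y = Z" "Cod V y = Ihom V K (Hom X b c)" "Ev V K (Hom X b c) \<cdot> (y \<odot> \<one> K) = k \<cdot> Sym V Z K"
          unfolding y_def using k curry_arr_props[of "k \<cdot> Sym V Z K" Z K "Hom X b c"] by simp_all
        have "Ev V K (Hom X b c) \<cdot> (y \<odot> \<one> K) \<cdot> Sym V K Z = k"
          using k y(1,2) by (simp add: comp_reassoc[OF y(3)])
        then have "mul X b p c \<gamma> h = k \<longleftrightarrow> ?g \<cdot> h = y" if "Dom V h = Z" "Cod V h = Hom X b p" for h
          using key[of h y] that y by simp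
        moreover have "\<exists>!h. Dom V h = Z \<and> Cod V h = Hom X b p \<and> ?g \<cdot> h = y"
          using i[unfolded iso_iff_bij, rule_format, of y] y g by simp
        ultimately show "\<exists>!h. Dom V h = Z \<and> Cod V h = Hom X b p \<and> mul X b p c \<gamma> h = k" by metis
      qed
    next
      assume R: ?R
      show "iso V ?g"
        unfolding iso_iff_bij
      proof (intro allI impI)
        fix y assume "Cod V y = Cod V ?g"
        then have y: "Cod V y = Ihom V K (Hom X b c)" using g by simp
        have "\<exists>!h. Dom V h = Dom V y \<and> Cod V h = Hom X b p \<and>
            mul X b p c \<gamma> h = Ev V K (Hom X b c) \<cdot> (y \<odot> \<one> K) \<cdot> Sym V K (Dom V y)"
          by (rule R[rule_format]) (use y in simp)
        then show "\<exists>!h. Dom V h = Dom V y \<and> Cod V h = Dom V ?g \<and> ?g \<cdot> h = y"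
          using key y g(1) by (metis (no_types, lifting))
      qed
    qed
  qed
  then show ?thesis
    unfolding is_cotensor_def in_hom_iff conj_assoc by (intro conj_cong ball_cong refl) simp_all
qed

lemma cotensor_simps:
  assumes "is_cotensor V X K c p \<gamma>"
  shows "c \<in> Obj X" "p \<in> Obj X" "Dom V \<gamma> = K" "Cod V \<gamma> = Hom X p c"
  using assms by (auto simp: is_cotensor_def in_hom_iff)

lemma cotensor_ex:
  assumes "vcategory V X" "is_cotensor V X K c p \<gamma>" "b \<in> Obj X" "Dom V k = K \<otimes> Z" "Cod V k = Hom X b c"
  obtains h where "Dom V h = Z" "Cod V h = Hom X b p" "mul X b p c \<gamma> h = k"
  using assms(2-) unfolding is_cotensor_iff[OF assms(1)] by metis

lemma cotensor_cancel:
  assumes "vcategory V X" "is_cotensor V X K c p \<gamma>" "b \<in> Obj X"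
    "mul X b p c \<gamma> h = mul X b p c \<gamma> h'"
    "Dom V h = Dom V h'" "Cod V h = Hom X b p" "Cod V h' = Hom X b p"
  shows "h = h'"
proof -
  have "Dom V (mul X b p c \<gamma> h) = K \<otimes> Dom V h" "Cod V (mul X b p c \<gamma> h) = Hom X b c"
    using assms cotensor_simps[OF assms(2)] by simp_all
  then show ?thesis
    using assms(2-) unfolding is_cotensor_iff[OF assms(1)] by metis
qed

lemma cotensor_arr_eq:
  assumes "vcategory V X" "is_cotensor V X K c p \<gamma>" "b \<in> Obj X"
    "mul X b p c \<gamma> h \<cdot> Sym V Z K = k" "Dom V h = Z" "Cod V h = Hom X b p"
  shows "cotensor_arr V X K c p \<gamma> Z b k = h"
  unfolding cotensor_arr_def
proof (rule the_equality)
  note s = cotensor_simps[OF assms(2)]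
  show "h \<in> hom V Z (Hom X b p) \<and> Mu X b p c \<cdot> (\<gamma> \<odot> h) \<cdot> Sym V Z K = k"
    using assms s by (simp add: in_hom_iff mul_def)
  fix h' assume h': "h' \<in> hom V Z (Hom X b p) \<and> Mu X b p c \<cdot> (\<gamma> \<odot> h') \<cdot> Sym V Z K = k"
  then have "mul X b p c \<gamma> h' \<cdot> Sym V Z K = mul X b p c \<gamma> h \<cdot> Sym V Z K"
    using assms s by (simp add: in_hom_iff mul_def)
  then have "mul X b p c \<gamma> h' = mul X b p c \<gamma> h"
    by (rule iso_cancel_right) (use assms s h' in \<open>simp_all add: in_hom_iff\<close>)
  then show "h' = h"
    by (rule cotensor_cancel[OF assms(1,2,3)]) (use assms h' in \<open>simp_all add: in_hom_iff\<close>)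
qed

text \<open>A pair of mutually inverse isomorphisms in the underlying ordinary category of
  \<open>X\<close>, whose arrows are the elements \<open>\<I> \<rightarrow> X(a, b)\<close>.\<close>

definition inverse_elements :: "('a, 'o, 'm, 'z) vcat_scheme \<Rightarrow> 'a \<Rightarrow> 'a \<Rightarrow> 'm \<Rightarrow> 'm \<Rightarrow> bool" where
  "inverse_elements X a b \<phi> \<psi> \<longleftrightarrow>
     Dom V \<phi> = \<I> \<and> Cod V \<phi> = Hom X a b \<and> Dom V \<psi> = \<I> \<and> Cod V \<psi> = Hom X b a \<and>
     lact X a b a \<psi> \<phi> = Jd X a \<and> lact X b a b \<phi> \<psi> = Jd X b"

text \<open>Uniqueness of representing objects: each counit factors through the other, and both
  round trips fix a counit, so \<open>cotensor_cancel\<close> makes them identities.\<close>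

lemma cotensor_comparison:
  assumes X: "vcategory V X" and p: "is_cotensor V X K c p \<gamma>" and q: "is_cotensor V X K c q \<delta>"
  obtains \<phi> \<psi> where "inverse_elements X p q \<phi> \<psi>" "ract X p q c \<delta> \<phi> = \<gamma>" "ract X q p c \<gamma> \<psi> = \<delta>"
proof -
  have ex: "\<exists>\<phi>. Dom V \<phi> = \<I> \<and> Cod V \<phi> = Hom X p q \<and> ract X p q c \<delta> \<phi> = \<gamma>"
    if p: "is_cotensor V X K c p \<gamma>" and q: "is_cotensor V X K c q \<delta>" for p q \<gamma> \<delta>
  proof -
    note s = cotensor_simps[OF p] cotensor_simps[OF q]
    obtain \<phi> where "Dom V \<phi> = \<I>" "Cod V \<phi> = Hom X p q" "mul X p q c \<delta> \<phi> = \<gamma> \<cdot> Run V K"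
      using cotensor_ex[OF X q, of p "\<gamma> \<cdot> Run V K" \<I>] s by auto
    then show ?thesis using s X by (auto simp: ract_def)
  qed
  have id: "lact X p q p \<psi> \<phi> = Jd X p"
    if p: "is_cotensor V X K c p \<gamma>" and q: "is_cotensor V X K c q \<delta>" and
      h: "Dom V \<phi> = \<I>" "Cod V \<phi> = Hom X p q" "ract X p q c \<delta> \<phi> = \<gamma>"
      "Dom V \<psi> = \<I>" "Cod V \<psi> = Hom X q p" "ract X q p c \<gamma> \<psi> = \<delta>" for p q \<gamma> \<delta> \<phi> \<psi>
  proof (rule cotensor_cancel[OF X p])
    note s = cotensor_simps[OF p] cotensor_simps[OF q]
    have "ract X p p c \<gamma> (lact X p q p \<psi> \<phi>) = ract X p q c (ract X q p c \<gamma> \<psi>) \<phi>"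
      using s X h(1,2,4,5) by (subst ract_ract) simp_all
    also have "\<dots> = ract X p p c \<gamma> (Jd X p)" using h s X by simp
    finally show "mul X p p c \<gamma> (lact X p q p \<psi> \<phi>) = mul X p p c \<gamma> (Jd X p)"
      using s X h by (simp add: mul_unit_right)
  qed (use X h cotensor_simps[OF p] cotensor_simps[OF q] in simp_all)
  obtain \<phi> where 1: "Dom V \<phi> = \<I>" "Cod V \<phi> = Hom X p q" "ract X p q c \<delta> \<phi> = \<gamma>"
    using ex[OF p q] by blast
  obtain \<psi> where 2: "Dom V \<psi> = \<I>" "Cod V \<psi> = Hom X q p" "ract X q p c \<gamma> \<psi> = \<delta>"
    using ex[OF q p] by blast
  show thesis
    using that[of \<phi> \<psi>] id[OF p q 1 2] id[OF q p 2 1] 1 2 by (simp add: inverse_elements_def)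
qed

lemma lact_Jd_right [simp]:
  assumes "vcategory V X" "a \<in> Obj X" "b \<in> Obj X" "Cod V u = Hom X a b" "Dom V u = \<I>"
  shows "lact X a a b u (Jd X a) = u"
  using assms ract_Jd[OF assms(1-4)] by (simp add: ract_eq_lact)

section \<open>Conjugation by invertible elements\<close>

text \<open>The composite \<open>v f u\<close> for a generalized element \<open>f\<close>. Since
  \<open>u\<close> and \<open>v\<close> are ordinary arrows, the domain of \<open>f\<close> is
  preserved and no coherence isomorphism enters.\<close>

definition conj_el :: "('a, 'o, 'm, 'z) vcat_scheme \<Rightarrow> 'a \<Rightarrow> 'a \<Rightarrow> 'a \<Rightarrow> 'a \<Rightarrow> 'm \<Rightarrow> 'm \<Rightarrow> 'm \<Rightarrow> 'm" where
  "conj_el X a' a b b' v f u = ract X a' a b' (lact X a b b' v f) u"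

lemma conj_el_simps [simp]:
  assumes "vcategory V X" "a \<in> Obj X" "a' \<in> Obj X" "b \<in> Obj X" "b' \<in> Obj X"
    "Dom V v = \<I>" "Cod V v = Hom X b b'" "Dom V u = \<I>" "Cod V u = Hom X a' a" "Cod V f = Hom X a b"
  shows "Dom V (conj_el X a' a b b' v f u) = Dom V f"
    "Cod V (conj_el X a' a b b' v f u) = Hom X a' b'"
    "Cod V k = Dom V f \<Longrightarrow> conj_el X a' a b b' v f u \<cdot> k = conj_el X a' a b b' v (f \<cdot> k) u"
  using assms by (simp_all add: conj_el_def)

lemma inverse_elements_simps:
  assumes "inverse_elements X a b \<phi> \<psi>"
  shows "Dom V \<phi> = \<I>" "Cod V \<phi> = Hom X a b" "Dom V \<psi> = \<I>" "Cod V \<psi> = Hom X b a"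
    "lact X a b a \<psi> \<phi> = Jd X a" "lact X b a b \<phi> \<psi> = Jd X b"
  using assms by (auto simp: inverse_elements_def)

lemma inverse_elements_sym: "inverse_elements X a b \<phi> \<psi> \<Longrightarrow> inverse_elements X b a \<psi> \<phi>"
  by (auto simp: inverse_elements_def)

lemma inverse_elements_cancel:
  assumes X: "vcategory V X" "a \<in> Obj X" "b \<in> Obj X" "c \<in> Obj X" and i: "inverse_elements X a b \<phi> \<psi>"
  shows "Cod V f = Hom X c a \<Longrightarrow> lact X c b a \<psi> (lact X c a b \<phi> f) = f"
    "Cod V f = Hom X c b \<Longrightarrow> lact X c a b \<phi> (lact X c b a \<psi> f) = f"
    "Cod V f = Hom X a c \<Longrightarrow> ract X a b c (ract X b a c f \<psi>) \<phi> = f"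
    "Cod V f = Hom X b c \<Longrightarrow> ract X b a c (ract X a b c f \<phi>) \<psi> = f"
  using X inverse_elements_simps[OF i] by (simp_all add: lact_lact ract_ract)

text \<open>Moving invertible elements to the other side. The second equivalence translates a
  naturality square into a formula for one of its sides.\<close>

lemma conj_el_eq_iff:
  assumes X: "vcategory V X" "a \<in> Obj X" "a' \<in> Obj X" "b \<in> Obj X" "b' \<in> Obj X"
    and u: "inverse_elements X a a' u u'" and v: "inverse_elements X b b' v v'"
    and f: "Cod V f = Hom X a b" "Cod V g = Hom X a' b'"
  shows "conj_el X a' a b b' v f u' = g \<longleftrightarrow> f = conj_el X a a' b' b v' g u"
    "lact X a b b' v f = ract X a a' b' g u \<longleftrightarrow> g = conj_el X a' a b b' v f u'"
proof -
  note s = inverse_elements_simps[OF u] inverse_elements_simps[OF v]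
  note c = inverse_elements_cancel[OF X(1,2,3) _ u] inverse_elements_cancel[OF X(1,4,5) _ v]
  show "conj_el X a' a b b' v f u' = g \<longleftrightarrow> f = conj_el X a a' b' b v' g u"
    using f s X c by (auto simp: conj_el_def lact_ract)
  show "lact X a b b' v f = ract X a a' b' g u \<longleftrightarrow> g = conj_el X a' a b b' v f u'"
  proof
    assume "lact X a b b' v f = ract X a a' b' g u"
    then have "conj_el X a' a b b' v f u' = ract X a' a b' (ract X a a' b' g u) u'"
      by (simp add: conj_el_def)
    then show "g = conj_el X a' a b b' v f u'" using f s X c by simp
  next
    assume "g = conj_el X a' a b b' v f u'"
    then show "lact X a b b' v f = ract X a a' b' g u"
      using f s X c by (simp add: conj_el_def)
  qed
qed

text \<open>In the middle of the composite \<open>v'\<close> meets \<open>v\<close> and they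
  cancel.\<close>

lemma mul_conj_el:
  assumes X: "vcategory V X" "a \<in> Obj X" "a' \<in> Obj X" "b \<in> Obj X" "b' \<in> Obj X" "c \<in> Obj X" "c' \<in> Obj X"
    and v: "inverse_elements X b b' v v'"
    and u: "Dom V u = \<I>" "Cod V u = Hom X a' a" and w: "Dom V w = \<I>" "Cod V w = Hom X c c'"
    and f: "Cod V f = Hom X a b" "Cod V g = Hom X b c"
  shows "mul X a' b' c' (conj_el X b' b c c' w g v') (conj_el X a' a b b' v f u)
    = conj_el X a' a c c' w (mul X a b c g f) u"
proof -
  note s = inverse_elements_simps[OF v]
  have "mul X a' b' c' (conj_el X b' b c c' w g v') (conj_el X a' a b b' v f u)
      = ract X a' a c' (mul X a b' c' (ract X b' b c' (lact X b c c' w g) v') (lact X a b b' v f)) u"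
    using X u w f s by (simp add: conj_el_def mul_ract)
  also have "mul X a b' c' (ract X b' b c' (lact X b c c' w g) v') (lact X a b b' v f)
      = lact X a c c' w (mul X a b c g f)"
    using X u w f s inverse_elements_cancel(1)[OF X(1,4,5,2) v] by (simp add: mul_ract_lact mul_lact)
  finally show ?thesis by (simp add: conj_el_def)
qed

text \<open>Transport of structure along pointwise invertible elements. \<open>G\<close> enters as
  raw data whose functoriality is a conclusion: this is how the pointwise cotensors of an algebra
  and the commutant algebra are recognised as algebras.\<close>

definition conjugate ::
    "('a, 'o, 'm, 'y) vcat_scheme \<Rightarrow> ('b, 'o, 'm, 'z) vcat_scheme \<Rightarrow> ('a, 'b, 'm) vfun
      \<Rightarrow> ('a, 'b, 'm) vfun \<Rightarrow> ('a \<Rightarrow> 'm) \<Rightarrow> ('a \<Rightarrow> 'm) \<Rightarrow> bool" where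
  "conjugate X Y F G \<phi> \<psi> \<longleftrightarrow> G = mk_vfun (Obj X) (Fo G) (Fh G) \<and>
     (\<forall>a \<in> Obj X. Fo G a \<in> Obj Y \<and> inverse_elements Y (Fo F a) (Fo G a) (\<phi> a) (\<psi> a)) \<and>
     (\<forall>a \<in> Obj X. \<forall>b \<in> Obj X.
        Fh G a b = conj_el Y (Fo G a) (Fo F a) (Fo F b) (Fo G b) (\<phi> b) (Fh F a b) (\<psi> a))"

context
  fixes X :: "('a, 'o, 'm, 'y) vcat_scheme" and Y :: "('b, 'o, 'm, 'z) vcat_scheme" and F G \<phi> \<psi>
  assumes X: "vcategory V X" and Y: "vcategory V Y" and F: "vfunctor V X Y F"
    and FG: "conjugate X Y F G \<phi> \<psi>"
begin

lemma conjugate_simps: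
  assumes "a \<in> Obj X"
  shows "Fo G a \<in> Obj Y" "inverse_elements Y (Fo F a) (Fo G a) (\<phi> a) (\<psi> a)"
    "Dom V (\<phi> a) = \<I>" "Cod V (\<phi> a) = Hom Y (Fo F a) (Fo G a)"
    "Dom V (\<psi> a) = \<I>" "Cod V (\<psi> a) = Hom Y (Fo G a) (Fo F a)"
    "lact Y (Fo F a) (Fo G a) (Fo F a) (\<psi> a) (\<phi> a) = Jd Y (Fo F a)"
    "lact Y (Fo G a) (Fo F a) (Fo G a) (\<phi> a) (\<psi> a) = Jd Y (Fo G a)"
  using FG assms by (auto simp: conjugate_def inverse_elements_def)

lemma conjugate_Fh:
  "\<lbrakk>a \<in> Obj X; b \<in> Obj X\<rbrakk> \<Longrightarrow>
    Fh G a b = conj_el Y (Fo G a) (Fo F a) (Fo F b) (Fo G b) (\<phi> b) (Fh F a b) (\<psi> a)"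
  using FG by (auto simp: conjugate_def)

lemma conjugate_vfunctor: "vfunctor V X Y G"
proof -
  note [simp] = X Y vfunctor_simps[OF F] conjugate_simps
  have "Fh G a a \<cdot> Jd X a = Jd Y (Fo G a)" if "a \<in> Obj X" for a
    using that vfunctor_Jd[OF F that] by (simp add: conjugate_Fh) (simp add: conj_el_def ract_eq_lact)
  moreover have "Fh G a c \<cdot> Mu X a b c = Mu Y (Fo G a) (Fo G b) (Fo G c) \<cdot> (Fh G b c \<odot> Fh G a b)"
    if "a \<in> Obj X" "b \<in> Obj X" "c \<in> Obj X" for a b c
  proof -
    have "Fh G a c \<cdot> Mu X a b c = conj_el Y (Fo G a) (Fo F a) (Fo F c) (Fo G c) (\<phi> c)
        (mul Y (Fo F a) (Fo F b) (Fo F c) (Fh F b c) (Fh F a b)) (\<psi> a)"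
      using that by (simp add: conjugate_Fh vfunctor_Mu[OF F])
    also have "\<dots> = mul Y (Fo G a) (Fo G b) (Fo G c) (Fh G b c) (Fh G a b)"
      using that by (simp add: conjugate_Fh mul_conj_el[OF Y _ _ _ _ _ _ conjugate_simps(2)[OF that(2)]])
    finally show ?thesis by (simp add: mul_def)
  qed
  ultimately show ?thesis
    using FG unfolding vfunctor_def in_hom_iff by (auto simp: conjugate_Fh conjugate_def)
qed

lemma conjugate_sym: "conjugate X Y G F \<psi> \<phi>"
proof -
  note [simp] = X Y vfunctor_simps[OF F] conjugate_simps
  have "Fh F a b = conj_el Y (Fo F a) (Fo G a) (Fo G b) (Fo F b) (\<psi> b) (Fh G a b) (\<phi> a)"
    if "a \<in> Obj X" "b \<in> Obj X" for a b
    using that conj_el_eq_iff(1)[OF Y _ _ _ _ conjugate_simps(2)[OF that(1)] conjugate_simps(2)[OF that(2)], of "Fh F a b" "Fh G a b"]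
    by (simp add: conjugate_Fh)
  then show ?thesis
    using F unfolding conjugate_def by (auto simp: vfunctor_def inverse_elements_sym)
qed

lemma conjugate_preserves_cotensors:
  assumes P: "preserves_cotensors V J X Y F"
  shows "preserves_cotensors V J X Y G"
  unfolding preserves_cotensors_def
proof (intro ballI allI impI)
  fix K c p \<gamma> assume "K \<in> J" and c: "is_cotensor V X K c p \<gamma>"
  then have c': "is_cotensor V Y K (Fo F c) (Fo F p) (Fh F p c \<cdot> \<gamma>)"
    using P by (auto simp: preserves_cotensors_def)
  note [simp] = X Y vfunctor_simps[OF F] conjugate_simps vfunctor_simps[OF conjugate_vfunctor] cotensor_simps[OF c]
  let ?\<gamma> = "Fh F p c \<cdot> \<gamma>"
  have g: "Fh G p c \<cdot> \<gamma> = conj_el Y (Fo G p) (Fo F p) (Fo F c) (Fo G c) (\<phi> c) ?\<gamma> (\<psi> p)"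
    by (simp add: conjugate_Fh)
  \<comment> \<open>Composing with the counit for \<open>G\<close> is composing with the counit for
    \<open>F\<close>, preceded by \<open>\<psi> p\<close> and followed by \<open>\<phi> c\<close>.
    Both are invertible, so factorisations for \<open>F\<close> and \<open>G\<close>
    correspond.\<close>
  have m: "mul Y b (Fo G p) (Fo G c) (Fh G p c \<cdot> \<gamma>) h
      = lact Y b (Fo F c) (Fo G c) (\<phi> c) (mul Y b (Fo F p) (Fo F c) ?\<gamma> (lact Y b (Fo G p) (Fo F p) (\<psi> p) h))"
    if "b \<in> Obj Y" "Cod V h = Hom Y b (Fo G p)" for b h
    using that by (simp add: g conj_el_def mul_ract_lact mul_lact)
  show "is_cotensor V Y K (Fo G c) (Fo G p) (Fh G p c \<cdot> \<gamma>)"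
    unfolding is_cotensor_iff[OF Y]
  proof (intro conjI ballI allI impI)
    fix b Z k assume b [simp]: "b \<in> Obj Y" and k: "Dom V k = K \<otimes> Z \<and> Cod V k = Hom Y b (Fo G c)"
    note e = inverse_elements_cancel[OF Y _ _ b conjugate_simps(2)]
    let ?k = "lact Y b (Fo G c) (Fo F c) (\<psi> c) k"
    obtain h where h: "Dom V h = Z" "Cod V h = Hom Y b (Fo F p)" "mul Y b (Fo F p) (Fo F c) ?\<gamma> h = ?k"
      using cotensor_ex[OF Y c', of b ?k Z] k by auto
    show "\<exists>!h. Dom V h = Z \<and> Cod V h = Hom Y b (Fo G p) \<and> mul Y b (Fo G p) (Fo G c) (Fh G p c \<cdot> \<gamma>) h = k"
    proof (intro ex1I[of _ "lact Y b (Fo F p) (Fo G p) (\<phi> p) h"] conjI)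
      fix h' assume h': "Dom V h' = Z \<and> Cod V h' = Hom Y b (Fo G p) \<and>
          mul Y b (Fo G p) (Fo G c) (Fh G p c \<cdot> \<gamma>) h' = k"
      then have "k = lact Y b (Fo F c) (Fo G c) (\<phi> c)
          (mul Y b (Fo F p) (Fo F c) ?\<gamma> (lact Y b (Fo G p) (Fo F p) (\<psi> p) h'))"
        using m[of b h'] by simp
      then have "?k = mul Y b (Fo F p) (Fo F c) ?\<gamma> (lact Y b (Fo G p) (Fo F p) (\<psi> p) h')"
        using h' by (simp add: e)
      then have "lact Y b (Fo G p) (Fo F p) (\<psi> p) h' = h"
        using h h' by - (rule cotensor_cancel[OF Y c' b], simp_all)
      then show "h' = lact Y b (Fo F p) (Fo G p) (\<phi> p) h"
        using h' e(2)[of p h'] by auto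
    qed (use h k in \<open>simp_all add: m e\<close>)
  qed simp_all
qed

end

section \<open>Natural transformations\<close>

text \<open>For a family with domain \<open>\<I>\<close> both sides of the naturality condition end
  in the same \<open>Run\<close>: \<open>lun_sym\<close> absorbs the symmetry on the left side.
  Cancelling it leaves a square without coherence isomorphisms.\<close>

lemma vnat_iff:
  assumes "vcategory V X" "vcategory V Y" "vfunctor V X Y F" "vfunctor V X Y G"
  shows "vnat V X Y F G f \<longleftrightarrow> f \<in> extensional (Obj X) \<and>
    (\<forall>a \<in> Obj X. Dom V (f a) = \<I> \<and> Cod V (f a) = Hom Y (Fo F a) (Fo G a)) \<and>
    (\<forall>a \<in> Obj X. \<forall>b \<in> Obj X. lact Y (Fo F a) (Fo F b) (Fo G b) (f b) (Fh F a b)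
        = ract Y (Fo F a) (Fo G a) (Fo G b) (Fh G a b) (f a))"
proof -
  have "mul Y (Fo F a) (Fo F b) (Fo G b) (f b) (Fh F a b) \<cdot> Sym V (Hom X a b) \<I>
       = mul Y (Fo F a) (Fo G a) (Fo G b) (Fh G a b) (f a) \<longleftrightarrow>
     lact Y (Fo F a) (Fo F b) (Fo G b) (f b) (Fh F a b) = ract Y (Fo F a) (Fo G a) (Fo G b) (Fh G a b) (f a)"
    (is "?l \<cdot> ?s = ?r \<longleftrightarrow> ?l' = ?r'")
    if "a \<in> Obj X" "b \<in> Obj X" "Dom V (f a) = \<I>" "Cod V (f a) = Hom Y (Fo F a) (Fo G a)"
       "Dom V (f b) = \<I>" "Cod V (f b) = Hom Y (Fo F b) (Fo G b)" for a b
  proof -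
    have l: "?l \<cdot> ?s = ?l' \<cdot> Run V (Hom X a b)"
      using assms that by (simp add: mul_unit_left comp_reassoc[OF lun_sym] lun_sym del: lact_comp)
    have r: "?r = ?r' \<cdot> Run V (Hom X a b)"
      using assms that by (simp add: mul_unit_right del: ract_comp)
    show ?thesis
      unfolding l r
    proof
      assume "?l' \<cdot> Run V (Hom X a b) = ?r' \<cdot> Run V (Hom X a b)"
      then show "?l' = ?r'"
        by (rule iso_cancel_right) (use assms that in simp_all)
    qed simp
  qed
  then show ?thesis
    unfolding vnat_def vnat_family_def in_hom_iff
    by (intro conj_cong ball_cong refl) (use assms in \<open>simp_all add: mul_def\<close>)
qed

lemma vnat_comp_eq:
  assumes "vcategory V Y" "\<And>a. a \<in> Obj X \<Longrightarrow> Fo F a \<in> Obj Y" "\<And>a. a \<in> Obj X \<Longrightarrow> Fo G a \<in> Obj Y"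
    "\<And>a. a \<in> Obj X \<Longrightarrow> Fo H a \<in> Obj Y"
    "\<And>a. a \<in> Obj X \<Longrightarrow> Dom V (f a) = \<I> \<and> Cod V (f a) = Hom Y (Fo F a) (Fo G a)"
    "\<And>a. a \<in> Obj X \<Longrightarrow> Dom V (g a) = \<I> \<and> Cod V (g a) = Hom Y (Fo G a) (Fo H a)"
  shows "vnat_comp V X Y F G H g f = (\<lambda>a \<in> Obj X. lact Y (Fo F a) (Fo G a) (Fo H a) (g a) (f a))"
  unfolding vnat_comp_def by (rule restrict_ext) (use assms in \<open>simp add: lact_def mul_def\<close>)

lemma conjugate_vnat_iso:
  assumes X: "vcategory V X" and Y: "vcategory V Y" and F: "vfunctor V X Y F"
    and FG: "conjugate X Y F G \<phi> \<psi>"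
  shows "vnat_iso V X Y F G (restrict \<phi> (Obj X))"
proof -
  \<comment> \<open>Generalized over all the data so that it also applies to the reversed
    conjugation, which supplies the inverse.\<close>
  have nat: "vnat V X Y F G (restrict \<phi> (Obj X))"
    if F: "vfunctor V X Y F" and FG: "conjugate X Y F G \<phi> \<psi>" for F G \<phi> \<psi>
  proof -
    note G = conjugate_vfunctor[OF X Y F FG]
    note [simp] = vfunctor_simps[OF F] conjugate_simps[OF X Y F FG] X Y
    have "lact Y (Fo F a) (Fo F b) (Fo G b) (\<phi> b) (Fh F a b) = ract Y (Fo F a) (Fo G a) (Fo G b) (Fh G a b) (\<phi> a)"
      if "a \<in> Obj X" "b \<in> Obj X" for a b
      using that by (subst conj_el_eq_iff(2)[OF Y _ _ _ _ conjugate_simps(2)[OF X Y F FG that(1)]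
          conjugate_simps(2)[OF X Y F FG that(2)]]) (simp_all add: conjugate_Fh[OF X Y F FG])
    then show ?thesis
      unfolding vnat_iff[OF X Y F G] by simp
  qed
  note G = conjugate_vfunctor[OF X Y F FG] and GF = conjugate_sym[OF X Y F FG]
  note [simp] = vfunctor_simps[OF F] conjugate_simps[OF X Y F FG]
  show ?thesis
    unfolding vnat_iso_def
  proof (intro conjI exI[of _ "restrict \<psi> (Obj X)"])
    show "vnat V X Y F G (restrict \<phi> (Obj X))" "vnat V X Y G F (restrict \<psi> (Obj X))"
      using nat[OF F FG] nat[OF G GF] .
    show "vnat_comp V X Y F G F (restrict \<psi> (Obj X)) (restrict \<phi> (Obj X)) = vnat_id X Y F"
      "vnat_comp V X Y G F G (restrict \<phi> (Obj X)) (restrict \<psi> (Obj X)) = vnat_id X Y G"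
      unfolding vnat_id_def by (subst vnat_comp_eq; simp add: Y cong: restrict_cong)+
  qed
qed

section \<open>Ends\<close>

lemma vnat_family_iff:
  assumes "vcategory V X" "vcategory V Y" "vfunctor V X Y F" "vfunctor V X Y G"
  shows "vnat_family V X Y F G Z \<alpha> \<longleftrightarrow>
    (\<forall>a \<in> Obj X. Dom V (\<alpha> a) = Z \<and> Cod V (\<alpha> a) = Hom Y (Fo F a) (Fo G a)) \<and>
    (\<forall>a \<in> Obj X. \<forall>b \<in> Obj X.
      mul Y (Fo F a) (Fo F b) (Fo G b) (\<alpha> b) (Fh F a b) \<cdot> Sym V (Hom X a b) Z =
      mul Y (Fo F a) (Fo G a) (Fo G b) (Fh G a b) (\<alpha> a))"
  unfolding vnat_family_def in_hom_iff
  by (intro conj_cong ball_cong refl) (use assms in \<open>simp_all add: mul_def\<close>)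

text \<open>By \<open>mul_conj_el\<close> the two sides of the new naturality condition are
  conjugates of the two sides of the old one.\<close>

lemma vnat_family_conjugate:
  assumes X: "vcategory V X" and Y: "vcategory V Y" and F: "vfunctor V X Y F" and G: "vfunctor V X Y G"
    and F': "conjugate X Y F F' \<phi> \<phi>'" and G': "conjugate X Y G G' \<psi> \<psi>'" and \<alpha>: "vnat_family V X Y F G Z \<alpha>"
  shows "vnat_family V X Y F' G' Z
    (\<lambda>a. conj_el Y (Fo F' a) (Fo F a) (Fo G a) (Fo G' a) (\<psi> a) (\<alpha> a) (\<phi>' a))"
proof -
  note [simp] = X Y vfunctor_simps[OF F] vfunctor_simps[OF G] conjugate_simps[OF X Y F F'] conjugate_simps[OF X Y G G']
  have [simp]: "Dom V (\<alpha> a) = Z" "Cod V (\<alpha> a) = Hom Y (Fo F a) (Fo G a)" if "a \<in> Obj X" for a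
    using \<alpha> that unfolding vnat_family_iff[OF X Y F G] by auto
  have nat: "mul Y (Fo F a) (Fo F b) (Fo G b) (\<alpha> b) (Fh F a b) \<cdot> Sym V (Hom X a b) Z =
      mul Y (Fo F a) (Fo G a) (Fo G b) (Fh G a b) (\<alpha> a)" if "a \<in> Obj X" "b \<in> Obj X" for a b
    using \<alpha> that unfolding vnat_family_iff[OF X Y F G] by auto
  show ?thesis
    unfolding vnat_family_iff[OF X Y conjugate_vfunctor[OF X Y F F'] conjugate_vfunctor[OF X Y G G']]
  proof (intro conjI ballI)
    fix a b assume ab [simp]: "a \<in> Obj X" "b \<in> Obj X"
    note m = mul_conj_el[OF Y _ _ _ _ _ _ conjugate_simps(2)[OF X Y F F' ab(2)]]
      mul_conj_el[OF Y _ _ _ _ _ _ conjugate_simps(2)[OF X Y G G' ab(1)]]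
    show "mul Y (Fo F' a) (Fo F' b) (Fo G' b)
          (conj_el Y (Fo F' b) (Fo F b) (Fo G b) (Fo G' b) (\<psi> b) (\<alpha> b) (\<phi>' b)) (Fh F' a b) \<cdot>
          Sym V (Hom X a b) Z =
        mul Y (Fo F' a) (Fo G' a) (Fo G' b) (Fh G' a b)
         (conj_el Y (Fo F' a) (Fo F a) (Fo G a) (Fo G' a) (\<psi> a) (\<alpha> a) (\<phi>' a))"
      by (simp add: conjugate_Fh[OF X Y F F'] conjugate_Fh[OF X Y G G'] m nat)
  qed simp_all
qed

text \<open>Conjugation is a bijection between natural families that commutes with precomposition,
  so the object \<open>E\<close> serves both pairs of functors and only the projections
  change.\<close>

lemma is_end_conjugate:
  assumes X: "vcategory V X" and Y: "vcategory V Y" and F: "vfunctor V X Y F" and G: "vfunctor V X Y G"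
    and F': "conjugate X Y F F' \<phi> \<phi>'" and G': "conjugate X Y G G' \<psi> \<psi>'" and E: "is_end V X Y F G E \<pi>"
  shows "is_end V X Y F' G' E (\<lambda>a. conj_el Y (Fo F' a) (Fo F a) (Fo G a) (Fo G' a) (\<psi> a) (\<pi> a) (\<phi>' a))"
proof -
  note [simp] = X Y vfunctor_simps[OF F] vfunctor_simps[OF G] conjugate_simps[OF X Y F F'] conjugate_simps[OF X Y G G']
  have \<pi>: "vnat_family V X Y F G E \<pi>" using E by (simp add: is_end_def)
  then have [simp]: "Dom V (\<pi> a) = E" "Cod V (\<pi> a) = Hom Y (Fo F a) (Fo G a)" if "a \<in> Obj X" for a
    using that unfolding vnat_family_iff[OF X Y F G] by auto
  show ?thesis
    unfolding is_end_def
  proof (intro conjI allI impI vnat_family_conjugate[OF X Y F G F' G' \<pi>])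
    fix Z \<alpha> assume \<alpha>: "vnat_family V X Y F' G' Z \<alpha>"
    from \<alpha> have [simp]: "Dom V (\<alpha> a) = Z" "Cod V (\<alpha> a) = Hom Y (Fo F' a) (Fo G' a)" if "a \<in> Obj X" for a
      using that unfolding vnat_family_iff[OF X Y conjugate_vfunctor[OF X Y F F'] conjugate_vfunctor[OF X Y G G']] by auto
    have "vnat_family V X Y F G Z (\<lambda>a. conj_el Y (Fo F a) (Fo F' a) (Fo G' a) (Fo G a) (\<psi>' a) (\<alpha> a) (\<phi> a))"
      by (rule vnat_family_conjugate[OF X Y conjugate_vfunctor[OF X Y F F'] conjugate_vfunctor[OF X Y G G']
           conjugate_sym[OF X Y F F'] conjugate_sym[OF X Y G G'] \<alpha>])
    then have "\<exists>!h. h \<in> hom V Z E \<and>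
        (\<forall>a \<in> Obj X. \<pi> a \<cdot> h = conj_el Y (Fo F a) (Fo F' a) (Fo G' a) (Fo G a) (\<psi>' a) (\<alpha> a) (\<phi> a))"
      using E by (simp add: is_end_def)
    moreover have "conj_el Y (Fo F' a) (Fo F a) (Fo G a) (Fo G' a) (\<psi> a) (\<pi> a) (\<phi>' a) \<cdot> h = \<alpha> a \<longleftrightarrow>
        \<pi> a \<cdot> h = conj_el Y (Fo F a) (Fo F' a) (Fo G' a) (Fo G a) (\<psi>' a) (\<alpha> a) (\<phi> a)"
      if "h \<in> hom V Z E" "a \<in> Obj X" for h a
      using that conj_el_eq_iff(1)[OF Y _ _ _ _ conjugate_simps(2)[OF X Y F F' that(2)]
          conjugate_simps(2)[OF X Y G G' that(2)], of "\<pi> a \<cdot> h" "\<alpha> a"]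
      by (simp add: in_hom_iff)
    ultimately show "\<exists>!h. h \<in> hom V Z E \<and>
        (\<forall>a \<in> Obj X. conj_el Y (Fo F' a) (Fo F a) (Fo G a) (Fo G' a) (\<psi> a) (\<pi> a) (\<phi>' a) \<cdot> h = \<alpha> a)"
      by (metis (no_types, lifting))
  qed
qed

text \<open>The restrictions \<open>\<pi> a \<cdot> h\<close> again form a natural family, to which
  the uniqueness in \<open>is_end\<close> applies.\<close>

lemma is_end_cancel:
  assumes "is_end V X Y F G E \<pi>" "Dom V h = Dom V h'" "Cod V h = E" "Cod V h' = E"
    "vcategory V X" "vcategory V Y" "vfunctor V X Y F" "vfunctor V X Y G"
    "\<And>a. a \<in> Obj X \<Longrightarrow> \<pi> a \<cdot> h = \<pi> a \<cdot> h'"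
  shows "h = h'"
proof -
  have \<pi>: "vnat_family V X Y F G E \<pi>" using assms(1) by (simp add: is_end_def)
  then have [simp]: "Dom V (\<pi> a) = E" "Cod V (\<pi> a) = Hom Y (Fo F a) (Fo G a)" if "a \<in> Obj X" for a
    using that unfolding vnat_family_iff[OF assms(5-8)] by auto
  note [simp] = vfunctor_simps[OF assms(7)] vfunctor_simps[OF assms(8)]
  have "vnat_family V X Y F G (Dom V h) (\<lambda>a. \<pi> a \<cdot> h)"
    unfolding vnat_family_iff[OF assms(5-8)]
  proof (intro conjI ballI)
    fix a b assume ab [simp]: "a \<in> Obj X" "b \<in> Obj X"
    have "mul Y (Fo F a) (Fo F b) (Fo G b) (\<pi> b \<cdot> h) (Fh F a b) \<cdot> Sym V (Hom X a b) (Dom V h)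
      = mul Y (Fo F a) (Fo F b) (Fo G b) (\<pi> b) (Fh F a b) \<cdot> (h \<odot> \<one> (Hom X a b)) \<cdot> Sym V (Hom X a b) (Dom V h)"
      using assms by simp
    also have "\<dots> = (mul Y (Fo F a) (Fo F b) (Fo G b) (\<pi> b) (Fh F a b) \<cdot> Sym V (Hom X a b) E) \<cdot> (\<one> (Hom X a b) \<odot> h)"
      using assms sym_nat'[of "\<one> (Hom X a b)" h] by simp
    also have "\<dots> = mul Y (Fo F a) (Fo G a) (Fo G b) (Fh G a b) (\<pi> a) \<cdot> (\<one> (Hom X a b) \<odot> h)"
      using \<pi> by (simp only: vnat_family_iff[OF assms(5-8)] ab)
    also have "\<dots> = mul Y (Fo F a) (Fo G a) (Fo G b) (Fh G a b) (\<pi> a \<cdot> h)"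
      using assms by simp
    finally show "mul Y (Fo F a) (Fo F b) (Fo G b) (\<pi> b \<cdot> h) (Fh F a b) \<cdot> Sym V (Hom X a b) (Dom V h)
      = mul Y (Fo F a) (Fo G a) (Fo G b) (Fh G a b) (\<pi> a \<cdot> h)" .
  qed (use assms in simp_all)
  then have "\<exists>!k. k \<in> hom V (Dom V h) E \<and> (\<forall>a \<in> Obj X. \<pi> a \<cdot> k = \<pi> a \<cdot> h)"
    using assms(1) by (simp add: is_end_def)
  then show ?thesis
    using assms by (metis (no_types, lifting) in_hom_iff)
qed

definition end_exists ::
    "('a, 'o, 'm, 'y) vcat_scheme \<Rightarrow> ('b, 'o, 'm, 'z) vcat_scheme \<Rightarrow> ('a, 'b, 'm) vfun
      \<Rightarrow> ('a, 'b, 'm) vfun \<Rightarrow> bool" where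
  "end_exists X Y F G \<longleftrightarrow> vcategory V X \<and> vcategory V Y \<and> vfunctor V X Y F \<and> vfunctor V X Y G \<and>
     (\<exists>E \<pi>. is_end V X Y F G E \<pi>)"

lemma is_end_EndOb:
  assumes "end_exists X Y F G"
  shows "is_end V X Y F G (EndOb V X Y F G) (EndPr V X Y F G)"
proof -
  have "\<exists>p. case p of (E, \<pi>) \<Rightarrow> is_end V X Y F G E \<pi>" using assms by (auto simp: end_exists_def)
  from someI_ex[OF this] show ?thesis
    by (simp add: EndOb_def EndPr_def some_end_def split: prod.splits)
qed

lemma EndPr_simps:
  assumes "end_exists X Y F G" "a \<in> Obj X"
  shows "Dom V (EndPr V X Y F G a) = EndOb V X Y F G" "Cod V (EndPr V X Y F G a) = Hom Y (Fo F a) (Fo G a)"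
  using is_end_EndOb[OF assms(1)] assms(2) by (auto simp: is_end_def vnat_family_def in_hom_iff)

lemma EndPr_vnat:
  assumes "end_exists X Y F G"
  shows "vnat_family V X Y F G (EndOb V X Y F G) (EndPr V X Y F G)"
  using is_end_EndOb[OF assms(1)] by (auto simp: is_end_def)

lemma EndPr_cancel:
  assumes "end_exists X Y F G" "Dom V h = Dom V h'" "Cod V h = EndOb V X Y F G" "Cod V h' = EndOb V X Y F G"
    "\<And>a. a \<in> Obj X \<Longrightarrow> EndPr V X Y F G a \<cdot> h = EndPr V X Y F G a \<cdot> h'"
  shows "h = h'"
  using is_end_cancel[OF is_end_EndOb[OF assms(1)] assms(2-4)] assms(1,5) by (auto simp: end_exists_def)

lemma end_arr_props:
  assumes "end_exists X Y F G" "vnat_family V X Y F G Z \<alpha>"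
  shows "Dom V (end_arr V X Y F G Z \<alpha>) = Z" "Cod V (end_arr V X Y F G Z \<alpha>) = EndOb V X Y F G"
    "a \<in> Obj X \<Longrightarrow> EndPr V X Y F G a \<cdot> end_arr V X Y F G Z \<alpha> = \<alpha> a"
proof -
  have "\<exists>!h. h \<in> hom V Z (EndOb V X Y F G) \<and> (\<forall>a \<in> Obj X. EndPr V X Y F G a \<cdot> h = \<alpha> a)"
    using is_end_EndOb[OF assms(1)] assms(2) by (simp add: is_end_def)
  from theI'[OF this] show "Dom V (end_arr V X Y F G Z \<alpha>) = Z" "Cod V (end_arr V X Y F G Z \<alpha>) = EndOb V X Y F G"
    "a \<in> Obj X \<Longrightarrow> EndPr V X Y F G a \<cdot> end_arr V X Y F G Z \<alpha> = \<alpha> a"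
    by (simp_all add: end_arr_def in_hom_iff)
qed

end

section \<open>Extensionality and composition of enriched functors\<close>

lemma mk_vfun_simps [simp]:
  "a \<in> S \<Longrightarrow> Fo (mk_vfun S p h) a = p a"
  "\<lbrakk>a \<in> S; b \<in> S\<rbrakk> \<Longrightarrow> Fh (mk_vfun S p h) a b = h a b"
  "mk_vfun S (Fo (mk_vfun S p h)) (Fh (mk_vfun S p h)) = mk_vfun S p h"
  by (auto simp: mk_vfun_def fun_eq_iff)

lemma mk_vfun_cong:
  assumes "\<And>a. a \<in> S \<Longrightarrow> p a = p' a" "\<And>a b. \<lbrakk>a \<in> S; b \<in> S\<rbrakk> \<Longrightarrow> h a b = h' a b"
  shows "mk_vfun S p h = mk_vfun S p' h'"
  using assms by (auto simp: mk_vfun_def fun_eq_iff)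

context symmetric_monoidal_closed
begin

lemma vfunctor_mk: "vfunctor V X Y F \<Longrightarrow> F = mk_vfun (Obj X) (Fo F) (Fh F)"
  by (simp add: vfunctor_def)

lemma vfunctor_eqI:
  assumes "vfunctor V X Y F" "vfunctor V X Z G" "\<And>a. a \<in> Obj X \<Longrightarrow> Fo F a = Fo G a"
    "\<And>a b. \<lbrakk>a \<in> Obj X; b \<in> Obj X\<rbrakk> \<Longrightarrow> Fh F a b = Fh G a b"
  shows "F = G"
proof -
  have "F = mk_vfun (Obj X) (Fo F) (Fh F)" using assms(1) by (rule vfunctor_mk)
  also have "\<dots> = mk_vfun (Obj X) (Fo G) (Fh G)" using assms(3,4) by (rule mk_vfun_cong)
  also have "\<dots> = G" using vfunctor_mk[OF assms(2)] by simp
  finally show ?thesis .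
qed

lemma vfun_comp_simps [simp]:
  "a \<in> Obj X \<Longrightarrow> Fo (vfun_comp V X G F) a = Fo G (Fo F a)"
  "\<lbrakk>a \<in> Obj X; b \<in> Obj X\<rbrakk> \<Longrightarrow> Fh (vfun_comp V X G F) a b = Fh G (Fo F a) (Fo F b) \<cdot> Fh F a b"
  by (simp_all add: vfun_comp_def)

lemma vfunctor_comp:
  assumes Y: "vcategory V Y" and Z: "vcategory V Z"
    and F: "vfunctor V X Y F" and G: "vfunctor V Y Z G"
    and X: "\<And>a. a \<in> Obj X \<Longrightarrow> Cod V (Jd X a) = Hom X a a"
      "\<And>a b c. \<lbrakk>a \<in> Obj X; b \<in> Obj X; c \<in> Obj X\<rbrakk> \<Longrightarrow> Cod V (Mu X a b c) = Hom X a c"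
  shows "vfunctor V X Z (vfun_comp V X G F)"
proof -
  note [simp] = X Y Z vfunctor_simps[OF F] vfunctor_simps[OF G]
  show ?thesis
    unfolding vfunctor_def in_hom_iff
  proof (intro conjI ballI)
    show "vfun_comp V X G F = mk_vfun (Obj X) (Fo (vfun_comp V X G F)) (Fh (vfun_comp V X G F))"
      by (simp add: vfun_comp_def)
    fix a b c assume abc [simp]: "a \<in> Obj X" "b \<in> Obj X" "c \<in> Obj X"
    have "Fh G (Fo F a) (Fo F c) \<cdot> Fh F a c \<cdot> Mu X a b c
       = (Fh G (Fo F a) (Fo F c) \<cdot> Mu Y (Fo F a) (Fo F b) (Fo F c)) \<cdot> (Fh F b c \<odot> Fh F a b)"
      by (simp add: vfunctor_Mu[OF F] mul_def)
    also have "\<dots> = mul Z (Fo G (Fo F a)) (Fo G (Fo F b)) (Fo G (Fo F c))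
        (Fh G (Fo F b) (Fo F c)) (Fh G (Fo F a) (Fo F b)) \<cdot> (Fh F b c \<odot> Fh F a b)"
      by (subst vfunctor_Mu[OF G]) simp_all
    finally show "Fh (vfun_comp V X G F) a c \<cdot> Mu X a b c =
       Mu Z (Fo (vfun_comp V X G F) a) (Fo (vfun_comp V X G F) b) (Fo (vfun_comp V X G F) c) \<cdot>
       (Fh (vfun_comp V X G F) b c \<odot> Fh (vfun_comp V X G F) a b)"
      by (simp add: mul_def)
  qed (simp_all add: vfunctor_Jd[OF F] vfunctor_Jd[OF G])
qed

lemma preserves_cotensors_comp:
  assumes F: "preserves_cotensors V J X Y F" and G: "preserves_cotensors V J Y Z G"
    and F': "vfunctor V X Y F" and G': "vfunctor V Y Z G"
  shows "preserves_cotensors V J X Z (vfun_comp V X G F)"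
  unfolding preserves_cotensors_def
proof (intro ballI allI impI)
  fix K c p \<gamma> assume K: "K \<in> J" and c: "is_cotensor V X K c p \<gamma>"
  note [simp] = vfunctor_simps[OF F'] vfunctor_simps[OF G'] cotensor_simps[OF c]
  have "is_cotensor V Z K (Fo G (Fo F c)) (Fo G (Fo F p)) (Fh G (Fo F p) (Fo F c) \<cdot> Fh F p c \<cdot> \<gamma>)"
    using F G K c by (simp add: preserves_cotensors_def)
  then show "is_cotensor V Z K (Fo (vfun_comp V X G F) c) (Fo (vfun_comp V X G F) p)
      (Fh (vfun_comp V X G F) p c \<cdot> \<gamma>)"
    by simp
qed

end

section \<open>Isomorphisms of enriched categories that fix objects\<close>

text \<open>The target \<open>Y\<close> is given as raw data with typed composition, since the
  hom-objects and composition of the commutant are available before its axioms are. The axioms are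
  derived from those of \<open>X\<close>.\<close>

locale id_on_obj_iso = symmetric_monoidal_closed V
  for V :: "('o, 'm) smc" (structure) +
  fixes X :: "('a, 'o, 'm, 'y) vcat_scheme" and Y :: "('a, 'o, 'm, 'z) vcat_scheme" and M
  assumes X: "vcategory V X" and M: "vfunctor V X Y M" and Obj: "Obj Y = Obj X"
    and Fo_M: "a \<in> Obj X \<Longrightarrow> Fo M a = a"
    and iso_M: "\<lbrakk>a \<in> Obj X; b \<in> Obj X\<rbrakk> \<Longrightarrow> iso V (Fh M a b)"
    and Mu_Y: "\<lbrakk>a \<in> Obj X; b \<in> Obj X; c \<in> Obj X\<rbrakk> \<Longrightarrow> Mu Y a b c \<in> hom V (Hom Y b c \<otimes> Hom Y a b) (Hom Y a c)"
begin

lemma M_simps [simp]: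
  "\<lbrakk>a \<in> Obj X; b \<in> Obj X\<rbrakk> \<Longrightarrow> Dom V (Fh M a b) = Hom X a b"
  "\<lbrakk>a \<in> Obj X; b \<in> Obj X\<rbrakk> \<Longrightarrow> Cod V (Fh M a b) = Hom Y a b"
  "\<lbrakk>a \<in> Obj X; b \<in> Obj X; c \<in> Obj X\<rbrakk> \<Longrightarrow> Dom V (Mu Y a b c) = Hom Y b c \<otimes> Hom Y a b"
  "\<lbrakk>a \<in> Obj X; b \<in> Obj X; c \<in> Obj X\<rbrakk> \<Longrightarrow> Cod V (Mu Y a b c) = Hom Y a c"
  using vfunctor_simps(2,3)[OF M] Fo_M Mu_Y by (simp_all add: in_hom_iff)

lemma Jd_Y: "a \<in> Obj X \<Longrightarrow> Jd Y a = Fh M a a \<cdot> Jd X a"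
  using vfunctor_Jd[OF M] Fo_M by simp

lemma Mu_Y_M:
  "\<lbrakk>a \<in> Obj X; b \<in> Obj X; c \<in> Obj X\<rbrakk> \<Longrightarrow> Mu Y a b c \<cdot> (Fh M b c \<odot> Fh M a b) = Fh M a c \<cdot> Mu X a b c"
  using vfunctor_Mu[OF M] Fo_M by (simp add: mul_def)

text \<open>Each axiom may be tested after precomposition with a tensor product of hom arrows of
  \<open>M\<close> and identities. This is invertible, and functoriality of \<open>M\<close> then
  reduces the claim to the axiom in \<open>X\<close>.\<close>

lemma vcategory_Y: "vcategory V Y"
proof -
  note [simp] = X Jd_Y iso_M
  have assoc: "Mu Y a b d \<cdot> (Mu Y b c d \<odot> \<one> (Hom Y a b)) =
     Mu Y a c d \<cdot> (\<one> (Hom Y c d) \<odot> Mu Y a b c) \<cdot> Asc V (Hom Y c d) (Hom Y b c) (Hom Y a b)"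
    if [simp]: "a \<in> Obj X" "b \<in> Obj X" "c \<in> Obj X" "d \<in> Obj X" for a b c d
  proof (rule iso_cancel_right)
    let ?m = "(Fh M c d \<odot> Fh M b c) \<odot> Fh M a b"
    have "(Mu Y a b d \<cdot> (Mu Y b c d \<odot> \<one> (Hom Y a b))) \<cdot> ?m
       = (Mu Y a b d \<cdot> (Fh M b d \<odot> Fh M a b)) \<cdot> (Mu X b c d \<odot> \<one> (Hom X a b))"
      by (simp add: Mu_Y_M[of b c d])
    also have "\<dots> = Fh M a d \<cdot> Mu X a b d \<cdot> (Mu X b c d \<odot> \<one> (Hom X a b))"
      by (subst Mu_Y_M) simp_all
    also have "\<dots> = (Mu Y a c d \<cdot> (Fh M c d \<odot> Fh M a c)) \<cdot> (\<one> (Hom X c d) \<odot> Mu X a b c)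
        \<cdot> Asc V (Hom X c d) (Hom X b c) (Hom X a b)"
      by (subst Mu_Y_M) (simp_all add: vcategory_assoc[OF X])
    also have "\<dots> = Mu Y a c d \<cdot> (\<one> (Hom Y c d) \<odot> Mu Y a b c)
        \<cdot> ((Fh M c d \<odot> (Fh M b c \<odot> Fh M a b)) \<cdot> Asc V (Hom X c d) (Hom X b c) (Hom X a b))"
      by (simp add: Mu_Y_M[of a b c])
    also have "\<dots> = (Mu Y a c d \<cdot> (\<one> (Hom Y c d) \<odot> Mu Y a b c)
        \<cdot> Asc V (Hom Y c d) (Hom Y b c) (Hom Y a b)) \<cdot> ?m"
      using asc_nat'[of "Fh M c d" "Fh M b c" "Fh M a b"] by simp
    finally show "(Mu Y a b d \<cdot> (Mu Y b c d \<odot> \<one> (Hom Y a b))) \<cdot> ?m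
      = (Mu Y a c d \<cdot> (\<one> (Hom Y c d) \<odot> Mu Y a b c)
        \<cdot> Asc V (Hom Y c d) (Hom Y b c) (Hom Y a b)) \<cdot> ?m" .
  qed simp_all
  have unit_l: "Mu Y a b b \<cdot> (Jd Y b \<odot> \<one> (Hom Y a b)) = Lun V (Hom Y a b)"
    if [simp]: "a \<in> Obj X" "b \<in> Obj X" for a b
  proof (rule iso_cancel_right)
    have "(Mu Y a b b \<cdot> (Jd Y b \<odot> \<one> (Hom Y a b))) \<cdot> (\<one> \<I> \<odot> Fh M a b)
       = (Mu Y a b b \<cdot> (Fh M b b \<odot> Fh M a b)) \<cdot> (Jd X b \<odot> \<one> (Hom X a b))"
      by simp
    also have "\<dots> = Fh M a b \<cdot> Lun V (Hom X a b)"
      by (subst Mu_Y_M) (simp_all add: vcategory_unit[OF X])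
    also have "\<dots> = Lun V (Hom Y a b) \<cdot> (\<one> \<I> \<odot> Fh M a b)"
      using lun_nat'[of "Fh M a b"] by simp
    finally show "(Mu Y a b b \<cdot> (Jd Y b \<odot> \<one> (Hom Y a b))) \<cdot> (\<one> \<I> \<odot> Fh M a b)
       = Lun V (Hom Y a b) \<cdot> (\<one> \<I> \<odot> Fh M a b)" .
  qed simp_all
  have unit_r: "Mu Y a a b \<cdot> (\<one> (Hom Y a b) \<odot> Jd Y a) = Run V (Hom Y a b)"
    if [simp]: "a \<in> Obj X" "b \<in> Obj X" for a b
  proof (rule iso_cancel_right)
    have "(Mu Y a a b \<cdot> (\<one> (Hom Y a b) \<odot> Jd Y a)) \<cdot> (Fh M a b \<odot> \<one> \<I>)
       = (Mu Y a a b \<cdot> (Fh M a b \<odot> Fh M a a)) \<cdot> (\<one> (Hom X a b) \<odot> Jd X a)"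
      by simp
    also have "\<dots> = Fh M a b \<cdot> Run V (Hom X a b)"
      by (subst Mu_Y_M) (simp_all add: vcategory_unit[OF X])
    also have "\<dots> = Run V (Hom Y a b) \<cdot> (Fh M a b \<odot> \<one> \<I>)"
      using run_nat'[of "Fh M a b"] by simp
    finally show "(Mu Y a a b \<cdot> (\<one> (Hom Y a b) \<odot> Jd Y a)) \<cdot> (Fh M a b \<odot> \<one> \<I>)
       = Run V (Hom Y a b) \<cdot> (Fh M a b \<odot> \<one> \<I>)" .
  qed simp_all
  show ?thesis
    unfolding vcategory_def in_hom_iff Obj
    by (intro conjI ballI assoc unit_l unit_r; simp)
qed

definition inv_vfun :: "('a, 'a, 'm) vfun" where
  "inv_vfun = mk_vfun (Obj Y) (\<lambda>a. a) (\<lambda>a b. inv_arr V (Fh M a b))"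

lemma inv_vfun_simps [simp]:
  "a \<in> Obj X \<Longrightarrow> Fo inv_vfun a = a"
  "\<lbrakk>a \<in> Obj X; b \<in> Obj X\<rbrakk> \<Longrightarrow> Fh inv_vfun a b = inv_arr V (Fh M a b)"
  by (simp_all add: inv_vfun_def Obj)

lemma vfunctor_inv_vfun: "vfunctor V Y X inv_vfun"
proof -
  note [simp] = X vcategory_Y Obj iso_M
  have "inv_arr V (Fh M a c) \<cdot> Mu Y a b c = Mu X a b c \<cdot> (inv_arr V (Fh M b c) \<odot> inv_arr V (Fh M a b))"
    if [simp]: "a \<in> Obj X" "b \<in> Obj X" "c \<in> Obj X" for a b c
  proof (rule iso_cancel_right)
    show "(inv_arr V (Fh M a c) \<cdot> Mu Y a b c) \<cdot> (Fh M b c \<odot> Fh M a b)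
      = (Mu X a b c \<cdot> (inv_arr V (Fh M b c) \<odot> inv_arr V (Fh M a b))) \<cdot> (Fh M b c \<odot> Fh M a b)"
      by (simp add: Mu_Y_M)
  qed simp_all
  moreover have "inv_vfun = mk_vfun (Obj X) (Fo inv_vfun) (Fh inv_vfun)"
    by (simp add: inv_vfun_def)
  ultimately show ?thesis
    unfolding vfunctor_def in_hom_iff Obj by (simp add: Jd_Y)
qed

lemma id_on_obj_iso_inv_vfun: "id_on_obj_iso V Y X inv_vfun"
  by unfold_locales (simp_all add: vcategory_Y vfunctor_inv_vfun Obj in_hom_iff iso_M X)

text \<open>\<open>M\<close> is bijective on generalized elements of hom-objects and fixes objects,
  so unique factorisations carry over.\<close>

lemma preserves_cotensors_M: "preserves_cotensors V J X Y M"
  unfolding preserves_cotensors_def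
proof (intro ballI allI impI)
  fix K c p \<gamma> assume c: "is_cotensor V X K c p \<gamma>"
  note [simp] = X vcategory_Y Obj Fo_M cotensor_simps[OF c] iso_M
  have m: "mul Y b p c (Fh M p c \<cdot> \<gamma>) h = Fh M b c \<cdot> mul X b p c \<gamma> (inv_arr V (Fh M b p) \<cdot> h)"
    if [simp]: "b \<in> Obj X" "Cod V h = Hom Y b p" for b h
    using vfunctor_mul[OF M X vcategory_Y, of b p c \<gamma> "inv_arr V (Fh M b p) \<cdot> h"] by simp
  show "is_cotensor V Y K (Fo M c) (Fo M p) (Fh M p c \<cdot> \<gamma>)"
    unfolding is_cotensor_iff[OF vcategory_Y]
  proof (intro conjI ballI allI impI)
    fix b Z k assume "b \<in> Obj Y" and k: "Dom V k = K \<otimes> Z \<and> Cod V k = Hom Y b (Fo M c)"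
    then have b [simp]: "b \<in> Obj X" by simp
    obtain h where h: "Dom V h = Z" "Cod V h = Hom X b p" "mul X b p c \<gamma> h = inv_arr V (Fh M b c) \<cdot> k"
      using cotensor_ex[OF X c b, of "inv_arr V (Fh M b c) \<cdot> k" Z] k by auto
    show "\<exists>!h. Dom V h = Z \<and> Cod V h = Hom Y b (Fo M p) \<and>
        mul Y b (Fo M p) (Fo M c) (Fh M p c \<cdot> \<gamma>) h = k"
    proof (intro ex1I[of _ "Fh M b p \<cdot> h"] conjI)
      fix h' assume h': "Dom V h' = Z \<and> Cod V h' = Hom Y b (Fo M p) \<and>
          mul Y b (Fo M p) (Fo M c) (Fh M p c \<cdot> \<gamma>) h' = k"
      then have "k = Fh M b c \<cdot> mul X b p c \<gamma> (inv_arr V (Fh M b p) \<cdot> h')"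
        using m[of b h'] by simp
      then have "mul X b p c \<gamma> (inv_arr V (Fh M b p) \<cdot> h') = mul X b p c \<gamma> h"
        using h h' by simp
      then have "inv_arr V (Fh M b p) \<cdot> h' = h"
        using h h' by - (rule cotensor_cancel[OF X c b], simp_all)
      then show "h' = Fh M b p \<cdot> h"
        using h' by auto
    qed (use h k in \<open>simp_all add: m\<close>)
  qed simp_all
qed

end

context symmetric_monoidal_closed
begin

section \<open>Theories\<close>

text \<open>The canonical isomorphism from \<open>K\<close> to \<open>[\<I>, K]\<close>. As
  \<open>[\<I>, K]\<close> is the hom-object from \<open>K\<close> to \<open>\<I>\<close> in the
  opposite of the arities, it is the counit that makes \<open>K\<close> the cotensor
  \<open>[K, \<I>]\<close> there.\<close>

definition unit_curry :: "'o \<Rightarrow> 'm" where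
  "unit_curry K = curry_arr V K \<I> K (Run V K)"

lemma unit_curry_simps [simp]:
  "Dom V (unit_curry K) = K" "Cod V (unit_curry K) = Ihom V \<I> K"
  "Ev V \<I> K \<cdot> (unit_curry K \<odot> \<one> \<I>) = Run V K"
  using curry_arr_props[of "Run V K" K \<I> K] by (simp_all add: unit_curry_def)

lemma unit_curry_Ev: "unit_curry K \<cdot> Ev V \<I> K \<cdot> inv_arr V (Run V (Ihom V \<I> K)) = \<one> (Ihom V \<I> K)"
proof (rule ev_cancel)
  let ?e = "Ev V \<I> K \<cdot> inv_arr V (Run V (Ihom V \<I> K))"
  have "Ev V \<I> K \<cdot> ((unit_curry K \<cdot> ?e) \<odot> \<one> \<I>)
      = (Ev V \<I> K \<cdot> (unit_curry K \<odot> \<one> \<I>)) \<cdot> (?e \<odot> \<one> \<I>)"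
    by (simp del: unit_curry_simps(3))
  also have "\<dots> = ?e \<cdot> Run V (Ihom V \<I> K)"
    using run_nat'[of ?e] by (simp only: unit_curry_simps) simp
  finally show "Ev V \<I> K \<cdot> ((unit_curry K \<cdot> Ev V \<I> K \<cdot> inv_arr V (Run V (Ihom V \<I> K))) \<odot> \<one> \<I>)
      = Ev V \<I> K \<cdot> (\<one> (Ihom V \<I> K) \<odot> \<one> \<I>)" by simp
qed simp_all

lemma Ev_unit_curry: "Ev V \<I> K \<cdot> inv_arr V (Run V (Ihom V \<I> K)) \<cdot> unit_curry K = \<one> K"
proof -
  have "Ev V \<I> K \<cdot> inv_arr V (Run V (Ihom V \<I> K)) \<cdot> unit_curry K
      = (Ev V \<I> K \<cdot> (unit_curry K \<odot> \<one> \<I>)) \<cdot> inv_arr V (Run V K)"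
    using inv_run_nat[of "unit_curry K"] by (simp del: unit_curry_simps(3))
  then show ?thesis by simp
qed

lemma iso_unit_curry: "iso V (unit_curry K)"
  by (rule isoI[of "Ev V \<I> K \<cdot> inv_arr V (Run V (Ihom V \<I> K))"]) (simp_all add: unit_curry_Ev Ev_unit_curry)

text \<open>The curried arrow is \<open>[X, u]\<close>, and functoriality of the internal hom sends
  inverses to inverses.\<close>

lemma iso_curry_comp_Ev:
  assumes "iso V u" "Dom V u = Y" "Cod V u = Z"
  shows "iso V (curry_arr V (Ihom V X Y) X Z (u \<cdot> Ev V X Y))"
proof -
  have inv: "curry_arr V (Ihom V X Z) X Y (v \<cdot> Ev V X Z) \<cdot> curry_arr V (Ihom V X Y) X Z (u \<cdot> Ev V X Y) = \<one> (Ihom V X Y)"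
    if [simp]: "Dom V u = Y" "Cod V u = Z" "Dom V v = Z" "Cod V v = Y" and vu: "v \<cdot> u = \<one> Y" for u v Y Z
  proof (rule ev_cancel)
    let ?u = "curry_arr V (Ihom V X Y) X Z (u \<cdot> Ev V X Y)" and ?v = "curry_arr V (Ihom V X Z) X Y (v \<cdot> Ev V X Z)"
    have u: "Ev V X Z \<cdot> (?u \<odot> \<one> X) = u \<cdot> Ev V X Y" and v: "Ev V X Y \<cdot> (?v \<odot> \<one> X) = v \<cdot> Ev V X Z"
      by (rule curry_arr_props; simp)+
    have "Ev V X Y \<cdot> ((?v \<cdot> ?u) \<odot> \<one> X) = (Ev V X Y \<cdot> (?v \<odot> \<one> X)) \<cdot> (?u \<odot> \<one> X)"
      by simp
    also have "\<dots> = v \<cdot> (Ev V X Z \<cdot> (?u \<odot> \<one> X))"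
      by (simp only: v) simp
    also have "\<dots> = (v \<cdot> u) \<cdot> Ev V X Y"
      by (simp only: u) simp
    also have "\<dots> = Ev V X Y"
      by (simp only: vu) simp
    finally show "Ev V X Y \<cdot> ((?v \<cdot> ?u) \<odot> \<one> X) = Ev V X Y \<cdot> (\<one> (Ihom V X Y) \<odot> \<one> X)"
      by simp
  qed simp_all
  show ?thesis
    by (rule isoI[of "curry_arr V (Ihom V X Z) X Y (inv_arr V u \<cdot> Ev V X Z)"])
      (use assms inv[of u Y Z "inv_arr V u"] inv[of "inv_arr V u" Z Y u] in simp_all)
qed

lemma arities_op_simps [simp]:
  "Obj (arities_op V J) = J" "Hom (arities_op V J) X Y = Ihom V Y X"
  "Jd (arities_op V J) X = curry_arr V \<I> X X (Lun V X)"
  by (simp_all add: arities_op_def opposite_def self_enriched_def)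

lemma Mu_arities_op_simps [simp]:
  "Dom V (Mu (arities_op V J) X Y Z) = Ihom V Z Y \<otimes> Ihom V Y X"
  "Cod V (Mu (arities_op V J) X Y Z) = Ihom V Z X"
  by (simp_all add: arities_op_def opposite_def self_enriched_def)

text \<open>The left side is the arrow whose transpose has to be invertible for
  \<open>unit_curry\<close> to be a cotensor counit. It is evaluation followed by an isomorphism, so
  \<open>iso_curry_comp_Ev\<close> applies.\<close>

lemma Mu_arities_op_unit_curry:
  "Mu (arities_op V J) X Y \<I> \<cdot> (unit_curry Y \<odot> \<one> (Ihom V Y X)) \<cdot> Sym V (Ihom V Y X) Y = unit_curry X \<cdot> Ev V Y X"
proof -
  let ?f = "Ev V Y X \<cdot> (\<one> (Ihom V Y X) \<odot> Ev V \<I> Y) \<cdot> Asc V (Ihom V Y X) (Ihom V \<I> Y) \<I>"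
  let ?mu = "curry_arr V (Ihom V Y X \<otimes> Ihom V \<I> Y) \<I> X ?f"
  have mu: "Ev V \<I> X \<cdot> (?mu \<odot> \<one> \<I>) = ?f"
    by (rule curry_arr_props) simp_all
  have "Mu (arities_op V J) X Y \<I> \<cdot> (unit_curry Y \<odot> \<one> (Ihom V Y X)) \<cdot> Sym V (Ihom V Y X) Y
      = ?mu \<cdot> (\<one> (Ihom V Y X) \<odot> unit_curry Y) \<cdot> Sym V Y (Ihom V Y X) \<cdot> Sym V (Ihom V Y X) Y"
    using sym_nat'[of "unit_curry Y" "\<one> (Ihom V Y X)"]
    by (simp add: arities_op_def opposite_def self_enriched_def comp_reassoc2[of "Sym V (Ihom V \<I> Y) (Ihom V Y X)"])
  also have "\<dots> = ?mu \<cdot> (\<one> (Ihom V Y X) \<odot> unit_curry Y)" by simp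
  also have "\<dots> = unit_curry X \<cdot> Ev V Y X"
  proof (rule ev_cancel)
    have "Ev V \<I> X \<cdot> ((?mu \<cdot> (\<one> (Ihom V Y X) \<odot> unit_curry Y)) \<odot> \<one> \<I>)
        = (Ev V \<I> X \<cdot> (?mu \<odot> \<one> \<I>)) \<cdot> ((\<one> (Ihom V Y X) \<odot> unit_curry Y) \<odot> \<one> \<I>)"
      by simp
    also have "\<dots> = Ev V Y X \<cdot> (\<one> (Ihom V Y X) \<odot> Ev V \<I> Y)
        \<cdot> (\<one> (Ihom V Y X) \<odot> (unit_curry Y \<odot> \<one> \<I>)) \<cdot> Asc V (Ihom V Y X) Y \<I>"
      using asc_nat'[of "\<one> (Ihom V Y X)" "unit_curry Y" "\<one> \<I>"]
      by (simp only: mu) (simp del: unit_curry_simps(3))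
    also have "\<dots> = Ev V Y X \<cdot> Run V (Ihom V Y X \<otimes> Y)"
      by (simp add: run_asc)
    also have "\<dots> = Run V X \<cdot> (Ev V Y X \<odot> \<one> \<I>)"
      using run_nat'[of "Ev V Y X"] by simp
    also have "\<dots> = (Ev V \<I> X \<cdot> (unit_curry X \<odot> \<one> \<I>)) \<cdot> (Ev V Y X \<odot> \<one> \<I>)"
      by simp
    finally show "Ev V \<I> X \<cdot> ((?mu \<cdot> (\<one> (Ihom V Y X) \<odot> unit_curry Y)) \<odot> \<one> \<I>)
        = Ev V \<I> X \<cdot> ((unit_curry X \<cdot> Ev V Y X) \<odot> \<one> \<I>)"
      by (simp del: unit_curry_simps(3))
  qed simp_all
  finally show ?thesis .
qed

lemma is_cotensor_arities_op:
  assumes "K \<in> J" "\<I> \<in> J"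
  shows "is_cotensor V (arities_op V J) K \<I> K (unit_curry K)"
  unfolding is_cotensor_def using assms
  by (simp add: in_hom_iff Mu_arities_op_unit_curry iso_curry_comp_Ev iso_unit_curry)

text \<open>The structure morphism \<open>K \<rightarrow> T(K, \<I>)\<close> through which every
  object of a theory is a cotensor of \<open>\<I>\<close>.\<close>

definition counit :: "('o, 'm, 'z) jtheory_scheme \<Rightarrow> 'o \<Rightarrow> 'm" where
  "counit T K = Fh (Str T) K \<I> \<cdot> unit_curry K"

lemma is_theory_simps:
  assumes "is_theory V J T"
  shows "vcategory V T" "Obj T = J" "vfunctor V (arities_op V J) T (Str T)"
    "K \<in> J \<Longrightarrow> Fo (Str T) K = K"
  using assms by (auto simp: is_theory_def)

lemma Str_simps:
  assumes "is_theory V J T" "K \<in> J" "L \<in> J"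
  shows "Dom V (Fh (Str T) K L) = Ihom V L K" "Cod V (Fh (Str T) K L) = Hom T K L"
  using vfunctor_simps[OF is_theory_simps(3)[OF assms(1)]] is_theory_simps(4)[OF assms(1)] assms by simp_all

lemma is_cotensor_counit:
  assumes "is_theory V J T" "K \<in> J" "\<I> \<in> J"
  shows "is_cotensor V T K \<I> K (counit T K)"
proof -
  have "is_cotensor V T K (Fo (Str T) \<I>) (Fo (Str T) K) (Fh (Str T) K \<I> \<cdot> unit_curry K)"
    using assms is_cotensor_arities_op[of K J] unfolding is_theory_def preserves_cotensors_def by blast
  then show ?thesis
    using assms by (simp add: counit_def is_theory_simps)
qed

text \<open>The identity element of \<open>\<I>\<close> in the arities is curried from
  \<open>Lun\<close>, the counit from \<open>Run\<close>; these agree on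
  \<open>\<I>\<close>.\<close>

lemma counit_unit:
  assumes "is_theory V J T" "\<I> \<in> J"
  shows "counit T \<I> = Jd T \<I>"
  using vfunctor_Jd[OF is_theory_simps(3)[OF assms(1)], of \<I>] is_theory_simps(4)[OF assms(1)] assms
  by (simp add: counit_def unit_curry_def lun_unit_eq_run_unit)

text \<open>The counits determine the structure functor: this is the equation by which
  \<open>commutant_theory\<close> defines its \<open>Str\<close>.\<close>

lemma mul_counit_Str:
  assumes T: "is_theory V J T" and J: "X \<in> J" "Y \<in> J" "\<I> \<in> J"
  shows "mul T X Y \<I> (counit T Y) (Fh (Str T) X Y) \<cdot> Sym V (Ihom V Y X) Y = counit T X \<cdot> Ev V Y X"
proof -
  note [simp] = is_theory_simps[OF T] Str_simps[OF T] J
  have "mul T X Y \<I> (counit T Y) (Fh (Str T) X Y) \<cdot> Sym V (Ihom V Y X) Y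
      = mul T X Y \<I> (Fh (Str T) Y \<I>) (Fh (Str T) X Y) \<cdot> (unit_curry Y \<odot> \<one> (Ihom V Y X)) \<cdot> Sym V (Ihom V Y X) Y"
    by (simp add: counit_def)
  also have "mul T X Y \<I> (Fh (Str T) Y \<I>) (Fh (Str T) X Y) = Fh (Str T) X \<I> \<cdot> Mu (arities_op V J) X Y \<I>"
    using vfunctor_Mu[OF is_theory_simps(3)[OF T], of X Y \<I>] by simp
  finally show ?thesis
    by (simp add: Mu_arities_op_unit_curry counit_def)
qed

section \<open>Hom-objects of categories of algebras\<close>

lemma vnat_family_Jd:
  assumes X: "vcategory V X" and Y: "vcategory V Y" and F: "vfunctor V X Y F"
  shows "vnat_family V X Y F F \<I> (\<lambda>a. Jd Y (Fo F a))"
  unfolding vnat_family_iff[OF X Y F F]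
proof (intro conjI ballI)
  note [simp] = X Y vfunctor_simps[OF F]
  fix a b assume "a \<in> Obj X" "b \<in> Obj X"
  then show "mul Y (Fo F a) (Fo F b) (Fo F b) (Jd Y (Fo F b)) (Fh F a b) \<cdot> Sym V (Hom X a b) \<I>
      = mul Y (Fo F a) (Fo F a) (Fo F b) (Fh F a b) (Jd Y (Fo F a))"
    by (simp add: mul_Jd lun_sym)
qed (simp_all add: Y vfunctor_simps[OF F])

text \<open>\<open>X\<close> moves past \<open>Y \<otimes> Z\<close> in one step and returns past
  \<open>Z\<close> and then \<open>Y\<close>. This is the chain of symmetries left over when two
  natural families are composed.\<close>

lemma hexagon_cancel:
  "Asc V X Y Z \<cdot> (Sym V Y X \<odot> \<one> Z) \<cdot> inv_arr V (Asc V Y X Z) \<cdot> (\<one> Y \<odot> Sym V Z X) \<cdot> Asc V Y Z X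
    \<cdot> Sym V X (Y \<otimes> Z) = \<one> (X \<otimes> (Y \<otimes> Z))"
proof (rule iso_cancel_right[where m = "Asc V X Y Z"])
  have "(\<one> Y \<odot> Sym V Z X) \<cdot> Asc V Y Z X \<cdot> Sym V X (Y \<otimes> Z) \<cdot> Asc V X Y Z
      = Asc V Y X Z \<cdot> (Sym V X Y \<odot> \<one> Z)"
    by (simp add: hexagon)
  then show "(Asc V X Y Z \<cdot> (Sym V Y X \<odot> \<one> Z) \<cdot> inv_arr V (Asc V Y X Z) \<cdot> (\<one> Y \<odot> Sym V Z X) \<cdot> Asc V Y Z X
    \<cdot> Sym V X (Y \<otimes> Z)) \<cdot> Asc V X Y Z = \<one> (X \<otimes> (Y \<otimes> Z)) \<cdot> Asc V X Y Z"
    by simp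
qed simp_all

text \<open>The functor arrow moves past \<open>\<alpha>\<close> and then past
  \<open>\<beta>\<close>, turning from \<open>F\<close> to \<open>G\<close> to \<open>H\<close>.
  Each move leaves a symmetry, and \<open>hexagon_cancel\<close> removes them together.\<close>

lemma vnat_family_mul:
  assumes X: "vcategory V X" and Y: "vcategory V Y"
    and F: "vfunctor V X Y F" and G: "vfunctor V X Y G" and H: "vfunctor V X Y H"
    and \<alpha>: "vnat_family V X Y F G Z \<alpha>" and \<beta>: "vnat_family V X Y G H W \<beta>"
  shows "vnat_family V X Y F H (W \<otimes> Z) (\<lambda>a. mul Y (Fo F a) (Fo G a) (Fo H a) (\<beta> a) (\<alpha> a))"
proof -
  note [simp] = X Y vfunctor_simps[OF F] vfunctor_simps[OF G] vfunctor_simps[OF H]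
  have [simp]: "Dom V (\<alpha> a) = Z" "Cod V (\<alpha> a) = Hom Y (Fo F a) (Fo G a)"
    "Dom V (\<beta> a) = W" "Cod V (\<beta> a) = Hom Y (Fo G a) (Fo H a)" if "a \<in> Obj X" for a
    using that \<alpha> \<beta> unfolding vnat_family_iff[OF X Y F G] vnat_family_iff[OF X Y G H] by auto
  have n\<alpha>: "mul Y (Fo F a) (Fo F b) (Fo G b) (\<alpha> b) (Fh F a b)
      = mul Y (Fo F a) (Fo G a) (Fo G b) (Fh G a b) (\<alpha> a) \<cdot> Sym V Z (Hom X a b)"
    and n\<beta>: "mul Y (Fo G a) (Fo G b) (Fo H b) (\<beta> b) (Fh G a b)
      = mul Y (Fo G a) (Fo H a) (Fo H b) (Fh H a b) (\<beta> a) \<cdot> Sym V W (Hom X a b)"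
    if "a \<in> Obj X" "b \<in> Obj X" for a b
  proof -
    have "mul Y (Fo F a) (Fo F b) (Fo G b) (\<alpha> b) (Fh F a b) \<cdot> Sym V (Hom X a b) Z
        = mul Y (Fo F a) (Fo G a) (Fo G b) (Fh G a b) (\<alpha> a)"
      "mul Y (Fo G a) (Fo G b) (Fo H b) (\<beta> b) (Fh G a b) \<cdot> Sym V (Hom X a b) W
        = mul Y (Fo G a) (Fo H a) (Fo H b) (Fh H a b) (\<beta> a)"
      using that \<alpha> \<beta> unfolding vnat_family_iff[OF X Y F G] vnat_family_iff[OF X Y G H] by auto
    from this[THEN comp_inv_right] show
      "mul Y (Fo F a) (Fo F b) (Fo G b) (\<alpha> b) (Fh F a b)
        = mul Y (Fo F a) (Fo G a) (Fo G b) (Fh G a b) (\<alpha> a) \<cdot> Sym V Z (Hom X a b)"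
      "mul Y (Fo G a) (Fo G b) (Fo H b) (\<beta> b) (Fh G a b)
        = mul Y (Fo G a) (Fo H a) (Fo H b) (Fh H a b) (\<beta> a) \<cdot> Sym V W (Hom X a b)"
      using that by simp_all
  qed
  show ?thesis
    unfolding vnat_family_iff[OF X Y F H]
  proof (intro conjI ballI)
    fix a b assume [simp]: "a \<in> Obj X" "b \<in> Obj X"
    let ?A = "Hom X a b" and ?Fa = "Fo F a" and ?Ga = "Fo G a" and ?Ha = "Fo H a" and ?Hb = "Fo H b"
    have "mul Y ?Fa (Fo F b) ?Hb (mul Y (Fo F b) (Fo G b) ?Hb (\<beta> b) (\<alpha> b)) (Fh F a b)
        = mul Y ?Fa (Fo G b) ?Hb (\<beta> b) (mul Y ?Fa (Fo F b) (Fo G b) (\<alpha> b) (Fh F a b)) \<cdot> Asc V W Z ?A"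
      by (subst mul_assoc) simp_all
    also have "\<dots> = mul Y ?Fa (Fo G b) ?Hb (\<beta> b) (mul Y ?Fa ?Ga (Fo G b) (Fh G a b) (\<alpha> a))
        \<cdot> (\<one> W \<odot> Sym V Z ?A) \<cdot> Asc V W Z ?A"
      by (simp add: n\<alpha>)
    also have "\<dots> = mul Y ?Fa ?Ga ?Hb (mul Y ?Ga (Fo G b) ?Hb (\<beta> b) (Fh G a b)) (\<alpha> a)
        \<cdot> inv_arr V (Asc V W ?A Z) \<cdot> (\<one> W \<odot> Sym V Z ?A) \<cdot> Asc V W Z ?A"
      by (subst mul_assoc_inv) simp_all
    also have "\<dots> = mul Y ?Fa ?Ga ?Hb (mul Y ?Ga ?Ha ?Hb (Fh H a b) (\<beta> a)) (\<alpha> a)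
        \<cdot> (Sym V W ?A \<odot> \<one> Z) \<cdot> inv_arr V (Asc V W ?A Z) \<cdot> (\<one> W \<odot> Sym V Z ?A) \<cdot> Asc V W Z ?A"
      by (simp add: n\<beta>)
    also have "\<dots> = mul Y ?Fa ?Ha ?Hb (Fh H a b) (mul Y ?Fa ?Ga ?Ha (\<beta> a) (\<alpha> a)) \<cdot> Asc V ?A W Z
        \<cdot> (Sym V W ?A \<odot> \<one> Z) \<cdot> inv_arr V (Asc V W ?A Z) \<cdot> (\<one> W \<odot> Sym V Z ?A) \<cdot> Asc V W Z ?A"
      by (subst mul_assoc) simp_all
    finally have "mul Y ?Fa (Fo F b) ?Hb (mul Y (Fo F b) (Fo G b) ?Hb (\<beta> b) (\<alpha> b)) (Fh F a b) \<cdot> Sym V ?A (W \<otimes> Z)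
      = mul Y ?Fa ?Ha ?Hb (Fh H a b) (mul Y ?Fa ?Ga ?Ha (\<beta> a) (\<alpha> a)) \<cdot> (Asc V ?A W Z
        \<cdot> (Sym V W ?A \<odot> \<one> Z) \<cdot> inv_arr V (Asc V W ?A Z) \<cdot> (\<one> W \<odot> Sym V Z ?A) \<cdot> Asc V W Z ?A
        \<cdot> Sym V ?A (W \<otimes> Z))"
      by simp
    then show "mul Y ?Fa (Fo F b) ?Hb (mul Y (Fo F b) (Fo G b) ?Hb (\<beta> b) (\<alpha> b)) (Fh F a b) \<cdot> Sym V ?A (W \<otimes> Z)
      = mul Y ?Fa ?Ha ?Hb (Fh H a b) (mul Y ?Fa ?Ga ?Ha (\<beta> a) (\<alpha> a))"
      by (simp only: hexagon_cancel) simp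
  qed simp_all
qed

lemma end_arr_eq:
  assumes "end_exists X Y F G" "Dom V h = Z" "Cod V h = EndOb V X Y F G"
    "\<And>a. a \<in> Obj X \<Longrightarrow> EndPr V X Y F G a \<cdot> h = \<alpha> a"
  shows "end_arr V X Y F G Z \<alpha> = h"
  unfolding end_arr_def
  by (rule the_equality) (use assms EndPr_cancel[OF assms(1)] in \<open>auto simp: in_hom_iff\<close>)

lemma is_end_comparison:
  assumes 1: "is_end V X Y F G E \<pi>" and 2: "is_end V X Y F G E' \<pi>'"
    and XY: "vcategory V X" "vcategory V Y" "vfunctor V X Y F" "vfunctor V X Y G"
  obtains k where "iso V k" "Dom V k = E" "Cod V k = E'" "\<And>a. a \<in> Obj X \<Longrightarrow> \<pi>' a \<cdot> k = \<pi> a"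
proof -
  have nat: "vnat_family V X Y F G E \<pi>" "vnat_family V X Y F G E' \<pi>'" using 1 2 by (auto simp: is_end_def)
  then have [simp]: "Dom V (\<pi> a) = E" "Dom V (\<pi>' a) = E'" if "a \<in> Obj X" for a
    using that by (auto simp: vnat_family_def in_hom_iff)
  obtain k where k: "Dom V k = E" "Cod V k = E'" "\<And>a. a \<in> Obj X \<Longrightarrow> \<pi>' a \<cdot> k = \<pi> a"
    using 2 nat(1) unfolding is_end_def in_hom_iff by blast
  obtain l where l: "Dom V l = E'" "Cod V l = E" "\<And>a. a \<in> Obj X \<Longrightarrow> \<pi> a \<cdot> l = \<pi>' a"
    using 1 nat(2) unfolding is_end_def in_hom_iff by blast
  have "l \<cdot> k = \<one> E"
    by (rule is_end_cancel[OF 1 _ _ _ XY]) (use k l in \<open>simp_all add: comp_reassoc[OF l(3)]\<close>)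
  moreover have "k \<cdot> l = \<one> E'"
    by (rule is_end_cancel[OF 2 _ _ _ XY]) (use k l in \<open>simp_all add: comp_reassoc[OF k(3)]\<close>)
  ultimately have "iso V k" by (intro isoI) (use k l in simp_all)
  then show thesis using that k by blast
qed

lemma Alg_simps [simp]:
  "Obj (Alg V J T C) = {A. is_algebra V J T C A}" "Hom (Alg V J T C) = EndOb V T C"
  by (simp_all add: Alg_def functor_vcat_def)

lemma Alg_Jd:
  assumes "end_exists T C F F"
  shows "Dom V (Jd (Alg V J T C) F) = \<I>" "Cod V (Jd (Alg V J T C) F) = EndOb V T C F F"
    "a \<in> Obj T \<Longrightarrow> EndPr V T C F F a \<cdot> Jd (Alg V J T C) F = Jd C (Fo F a)"
  using end_arr_props[OF assms vnat_family_Jd] assms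
  by (simp_all add: Alg_def functor_vcat_def end_exists_def)

lemma Alg_Mu:
  assumes "end_exists T C F G" "end_exists T C G H" "end_exists T C F H"
  shows "Dom V (Mu (Alg V J T C) F G H) = EndOb V T C G H \<otimes> EndOb V T C F G"
    "Cod V (Mu (Alg V J T C) F G H) = EndOb V T C F H"
    "a \<in> Obj T \<Longrightarrow> EndPr V T C F H a \<cdot> Mu (Alg V J T C) F G H
       = mul C (Fo F a) (Fo G a) (Fo H a) (EndPr V T C G H a) (EndPr V T C F G a)"
  using end_arr_props[OF assms(3) vnat_family_mul[OF _ _ _ _ _ EndPr_vnat[OF assms(1)] EndPr_vnat[OF assms(2)]]] assms
  by (simp_all add: Alg_def functor_vcat_def end_exists_def mul_def)

lemma cotensor_map_props:
  assumes C: "vcategory V C" and cot: "has_cotensors V J C" and K: "K \<in> J" and cd: "c \<in> Obj C" "d \<in> Obj C"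
  shows "Dom V (cotensor_map V C K c d) = Hom C c d"
    "Cod V (cotensor_map V C K c d) = Hom C (Cot C K c) (Cot C K d)"
    "mul C (Cot C K c) (Cot C K d) d (Cun C K d) (cotensor_map V C K c d) \<cdot> Sym V (Hom C c d) K
      = mul C (Cot C K c) c d (\<one> (Hom C c d)) (Cun C K c)"
proof -
  have c: "is_cotensor V C K c (Cot C K c) (Cun C K c)" and d: "is_cotensor V C K d (Cot C K d) (Cun C K d)"
    using cot K cd by (auto simp: has_cotensors_def)
  note [simp] = C cd cotensor_simps[OF c] cotensor_simps[OF d]
  let ?k = "mul C (Cot C K c) c d (\<one> (Hom C c d)) (Cun C K c)"
  obtain m where m: "Dom V m = Hom C c d" "Cod V m = Hom C (Cot C K c) (Cot C K d)"
      "mul C (Cot C K c) (Cot C K d) d (Cun C K d) m = ?k \<cdot> Sym V K (Hom C c d)"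
    using cotensor_ex[OF C d, of "Cot C K c" "?k \<cdot> Sym V K (Hom C c d)" "Hom C c d"] by auto
  have "cotensor_map V C K c d = m"
    unfolding cotensor_map_def mul_def[symmetric]
    by (rule cotensor_arr_eq[OF C d]) (use m in simp_all)
  then show "Dom V (cotensor_map V C K c d) = Hom C c d"
    "Cod V (cotensor_map V C K c d) = Hom C (Cot C K c) (Cot C K d)"
    "mul C (Cot C K c) (Cot C K d) d (Cun C K d) (cotensor_map V C K c d) \<cdot> Sym V (Hom C c d) K = ?k"
    using m by simp_all
qed

lemma algebra_end_exists:
  assumes "is_theory V J T" "admissible V J C" "is_algebra V J T C F" "is_algebra V J T C G"
  shows "end_exists T C F G"
  using assms by (auto simp: end_exists_def admissible_def is_theory_def is_algebra_def)

text \<open>Every object of a theory is a cotensor of the unit, so evaluation at the unit is faithful on algebras.\<close>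

lemma EndPr_unit_cancel:
  assumes T: "is_theory V J T" and I: "\<I> \<in> J" and C: "admissible V J C"
    and F: "is_algebra V J T C F" and G: "is_algebra V J T C G"
    and h: "Dom V h = Dom V h'" "Cod V h = EndOb V T C F G" "Cod V h' = EndOb V T C F G"
    and eq: "EndPr V T C F G \<I> \<cdot> h = EndPr V T C F G \<I> \<cdot> h'"
  shows "h = h'"
proof -
  have C': "vcategory V C" using C by (simp add: admissible_def)
  have F': "vfunctor V T C F" and G': "vfunctor V T C G" using F G by (auto simp: is_algebra_def)
  note E = algebra_end_exists[OF T C F G]
  note [simp] = C' is_theory_simps[OF T] vfunctor_simps[OF F'] vfunctor_simps[OF G'] EndPr_simps[OF E] I
  show ?thesis
  proof (rule EndPr_cancel[OF E h])
    fix K assume "K \<in> Obj T"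
    then have K [simp]: "K \<in> J" by simp
    note c = is_cotensor_counit[OF T K I]
    then have Gc: "is_cotensor V C K (Fo G \<I>) (Fo G K) (Fh G K \<I> \<cdot> counit T K)"
      using G K by (simp add: is_algebra_def preserves_cotensors_def)
    note [simp] = cotensor_simps[OF c]
    \<comment> \<open>Naturality along the counit of \<open>K\<close> expresses the component at
      \<open>K\<close>, composed with a cotensor counit in \<open>C\<close>, through the component
      at \<open>\<I>\<close>.\<close>
    have *: "mul C (Fo F K) (Fo G K) (Fo G \<I>) (Fh G K \<I> \<cdot> counit T K) (EndPr V T C F G K \<cdot> h)
       = mul C (Fo F K) (Fo F \<I>) (Fo G \<I>) (EndPr V T C F G \<I> \<cdot> h) (Fh F K \<I> \<cdot> counit T K) \<cdot> Sym V K (Dom V h)"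
      if [simp]: "Cod V h = EndOb V T C F G" for h
    proof -
      have "mul C (Fo F K) (Fo G K) (Fo G \<I>) (Fh G K \<I> \<cdot> counit T K) (EndPr V T C F G K \<cdot> h)
        = mul C (Fo F K) (Fo G K) (Fo G \<I>) (Fh G K \<I>) (EndPr V T C F G K) \<cdot> (counit T K \<odot> h)"
        by simp
      also have "mul C (Fo F K) (Fo G K) (Fo G \<I>) (Fh G K \<I>) (EndPr V T C F G K)
         = mul C (Fo F K) (Fo F \<I>) (Fo G \<I>) (EndPr V T C F G \<I>) (Fh F K \<I>) \<cdot> Sym V (Hom T K \<I>) (EndOb V T C F G)"
        using EndPr_vnat[OF E] by (simp add: vnat_family_iff[OF _ _ F' G'])
      finally show ?thesis
        using sym_nat'[of "counit T K" h] by simp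
    qed
    show "EndPr V T C F G K \<cdot> h = EndPr V T C F G K \<cdot> h'"
      by (rule cotensor_cancel[OF C' Gc, of "Fo F K"]) (use h eq in \<open>simp_all add: *\<close>)
  qed
qed

end

section \<open>Commuting families of algebras\<close>

text \<open>The partial functors \<open>L X = D(X, -)\<close> and \<open>R Y = D(-, Y)\<close> of a bifold algebra determine it.
  Working with them directly makes the situation symmetric in the two theories.\<close>

locale commuting_algebras = symmetric_monoidal_closed V
  for V :: "('o, 'm) smc" (structure) +
  fixes J :: "'o set" and C :: "('c, 'o, 'm) cvcat" and T U :: "('o, 'm) jtheory"
    and L R :: "'o \<Rightarrow> ('o, 'c, 'm) vfun"
  assumes arities_J: "system_of_arities V J" and admissible: "admissible V J C"
    and T: "is_theory V J T" and U: "is_theory V J U"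
    and L: "X \<in> J \<Longrightarrow> is_algebra V J U C (L X)" and R: "Y \<in> J \<Longrightarrow> is_algebra V J T C (R Y)"
    and Fo_L: "\<lbrakk>X \<in> J; Y \<in> J\<rbrakk> \<Longrightarrow> Fo (L X) Y = Fo (R Y) X"
    and commute: "\<lbrakk>X \<in> J; X' \<in> J; Y \<in> J; Y' \<in> J\<rbrakk> \<Longrightarrow>
      mul C (Fo (R Y) X) (Fo (R Y) X') (Fo (R Y') X') (Fh (L X') Y Y') (Fh (R Y) X X')
        \<cdot> Sym V (Hom T X X') (Hom U Y Y')
      = mul C (Fo (R Y) X) (Fo (R Y') X) (Fo (R Y') X') (Fh (R Y') X X') (Fh (L X) Y Y')"
begin

abbreviation (input) A where "A \<equiv> R \<I>"
abbreviation (input) cot where "cot K \<equiv> alg_cot V T C K A"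

lemma unit_J [simp]: "\<I> \<in> J"
  using arities_J by (simp add: system_of_arities_def)

lemma C [simp]: "vcategory V C" and cotensors: "has_cotensors V J C"
  using admissible by (auto simp: admissible_def)

lemma T' [simp]: "vcategory V T" "Obj T = J" and U' [simp]: "vcategory V U" "Obj U = J"
  using is_theory_simps[OF T] is_theory_simps[OF U] by auto

lemma L': "X \<in> J \<Longrightarrow> vfunctor V U C (L X)" and R': "Y \<in> J \<Longrightarrow> vfunctor V T C (R Y)"
  using L R by (auto simp: is_algebra_def)

lemma LR_simps [simp]:
  "\<lbrakk>X \<in> J; Y \<in> J\<rbrakk> \<Longrightarrow> Fo (R Y) X \<in> Obj C"
  "\<lbrakk>X \<in> J; Y \<in> J; Y' \<in> J\<rbrakk> \<Longrightarrow> Dom V (Fh (L X) Y Y') = Hom U Y Y'"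
  "\<lbrakk>X \<in> J; Y \<in> J; Y' \<in> J\<rbrakk> \<Longrightarrow> Cod V (Fh (L X) Y Y') = Hom C (Fo (R Y) X) (Fo (R Y') X)"
  "\<lbrakk>Y \<in> J; X \<in> J; X' \<in> J\<rbrakk> \<Longrightarrow> Dom V (Fh (R Y) X X') = Hom T X X'"
  "\<lbrakk>Y \<in> J; X \<in> J; X' \<in> J\<rbrakk> \<Longrightarrow> Cod V (Fh (R Y) X X') = Hom C (Fo (R Y) X) (Fo (R Y) X')"
  using vfunctor_simps[OF L'] vfunctor_simps[OF R'] Fo_L by simp_all

lemma Cot_simps [simp]:
  assumes "K \<in> J" "c \<in> Obj C"
  shows "Cot C K c \<in> Obj C" "Dom V (Cun C K c) = K" "Cod V (Cun C K c) = Hom C (Cot C K c) c"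
proof -
  have "is_cotensor V C K c (Cot C K c) (Cun C K c)" using cotensors assms by (simp add: has_cotensors_def)
  from cotensor_simps[OF this] show "Cot C K c \<in> Obj C" "Dom V (Cun C K c) = K" "Cod V (Cun C K c) = Hom C (Cot C K c) c"
    by simp_all
qed

lemma Cot_unit [simp]: "c \<in> Obj C \<Longrightarrow> Cot C \<I> c = c" "c \<in> Obj C \<Longrightarrow> Cun C \<I> c = Jd C c"
  using cotensors by (auto simp: has_cotensors_def)

lemma Cot_cotensor: "\<lbrakk>K \<in> J; c \<in> Obj C\<rbrakk> \<Longrightarrow> is_cotensor V C K c (Cot C K c) (Cun C K c)"
  using cotensors by (auto simp: has_cotensors_def)

lemma counit_simps [simp]:
  assumes "K \<in> J"
  shows "Dom V (counit U K) = K" "Cod V (counit U K) = Hom U K \<I>"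
  using cotensor_simps[OF is_cotensor_counit[OF U assms unit_J]] by simp_all

text \<open>The image under \<open>L X\<close> of the theory counit at \<open>Y\<close>. As
  \<open>L X\<close> preserves cotensors, it exhibits \<open>D(X, Y)\<close> as a cotensor of
  \<open>A X\<close> by \<open>Y\<close>.\<close>

definition eta :: "'o \<Rightarrow> 'o \<Rightarrow> 'm" where
  "eta Y X = Fh (L X) Y \<I> \<cdot> counit U Y"

lemma eta_simps [simp]:
  assumes "X \<in> J" "Y \<in> J"
  shows "Dom V (eta Y X) = Y" "Cod V (eta Y X) = Hom C (Fo (R Y) X) (Fo (R \<I>) X)"
  using assms by (simp_all add: eta_def)

lemma eta_cotensor:
  assumes "X \<in> J" "Y \<in> J"
  shows "is_cotensor V C Y (Fo A X) (Fo (R Y) X) (eta Y X)"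
proof -
  have "is_cotensor V C Y (Fo (L X) \<I>) (Fo (L X) Y) (Fh (L X) Y \<I> \<cdot> counit U Y)"
    using L[OF assms(1)] is_cotensor_counit[OF U assms(2) unit_J] assms(2)
    unfolding is_algebra_def preserves_cotensors_def by blast
  then show ?thesis using assms by (simp add: eta_def Fo_L)
qed

text \<open>The choice is harmless: compatibility with the counits determines both components by
  \<open>cotensor_cancel\<close>.\<close>

definition comparison :: "'o \<Rightarrow> 'o \<Rightarrow> 'm \<times> 'm" where
  "comparison Y X = (SOME (\<phi>, \<psi>). inverse_elements C (Fo (R Y) X) (Cot C Y (Fo A X)) \<phi> \<psi> \<and>
     ract C (Fo (R Y) X) (Cot C Y (Fo A X)) (Fo A X) (Cun C Y (Fo A X)) \<phi> = eta Y X \<and>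
     ract C (Cot C Y (Fo A X)) (Fo (R Y) X) (Fo A X) (eta Y X) \<psi> = Cun C Y (Fo A X))"

definition phi :: "'o \<Rightarrow> 'o \<Rightarrow> 'm" where "phi Y X = fst (comparison Y X)"
definition psi :: "'o \<Rightarrow> 'o \<Rightarrow> 'm" where "psi Y X = snd (comparison Y X)"

lemma phi_psi:
  assumes "X \<in> J" "Y \<in> J"
  shows "inverse_elements C (Fo (R Y) X) (Cot C Y (Fo A X)) (phi Y X) (psi Y X)"
    "ract C (Fo (R Y) X) (Cot C Y (Fo A X)) (Fo A X) (Cun C Y (Fo A X)) (phi Y X) = eta Y X"
    "ract C (Cot C Y (Fo A X)) (Fo (R Y) X) (Fo A X) (eta Y X) (psi Y X) = Cun C Y (Fo A X)"
proof -
  have "is_cotensor V C Y (Fo A X) (Cot C Y (Fo A X)) (Cun C Y (Fo A X))"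
    using assms by (intro Cot_cotensor) simp_all
  then obtain \<phi> \<psi> where "inverse_elements C (Fo (R Y) X) (Cot C Y (Fo A X)) \<phi> \<psi>"
     "ract C (Fo (R Y) X) (Cot C Y (Fo A X)) (Fo A X) (Cun C Y (Fo A X)) \<phi> = eta Y X"
     "ract C (Cot C Y (Fo A X)) (Fo (R Y) X) (Fo A X) (eta Y X) \<psi> = Cun C Y (Fo A X)"
    by (rule cotensor_comparison[OF C eta_cotensor[OF assms]])
  then have "\<exists>p. case p of (\<phi>, \<psi>) \<Rightarrow> inverse_elements C (Fo (R Y) X) (Cot C Y (Fo A X)) \<phi> \<psi> \<and>
     ract C (Fo (R Y) X) (Cot C Y (Fo A X)) (Fo A X) (Cun C Y (Fo A X)) \<phi> = eta Y X \<and>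
     ract C (Cot C Y (Fo A X)) (Fo (R Y) X) (Fo A X) (eta Y X) \<psi> = Cun C Y (Fo A X)"
    by (intro exI[of _ "(\<phi>, \<psi>)"]) simp
  from someI_ex[OF this] show
    "inverse_elements C (Fo (R Y) X) (Cot C Y (Fo A X)) (phi Y X) (psi Y X)"
    "ract C (Fo (R Y) X) (Cot C Y (Fo A X)) (Fo A X) (Cun C Y (Fo A X)) (phi Y X) = eta Y X"
    "ract C (Cot C Y (Fo A X)) (Fo (R Y) X) (Fo A X) (eta Y X) (psi Y X) = Cun C Y (Fo A X)"
    by (simp_all add: phi_def psi_def comparison_def split: prod.splits)
qed

lemma phi_psi_simps [simp]:
  assumes "X \<in> J" "Y \<in> J"
  shows "Dom V (phi Y X) = \<I>" "Cod V (phi Y X) = Hom C (Fo (R Y) X) (Cot C Y (Fo A X))"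
    "Dom V (psi Y X) = \<I>" "Cod V (psi Y X) = Hom C (Cot C Y (Fo A X)) (Fo (R Y) X)"
  using inverse_elements_simps[OF phi_psi(1)[OF assms]] by simp_all

text \<open>Both counits are the identity element at \<open>Y = \<I>\<close>, one by functoriality
  of \<open>L X\<close>, the other by the convention on designated cotensors.\<close>

lemma phi_unit [simp]:
  assumes "X \<in> J"
  shows "phi \<I> X = Jd C (Fo A X)" "psi \<I> X = Jd C (Fo A X)"
proof -
  have "eta \<I> X = Jd C (Fo A X)"
    using assms vfunctor_Jd[OF L'[OF assms], of \<I>] by (simp add: eta_def counit_unit[OF U] Fo_L)
  then show phi: "phi \<I> X = Jd C (Fo A X)"
    using phi_psi(2)[OF assms unit_J] assms by (simp add: ract_eq_lact)
  show "psi \<I> X = Jd C (Fo A X)"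
    using inverse_elements_simps(6)[OF phi_psi(1)[OF assms unit_J]] assms by (simp add: phi)
qed

section \<open>Cotensors of the left face\<close>

lemma Fo_cot [simp]: "X \<in> J \<Longrightarrow> Fo (cot K) X = Cot C K (Fo A X)"
  by (simp add: alg_cot_def)

text \<open>This is naturality of \<open>\<phi>\<close> in \<open>X\<close>. An arrow into a
  cotensor is determined by its composite with the counit, and there the claim follows from the law
  defining \<open>cotensor_map\<close> and from naturality of \<open>eta\<close>.\<close>

lemma conjugate_cot:
  assumes Y: "Y \<in> J"
  shows "conjugate T C (R Y) (cot Y) (phi Y) (psi Y)"
proof -
  note [simp] = Y
  have "Fh (cot Y) X X' = conj_el C (Cot C Y (Fo A X)) (Fo (R Y) X) (Fo (R Y) X') (Cot C Y (Fo A X'))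
      (phi Y X') (Fh (R Y) X X') (psi Y X)" (is "_ = ?c")
    if [simp]: "X \<in> J" "X' \<in> J" for X X'
  proof -
    let ?m = "cotensor_map V C Y (Fo A X) (Fo A X')"
    have m [simp]: "Dom V ?m = Hom C (Fo A X) (Fo A X')"
        "Cod V ?m = Hom C (Cot C Y (Fo A X)) (Cot C Y (Fo A X'))"
      "mul C (Cot C Y (Fo A X)) (Cot C Y (Fo A X')) (Fo A X') (Cun C Y (Fo A X')) ?m \<cdot> Sym V (Hom C (Fo A X) (Fo A X')) Y
        = mul C (Cot C Y (Fo A X)) (Fo A X) (Fo A X') (\<one> (Hom C (Fo A X) (Fo A X'))) (Cun C Y (Fo A X))"
      using cotensor_map_props[OF C cotensors Y, of "Fo A X" "Fo A X'"] by simp_all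
    \<comment> \<open>The law \<open>commute\<close> with \<open>Y' = \<I>\<close>, restricted along
      the counit of \<open>Y\<close>: the \<open>eta\<close> are natural in the variable from
      \<open>T\<close>.\<close>
    have eta: "mul C (Fo (R Y) X) (Fo (R Y) X') (Fo A X') (eta Y X') (Fh (R Y) X X') \<cdot> Sym V (Hom T X X') Y
       = mul C (Fo (R Y) X) (Fo A X) (Fo A X') (Fh A X X') (eta Y X)"
    proof -
      have "mul C (Fo (R Y) X) (Fo (R Y) X') (Fo A X') (eta Y X') (Fh (R Y) X X') \<cdot> Sym V (Hom T X X') Y
        = mul C (Fo (R Y) X) (Fo (R Y) X') (Fo A X') (Fh (L X') Y \<I>) (Fh (R Y) X X')
            \<cdot> (counit U Y \<odot> \<one> (Hom T X X')) \<cdot> Sym V (Hom T X X') Y"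
        by (simp add: eta_def)
      also have "\<dots> = (mul C (Fo (R Y) X) (Fo (R Y) X') (Fo A X') (Fh (L X') Y \<I>) (Fh (R Y) X X')
            \<cdot> Sym V (Hom T X X') (Hom U Y \<I>)) \<cdot> (\<one> (Hom T X X') \<odot> counit U Y)"
        using sym_nat'[of "\<one> (Hom T X X')" "counit U Y"] by simp
      also have "\<dots> = mul C (Fo (R Y) X) (Fo A X) (Fo A X') (Fh A X X') (Fh (L X) Y \<I>)
            \<cdot> (\<one> (Hom T X X') \<odot> counit U Y)"
        by (subst commute) simp_all
      finally show ?thesis by (simp add: eta_def)
    qed
    \<comment> \<open>The chain replaces \<open>Cun\<close> by \<open>eta\<close> using
      \<open>psi\<close>, applies naturality of \<open>eta\<close>, and returns to
      \<open>Cun\<close> using \<open>phi\<close>; the two elements picked up on the way form the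
      conjugation in \<open>?c\<close>.\<close>
    have "mul C (Cot C Y (Fo A X)) (Cot C Y (Fo A X')) (Fo A X') (Cun C Y (Fo A X')) (?m \<cdot> Fh A X X')
         \<cdot> Sym V (Hom T X X') Y
      = mul C (Cot C Y (Fo A X)) (Cot C Y (Fo A X')) (Fo A X') (Cun C Y (Fo A X')) ?m
         \<cdot> (\<one> Y \<odot> Fh A X X') \<cdot> Sym V (Hom T X X') Y"
      by simp
    also have "\<dots> = (mul C (Cot C Y (Fo A X)) (Cot C Y (Fo A X')) (Fo A X') (Cun C Y (Fo A X')) ?m
         \<cdot> Sym V (Hom C (Fo A X) (Fo A X')) Y) \<cdot> (Fh A X X' \<odot> \<one> Y)"
      using sym_nat'[of "Fh A X X'" "\<one> Y"] by (simp del: m(3))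
    also have "\<dots> = mul C (Cot C Y (Fo A X)) (Fo A X) (Fo A X') (Fh A X X') (Cun C Y (Fo A X))"
      by (simp only: m) simp
    also have "\<dots> = ract C (Cot C Y (Fo A X)) (Fo (R Y) X) (Fo A X')
         (mul C (Fo (R Y) X) (Fo A X) (Fo A X') (Fh A X X') (eta Y X)) (psi Y X)"
      by (simp flip: mul_ract phi_psi(3))
    also have "\<dots> = ract C (Cot C Y (Fo A X)) (Fo (R Y) X) (Fo A X')
         (mul C (Fo (R Y) X) (Fo (R Y) X') (Fo A X') (eta Y X') (Fh (R Y) X X')) (psi Y X) \<cdot> Sym V (Hom T X X') Y"
      by (simp add: eta)
    also have "mul C (Fo (R Y) X) (Fo (R Y) X') (Fo A X') (eta Y X') (Fh (R Y) X X')
       = mul C (Fo (R Y) X) (Cot C Y (Fo A X')) (Fo A X') (Cun C Y (Fo A X'))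
           (lact C (Fo (R Y) X) (Fo (R Y) X') (Cot C Y (Fo A X')) (phi Y X') (Fh (R Y) X X'))"
      by (simp flip: mul_ract_lact add: phi_psi(2))
    also have "ract C (Cot C Y (Fo A X)) (Fo (R Y) X) (Fo A X') \<dots> (psi Y X)
       = mul C (Cot C Y (Fo A X)) (Cot C Y (Fo A X')) (Fo A X') (Cun C Y (Fo A X')) ?c"
      by (simp add: mul_ract conj_el_def)
    finally have "mul C (Cot C Y (Fo A X)) (Cot C Y (Fo A X')) (Fo A X') (Cun C Y (Fo A X')) (?m \<cdot> Fh A X X')
        \<cdot> Sym V (Hom T X X') Y =
       mul C (Cot C Y (Fo A X)) (Cot C Y (Fo A X')) (Fo A X') (Cun C Y (Fo A X')) ?c \<cdot> Sym V (Hom T X X') Y" .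
    then have "mul C (Cot C Y (Fo A X)) (Cot C Y (Fo A X')) (Fo A X') (Cun C Y (Fo A X')) (?m \<cdot> Fh A X X') =
       mul C (Cot C Y (Fo A X)) (Cot C Y (Fo A X')) (Fo A X') (Cun C Y (Fo A X')) ?c"
      by (rule iso_cancel_right) simp_all
    then have "?m \<cdot> Fh A X X' = ?c"
      by (rule cotensor_cancel[OF C Cot_cotensor[OF Y], rotated 2]) simp_all
    then show ?thesis by (simp add: alg_cot_def)
  qed
  then show ?thesis
    using phi_psi(1) by (simp add: conjugate_def) (simp add: alg_cot_def)
qed

lemma cot_algebra: "Y \<in> J \<Longrightarrow> is_algebra V J T C (cot Y)"
  using conjugate_vfunctor[OF T'(1) C R' conjugate_cot] R
    conjugate_preserves_cotensors[OF T'(1) C R' conjugate_cot]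
  by (auto simp: is_algebra_def)

text \<open>Equality is needed here: the counits of the commutant end in \<open>A\<close>, while its
  theory has \<open>cot \<I>\<close> as the algebra belonging to the object
  \<open>\<I>\<close>.\<close>

lemma cot_unit: "cot \<I> = A"
proof (rule vfunctor_eqI)
  show "vfunctor V T C (cot \<I>)" using cot_algebra by (simp add: is_algebra_def)
  show "vfunctor V T C A" by (simp add: R')
  show "Fh (cot \<I>) X X' = Fh A X X'" if "X \<in> Obj T" "X' \<in> Obj T" for X X'
    using that conjugate_Fh[OF T'(1) C R' conjugate_cot, of \<I> X X'] by (simp add: conj_el_def)
qed simp_all

lemma end_exists_R: "\<lbrakk>X \<in> J; Y \<in> J\<rbrakk> \<Longrightarrow> end_exists T C (R X) (R Y)"
  by (intro algebra_end_exists[OF T admissible] R)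

lemma end_exists_cot: "\<lbrakk>X \<in> J; Y \<in> J\<rbrakk> \<Longrightarrow> end_exists T C (cot X) (cot Y)"
  by (intro algebra_end_exists[OF T admissible] cot_algebra)

lemma EndPr_cot_simps [simp]:
  assumes "X \<in> J" "Y \<in> J" "Z \<in> J"
  shows "Dom V (EndPr V T C (cot X) (cot Y) Z) = EndOb V T C (cot X) (cot Y)"
    "Cod V (EndPr V T C (cot X) (cot Y) Z) = Hom C (Cot C X (Fo A Z)) (Cot C Y (Fo A Z))"
  using EndPr_simps[OF end_exists_cot] assms by simp_all

lemma EndPr_R_simps [simp]:
  assumes "X \<in> J" "Y \<in> J" "Z \<in> J"
  shows "Dom V (EndPr V T C (R X) (R Y) Z) = EndOb V T C (R X) (R Y)"
    "Cod V (EndPr V T C (R X) (R Y) Z) = Hom C (Fo (R X) Z) (Fo (R Y) Z)"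
  using EndPr_simps[OF end_exists_R] assms by simp_all

section \<open>The comparison with the commutant\<close>

abbreviation (input) P where "P \<equiv> commutant_theory V J C (T, A)"

lemma cot_vfunctor: "Y \<in> J \<Longrightarrow> vfunctor V T C (cot Y)"
  using cot_algebra by (simp add: is_algebra_def)

lemma P_simps [simp]:
  "Obj P = J" "Hom P X Y = EndOb V T C (cot X) (cot Y)"
  by (simp_all add: commutant_theory_def)

lemma P_Jd:
  assumes "X \<in> J"
  shows "Dom V (Jd P X) = \<I>" "Cod V (Jd P X) = EndOb V T C (cot X) (cot X)"
    "Z \<in> J \<Longrightarrow> EndPr V T C (cot X) (cot X) Z \<cdot> Jd P X = Jd C (Cot C X (Fo A Z))"
  using Alg_Jd[OF end_exists_cot[OF assms assms], where J = J] by (simp_all add: commutant_theory_def)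

lemma P_Mu:
  assumes "X \<in> J" "Y \<in> J" "W \<in> J"
  shows "Dom V (Mu P X Y W) = EndOb V T C (cot Y) (cot W) \<otimes> EndOb V T C (cot X) (cot Y)"
    "Cod V (Mu P X Y W) = EndOb V T C (cot X) (cot W)"
    "Z \<in> J \<Longrightarrow> EndPr V T C (cot X) (cot W) Z \<cdot> Mu P X Y W =
       mul C (Cot C X (Fo A Z)) (Cot C Y (Fo A Z)) (Cot C W (Fo A Z))
         (EndPr V T C (cot Y) (cot W) Z) (EndPr V T C (cot X) (cot Y) Z)"
  using Alg_Mu[OF end_exists_cot[OF assms(1,2)] end_exists_cot[OF assms(2,3)] end_exists_cot[OF assms(1,3)], where J = J]
  by (simp_all add: commutant_theory_def)

text \<open>Naturality in the variable from \<open>T\<close> is the law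
  \<open>commute\<close>.\<close>

lemma L_nat:
  assumes "Y \<in> J" "Y' \<in> J"
  shows "vnat_family V T C (R Y) (R Y') (Hom U Y Y') (\<lambda>X. Fh (L X) Y Y')"
  unfolding vnat_family_iff[OF T'(1) C R'[OF assms(1)] R'[OF assms(2)]]
  using assms by (simp add: commute)

text \<open>For the partial functors of \<open>D\<close> this is \<open>transpose_rl\<close>, and
  with the two theories exchanged it is \<open>transpose_lr\<close>.\<close>

definition transposed :: "('o, ('o, 'c, 'm) vfun, 'm) vfun" where
  "transposed = mk_vfun J R
     (\<lambda>Y Y'. end_arr V T C (R Y) (R Y') (Hom U Y Y') (\<lambda>X. Fh (L X) Y Y'))"

definition to_commutant :: "('o, 'o, 'm) vfun" where
  "to_commutant = mk_vfun J (\<lambda>X. X)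
     (\<lambda>X Y. end_arr V T C (cot X) (cot Y) (Hom U X Y)
       (\<lambda>Z. conj_el C (Cot C X (Fo A Z)) (Fo (R X) Z) (Fo (R Y) Z) (Cot C Y (Fo A Z))
          (phi Y Z) (Fh (L Z) X Y) (psi X Z)))"

lemma Fo_transposed [simp]: "X \<in> J \<Longrightarrow> Fo transposed X = R X"
  by (simp add: transposed_def)

lemma Fo_to_commutant [simp]: "X \<in> J \<Longrightarrow> Fo to_commutant X = X"
  by (simp add: to_commutant_def)

lemma transposed_simps [simp]:
  assumes "X \<in> J" "Y \<in> J"
  shows "Dom V (Fh transposed X Y) = Hom U X Y" "Cod V (Fh transposed X Y) = EndOb V T C (R X) (R Y)"
    "Z \<in> J \<Longrightarrow> EndPr V T C (R X) (R Y) Z \<cdot> Fh transposed X Y = Fh (L Z) X Y"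
  using assms end_arr_props[OF end_exists_R[OF assms] L_nat[OF assms]] by (simp_all add: transposed_def)

lemma to_commutant_simps [simp]:
  assumes "X \<in> J" "Y \<in> J"
  shows "Dom V (Fh to_commutant X Y) = Hom U X Y" "Cod V (Fh to_commutant X Y) = EndOb V T C (cot X) (cot Y)"
    "Z \<in> J \<Longrightarrow> EndPr V T C (cot X) (cot Y) Z \<cdot> Fh to_commutant X Y =
      conj_el C (Cot C X (Fo A Z)) (Fo (R X) Z) (Fo (R Y) Z) (Cot C Y (Fo A Z))
        (phi Y Z) (Fh (L Z) X Y) (psi X Z)"
proof -
  have "vnat_family V T C (cot X) (cot Y) (Hom U X Y)
      (\<lambda>Z. conj_el C (Fo (cot X) Z) (Fo (R X) Z) (Fo (R Y) Z) (Fo (cot Y) Z) (phi Y Z) (Fh (L Z) X Y) (psi X Z))"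
    by (rule vnat_family_conjugate[OF T'(1) C R' R' conjugate_cot conjugate_cot L_nat]) (use assms in simp_all)
  then have "vnat_family V T C (cot X) (cot Y) (Hom U X Y)
      (\<lambda>Z. conj_el C (Cot C X (Fo A Z)) (Fo (R X) Z) (Fo (R Y) Z) (Cot C Y (Fo A Z))
        (phi Y Z) (Fh (L Z) X Y) (psi X Z))"
    by (simp add: vnat_family_def)
  from end_arr_props[OF end_exists_cot[OF assms] this] assms
  show "Dom V (Fh to_commutant X Y) = Hom U X Y" "Cod V (Fh to_commutant X Y) = EndOb V T C (cot X) (cot Y)"
    "Z \<in> J \<Longrightarrow> EndPr V T C (cot X) (cot Y) Z \<cdot> Fh to_commutant X Y =
      conj_el C (Cot C X (Fo A Z)) (Fo (R X) Z) (Fo (R Y) Z) (Cot C Y (Fo A Z))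
        (phi Y Z) (Fh (L Z) X Y) (psi X Z)"
    by (simp_all add: to_commutant_def)
qed

lemma vfunctor_transposed: "vfunctor V U (Alg V J T C) transposed"
proof -
  have "Fh transposed X X \<cdot> Jd U X = Jd (Alg V J T C) (R X)" if [simp]: "X \<in> J" for X
  proof (rule EndPr_cancel[OF end_exists_R])
    fix Z assume "Z \<in> Obj T"
    then have [simp]: "Z \<in> J" by simp
    show "EndPr V T C (R X) (R X) Z \<cdot> Fh transposed X X \<cdot> Jd U X
        = EndPr V T C (R X) (R X) Z \<cdot> Jd (Alg V J T C) (R X)"
      using vfunctor_Jd[OF L'[of Z], of X] Alg_Jd(3)[OF end_exists_R[of X X], where a = Z and J = J]
      by (simp add: comp_reassoc[OF transposed_simps(3)] Fo_L)
  qed (simp_all add: Alg_Jd[OF end_exists_R])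
  moreover have "Fh transposed X W \<cdot> Mu U X Y W
      = Mu (Alg V J T C) (R X) (R Y) (R W) \<cdot> (Fh transposed Y W \<odot> Fh transposed X Y)"
    if [simp]: "X \<in> J" "Y \<in> J" "W \<in> J" for X Y W
  proof (rule EndPr_cancel[OF end_exists_R])
    note Mu = Alg_Mu[OF end_exists_R end_exists_R end_exists_R]
    fix Z assume "Z \<in> Obj T"
    then have [simp]: "Z \<in> J" by simp
    show "EndPr V T C (R X) (R W) Z \<cdot> Fh transposed X W \<cdot> Mu U X Y W
        = EndPr V T C (R X) (R W) Z \<cdot> Mu (Alg V J T C) (R X) (R Y) (R W)
            \<cdot> (Fh transposed Y W \<odot> Fh transposed X Y)"
      using vfunctor_Mu[OF L'[of Z], of X Y W]
      by (simp add: comp_reassoc[OF transposed_simps(3)] comp_reassoc[OF Mu(3)] Mu(1,2) Fo_L)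
  qed (simp_all add: Alg_Mu[OF end_exists_R end_exists_R end_exists_R])
  moreover have "transposed = mk_vfun J (Fo transposed) (Fh transposed)"
    by (simp add: transposed_def)
  ultimately show ?thesis
    unfolding vfunctor_def in_hom_iff by (simp add: R)
qed

text \<open>Both functor laws are tested on the projections of the end, where they are the laws of
  \<open>L Z\<close> conjugated by \<open>phi\<close>. The argument uses the identities and
  composition of \<open>P\<close> only as raw data.\<close>

lemma vfunctor_to_commutant: "vfunctor V U P to_commutant"
proof -
  have "Fh to_commutant X X \<cdot> Jd U X = Jd P X" if [simp]: "X \<in> J" for X
  proof (rule EndPr_cancel[OF end_exists_cot])
    fix Z assume "Z \<in> Obj T"
    then have [simp]: "Z \<in> J" by simp
    show "EndPr V T C (cot X) (cot X) Z \<cdot> Fh to_commutant X X \<cdot> Jd U X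
        = EndPr V T C (cot X) (cot X) Z \<cdot> Jd P X"
      using vfunctor_Jd[OF L'[of Z], of X] inverse_elements_simps(6)[OF phi_psi(1), of Z X]
      by (simp add: comp_reassoc[OF to_commutant_simps(3)] Fo_L P_Jd) (simp add: conj_el_def ract_eq_lact)
  qed (simp_all add: P_Jd)
  moreover have "Fh to_commutant X W \<cdot> Mu U X Y W = Mu P X Y W \<cdot> (Fh to_commutant Y W \<odot> Fh to_commutant X Y)"
    if [simp]: "X \<in> J" "Y \<in> J" "W \<in> J" for X Y W
  proof (rule EndPr_cancel[OF end_exists_cot])
    fix Z assume "Z \<in> Obj T"
    then have [simp]: "Z \<in> J" by simp
    show "EndPr V T C (cot X) (cot W) Z \<cdot> Fh to_commutant X W \<cdot> Mu U X Y W
        = EndPr V T C (cot X) (cot W) Z \<cdot> Mu P X Y W \<cdot> (Fh to_commutant Y W \<odot> Fh to_commutant X Y)"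
      using vfunctor_Mu[OF L'[of Z], of X Y W]
      by (simp add: comp_reassoc[OF to_commutant_simps(3)] comp_reassoc[OF P_Mu(3)] P_Mu(1,2) Fo_L
        mul_conj_el[OF C _ _ _ _ _ _ phi_psi(1)])
  qed (simp_all add: P_Mu)
  moreover have "to_commutant = mk_vfun J (Fo to_commutant) (Fh to_commutant)"
    by (simp add: to_commutant_def)
  ultimately show ?thesis
    unfolding vfunctor_def in_hom_iff by simp
qed

lemma EndPr_to_commutant_counit:
  assumes [simp]: "Y \<in> J" "Z \<in> J"
  shows "EndPr V T C (cot Y) (cot \<I>) Z \<cdot> Fh to_commutant Y \<I> \<cdot> counit U Y = Cun C Y (Fo A Z)"
proof -
  have "EndPr V T C (cot Y) (cot \<I>) Z \<cdot> Fh to_commutant Y \<I> \<cdot> counit U Y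
     = ract C (Cot C Y (Fo A Z)) (Fo (R Y) Z) (Fo A Z) (eta Y Z) (psi Y Z)"
    by (simp add: comp_reassoc[OF to_commutant_simps(3)]) (simp add: conj_el_def flip: eta_def)
  then show ?thesis using phi_psi(3) by simp
qed

text \<open>At each \<open>Z\<close> conjugation turns \<open>eta\<close> into the designated
  counit, so the comparison sends counits of \<open>U\<close> to counits of the commutant.\<close>

lemma to_commutant_counit:
  assumes [simp]: "Y \<in> J"
  shows "Fh to_commutant Y \<I> \<cdot> counit U Y = alg_cun V T C Y A"
proof -
  have "end_arr V T C (cot Y) (cot \<I>) Y (\<lambda>X. Cun C Y (Fo A X)) = Fh to_commutant Y \<I> \<cdot> counit U Y"
    by (rule end_arr_eq[OF end_exists_cot]) (simp_all add: EndPr_to_commutant_counit del: to_commutant_simps(3))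
  then show ?thesis by (simp add: alg_cun_def cot_unit)
qed

lemma alg_cun_simps [simp]:
  assumes "Y \<in> J"
  shows "Dom V (alg_cun V T C Y A) = Y" "Cod V (alg_cun V T C Y A) = EndOb V T C (cot Y) A"
    "Z \<in> J \<Longrightarrow> EndPr V T C (cot Y) A Z \<cdot> alg_cun V T C Y A = Cun C Y (Fo A Z)"
  using assms to_commutant_simps(1,2)[of Y \<I>] EndPr_to_commutant_counit[of Y Z]
  by (simp_all add: cot_unit flip: to_commutant_counit)

text \<open>\<open>Str P\<close> is defined by a description through the counit equation. The image
  of \<open>Str U\<close> satisfies it since the comparison preserves composition and counits, by
  \<open>mul_counit_Str\<close>.\<close>

lemma Str_P: "Str P = vfun_comp V (arities_op V J) to_commutant (Str U)"
proof -
  note [simp] = Str_simps[OF U] is_theory_simps(4)[OF U]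
  have "cotensor_arr V (Alg V J T C) Y A (cot Y) (alg_cun V T C Y A) (Ihom V Y X) (cot X)
      (alg_cun V T C X A \<cdot> Ev V Y X) = Fh to_commutant X Y \<cdot> Fh (Str U) X Y" (is "_ = ?h")
    if [simp]: "X \<in> J" "Y \<in> J" for X Y
    unfolding cotensor_arr_def Alg_simps
  proof (rule the_equality)
    have Mu: "Mu (Alg V J T C) (cot X) (cot Y) A = Mu P X Y \<I>"
      by (simp add: commutant_theory_def cot_unit)
    note [simp] = P_Mu
    have MuP: "Mu P X Y \<I> \<cdot> (Fh to_commutant Y \<I> \<odot> Fh to_commutant X Y) = Fh to_commutant X \<I> \<cdot> Mu U X Y \<I>"
      using vfunctor_Mu[OF vfunctor_to_commutant, of X Y \<I>] by (simp add: mul_def)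
    have "Mu P X Y \<I> \<cdot> (alg_cun V T C Y A \<odot> ?h) \<cdot> Sym V (Ihom V Y X) Y
      = (Mu P X Y \<I> \<cdot> (Fh to_commutant Y \<I> \<odot> Fh to_commutant X Y)) \<cdot> (counit U Y \<odot> Fh (Str U) X Y) \<cdot> Sym V (Ihom V Y X) Y"
      by (simp flip: to_commutant_counit)
    also have "\<dots> = Fh to_commutant X \<I> \<cdot> mul U X Y \<I> (counit U Y) (Fh (Str U) X Y) \<cdot> Sym V (Ihom V Y X) Y"
      by (simp only: MuP) (simp add: mul_def)
    also have "\<dots> = alg_cun V T C X A \<cdot> Ev V Y X"
      by (simp add: mul_counit_Str[OF U] flip: to_commutant_counit)
    finally have h: "Mu P X Y \<I> \<cdot> (alg_cun V T C Y A \<odot> ?h) \<cdot> Sym V (Ihom V Y X) Y = alg_cun V T C X A \<cdot> Ev V Y X" .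
    then show "?h \<in> hom V (Ihom V Y X) (EndOb V T C (cot X) (cot Y)) \<and>
      Mu (Alg V J T C) (cot X) (cot Y) A \<cdot> (alg_cun V T C Y A \<odot> ?h) \<cdot> Sym V (Ihom V Y X) Y = alg_cun V T C X A \<cdot> Ev V Y X"
      by (simp add: in_hom_iff Mu)
    fix h assume "h \<in> hom V (Ihom V Y X) (EndOb V T C (cot X) (cot Y)) \<and>
      Mu (Alg V J T C) (cot X) (cot Y) A \<cdot> (alg_cun V T C Y A \<odot> h) \<cdot> Sym V (Ihom V Y X) Y = alg_cun V T C X A \<cdot> Ev V Y X"
    then have h': "Dom V h = Ihom V Y X" "Cod V h = EndOb V T C (cot X) (cot Y)"
      "Mu P X Y \<I> \<cdot> (alg_cun V T C Y A \<odot> h) \<cdot> Sym V (Ihom V Y X) Y = alg_cun V T C X A \<cdot> Ev V Y X"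
      by (simp_all add: in_hom_iff Mu)
    note [simp] = h'(1,2)
    have "(Mu P X Y \<I> \<cdot> (alg_cun V T C Y A \<odot> h)) \<cdot> Sym V (Ihom V Y X) Y
       = (Mu P X Y \<I> \<cdot> (alg_cun V T C Y A \<odot> ?h)) \<cdot> Sym V (Ihom V Y X) Y"
      using h h'(3) by (simp add: cot_unit)
    then have eq: "Mu P X Y \<I> \<cdot> (alg_cun V T C Y A \<odot> h) = Mu P X Y \<I> \<cdot> (alg_cun V T C Y A \<odot> ?h)"
      by (rule iso_cancel_right) (simp_all add: cot_unit)
    \<comment> \<open>Uniqueness is verified componentwise: at each \<open>Z\<close> the equation
      becomes one about the designated cotensor in \<open>C\<close>, where the counit can be
      cancelled.\<close>
    show "h = ?h"
    proof (rule EndPr_cancel[OF end_exists_cot])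
      fix Z assume "Z \<in> Obj T"
      then have [simp]: "Z \<in> J" by simp
      have comp: "EndPr V T C (cot X) A Z \<cdot> Mu P X Y \<I> \<cdot> (alg_cun V T C Y A \<odot> k) =
          mul C (Cot C X (Fo A Z)) (Cot C Y (Fo A Z)) (Fo A Z) (Cun C Y (Fo A Z)) (EndPr V T C (cot X) (cot Y) Z \<cdot> k)"
        if [simp]: "Dom V k = Ihom V Y X" "Cod V k = EndOb V T C (cot X) (cot Y)" for k
      proof -
        have "EndPr V T C (cot X) A Z \<cdot> Mu P X Y \<I> \<cdot> (alg_cun V T C Y A \<odot> k)
          = mul C (Cot C X (Fo A Z)) (Cot C Y (Fo A Z)) (Fo A Z) (EndPr V T C (cot Y) A Z) (EndPr V T C (cot X) (cot Y) Z)
             \<cdot> (alg_cun V T C Y A \<odot> k)"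
          using comp_reassoc[OF P_Mu(3)[of X Y \<I> Z], of "alg_cun V T C Y A \<odot> k"] EndPr_cot_simps[of X \<I> Z]
          by (simp add: cot_unit)
        then show ?thesis
          using EndPr_cot_simps[of Y \<I> Z] by (simp add: cot_unit)
      qed
      have "mul C (Cot C X (Fo A Z)) (Cot C Y (Fo A Z)) (Fo A Z) (Cun C Y (Fo A Z)) (EndPr V T C (cot X) (cot Y) Z \<cdot> h)
        = mul C (Cot C X (Fo A Z)) (Cot C Y (Fo A Z)) (Fo A Z) (Cun C Y (Fo A Z)) (EndPr V T C (cot X) (cot Y) Z \<cdot> ?h)"
        using eq comp[of h] comp[of ?h] by (simp del: to_commutant_simps(3))
      then show "EndPr V T C (cot X) (cot Y) Z \<cdot> h = EndPr V T C (cot X) (cot Y) Z \<cdot> ?h"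
        by (rule cotensor_cancel[OF C Cot_cotensor[of Y "Fo A Z"], rotated 3]) simp_all
    qed simp_all
  qed
  then show ?thesis
    unfolding commutant_theory_def vfun_comp_def arities_op_simps by (simp cong: mk_vfun_cong)
qed

text \<open>Conjugation makes the chosen end for \<open>R X, R Y\<close> into an end for
  \<open>cot X, cot Y\<close>, hence canonically isomorphic to the chosen one. The comparison
  functor is the transpose followed by this isomorphism \<open>k\<close>.\<close>

lemma iso_transposed_iff:
  assumes [simp]: "X \<in> J" "Y \<in> J"
  shows "iso V (Fh transposed X Y) \<longleftrightarrow> iso V (Fh to_commutant X Y)"
proof -
  let ?\<pi> = "\<lambda>Z. conj_el C (Fo (cot X) Z) (Fo (R X) Z) (Fo (R Y) Z) (Fo (cot Y) Z)
      (phi Y Z) (EndPr V T C (R X) (R Y) Z) (psi X Z)"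
  have "is_end V T C (cot X) (cot Y) (EndOb V T C (R X) (R Y)) ?\<pi>"
    by (rule is_end_conjugate[OF T'(1) C R' R' conjugate_cot conjugate_cot is_end_EndOb])
      (simp_all add: end_exists_R)
  from is_end_comparison[OF this is_end_EndOb[OF end_exists_cot[OF assms]] T'(1) C cot_vfunctor cot_vfunctor]
  obtain k where k: "iso V k" "Dom V k = EndOb V T C (R X) (R Y)" "Cod V k = EndOb V T C (cot X) (cot Y)"
    "\<And>Z. Z \<in> J \<Longrightarrow> EndPr V T C (cot X) (cot Y) Z \<cdot> k = ?\<pi> Z"
    by auto
  have kt: "k \<cdot> Fh transposed X Y = Fh to_commutant X Y"
  proof (rule EndPr_cancel[OF end_exists_cot])
    fix Z assume "Z \<in> Obj T"
    then have [simp]: "Z \<in> J" by simp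
    have "EndPr V T C (cot X) (cot Y) Z \<cdot> k \<cdot> Fh transposed X Y = ?\<pi> Z \<cdot> Fh transposed X Y"
      by (rule comp_reassoc) (use k in simp_all)
    then show "EndPr V T C (cot X) (cot Y) Z \<cdot> k \<cdot> Fh transposed X Y
        = EndPr V T C (cot X) (cot Y) Z \<cdot> Fh to_commutant X Y"
      by simp
  qed (use k in simp_all)
  then have "Fh transposed X Y = inv_arr V k \<cdot> Fh to_commutant X Y"
    using k by (simp flip: kt)
  then show ?thesis
    using kt k iso_comp[of "Fh transposed X Y" k] iso_comp[of "Fh to_commutant X Y" "inv_arr V k"] by auto
qed

section \<open>Isomorphism with the commutant against invertibility of the comparison\<close>

definition Aperp :: "('o, 'c, 'm) vfun" where "Aperp = snd (commutant V J C (T, A))"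

lemma commutant_eq: "commutant V J C (T, A) = (P, Aperp)"
  by (simp add: Aperp_def commutant_def)

lemma Aperp_simps [simp]:
  "X \<in> J \<Longrightarrow> Fo Aperp X = Cot C X (Fo A \<I>)"
  "\<lbrakk>X \<in> J; Y \<in> J\<rbrakk> \<Longrightarrow> Fh Aperp X Y = EndPr V T C (cot X) (cot Y) \<I>"
  by (simp_all add: Aperp_def commutant_def carrier_def)

lemma Aperp_mk: "Aperp = mk_vfun J (Fo Aperp) (Fh Aperp)"
  by (simp add: Aperp_def commutant_def)

lemma commutant_imp_iso:
  assumes iso: "algebra_isomorphic V J C (Fo A \<I>) (U, L \<I>) (commutant V J C (T, A))"
    and [simp]: "X \<in> J" "Y \<in> J"
  shows "iso V (Fh to_commutant X Y)"
proof -
  from iso obtain M f N g where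
    Mf: "(M, f) \<in> algebra_hom V J C (Fo A \<I>) (U, L \<I>) (P, Aperp)" and
    Ng: "(N, g) \<in> algebra_hom V J C (Fo A \<I>) (P, Aperp) (U, L \<I>)" and
    inv: "vfun_comp V U N M = vfun_id V U" "vfun_comp V P M N = vfun_id V P" and
    alg: "is_theory V J P" "is_algebra V J P C Aperp"
    by (auto simp: commutant_eq algebra_isomorphic_def algebra_comp_def algebra_id_def algebras_on_def)
  have M: "vfunctor V U P M" and M_Str: "vfun_comp V (arities_op V J) M (Str U) = Str P"
    and N: "vfunctor V P U N" and N_Str: "vfun_comp V (arities_op V J) N (Str P) = Str U"
    and f: "vnat V U C (L \<I>) (vfun_comp V U Aperp M) f" and f_unit: "f \<I> = Jd C (Fo A \<I>)"
    using Mf Ng by (auto simp: algebra_hom_def theory_morphism_def vnat_iso_def)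
  note [simp] = is_theory_simps(4)[OF U] is_theory_simps(4)[OF alg(1)]
  \<comment> \<open>Both structure functors fix objects, and \<open>M\<close> and \<open>N\<close>
    commute with them.\<close>
  have Fo_M [simp]: "Fo M K = K" and Fo_N [simp]: "Fo N K = K" if "K \<in> J" for K
    using that arg_cong[OF M_Str, of "\<lambda>F. Fo F K"] arg_cong[OF N_Str, of "\<lambda>F. Fo F K"] by simp_all
  have M_simps [simp]: "Dom V (Fh M K K') = Hom U K K'"
    "Cod V (Fh M K K') = EndOb V T C (cot K) (cot K')" if "K \<in> J" "K' \<in> J" for K K'
    using that vfunctor_simps[OF M] by simp_all
  have N_simps [simp]: "Cod V (Fh N K K') = Hom U K K'"
    "Dom V (Fh N K K') = EndOb V T C (cot K) (cot K')" if "K \<in> J" "K' \<in> J" for K K'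
    using that vfunctor_simps[OF N] by simp_all
  have P: "vcategory V P" and Ap: "vfunctor V P C Aperp"
    using alg by (auto simp: is_algebra_def is_theory_def)
  have ApM: "vfunctor V U C (vfun_comp V U Aperp M)"
    by (rule vfunctor_comp[OF P C M Ap]) simp_all
  have f_simps [simp]: "Dom V (f K) = \<I>" "Cod V (f K) = Hom C (Fo (R K) \<I>) (Cot C K (Fo A \<I>))"
    if "K \<in> J" for K
    using f that unfolding vnat_iff[OF U'(1) C L'[OF unit_J] ApM] by (auto simp: Fo_L)
  have nat: "lact C (Fo (R K) \<I>) (Fo (R K') \<I>) (Cot C K' (Fo A \<I>)) (f K') (Fh (L \<I>) K K')
      = ract C (Fo (R K) \<I>) (Cot C K (Fo A \<I>)) (Cot C K' (Fo A \<I>))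
          (EndPr V T C (cot K) (cot K') \<I> \<cdot> Fh M K K') (f K)"
    if "K \<in> J" "K' \<in> J" for K K'
    using f that unfolding vnat_iff[OF U'(1) C L'[OF unit_J] ApM] by (auto simp: Fo_L)
  \<comment> \<open>Naturality of \<open>f\<close> at the counit of \<open>K\<close>, where
    \<open>f \<I>\<close> is the identity element, gives the equation that characterises
    \<open>phi\<close>.\<close>
  have f_eq: "f K = phi K \<I>" if [simp]: "K \<in> J" for K
  proof (rule cotensor_cancel[OF C Cot_cotensor[of K "Fo A \<I>"]])
    have cun: "EndPr V T C (cot K) (cot \<I>) \<I> \<cdot> Fh M K \<I> \<cdot> counit U K = Cun C K (Fo A \<I>)"
    proof -
      \<comment> \<open>\<open>M\<close> is known only along \<open>Str U\<close>; the counit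
        factors through it, and there both functors give \<open>Str P\<close>.\<close>
      have "Fh M K \<I> \<cdot> Fh (Str U) K \<I> = Fh to_commutant K \<I> \<cdot> Fh (Str U) K \<I>"
        using arg_cong[OF M_Str, of "\<lambda>F. Fh F K \<I>"] by (simp add: Str_P)
      then have "Fh M K \<I> \<cdot> counit U K = Fh to_commutant K \<I> \<cdot> counit U K"
        unfolding counit_def by - (rule comp_reassoc2, simp_all add: Str_simps[OF U])
      then show ?thesis using EndPr_to_commutant_counit[of K \<I>] by simp
    qed
    have "ract C (Fo (R K) \<I>) (Cot C K (Fo A \<I>)) (Fo A \<I>) (Cun C K (Fo A \<I>)) (f K)
       = ract C (Fo (R K) \<I>) (Cot C K (Fo A \<I>)) (Fo A \<I>)
           (EndPr V T C (cot K) (cot \<I>) \<I> \<cdot> Fh M K \<I>) (f K) \<cdot> counit U K"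
      by (simp add: cun)
    also have "\<dots> = eta K \<I>"
      using nat[of K \<I>] by (simp add: f_unit eta_def)
    also have "\<dots> = ract C (Fo (R K) \<I>) (Cot C K (Fo A \<I>)) (Fo A \<I>) (Cun C K (Fo A \<I>)) (phi K \<I>)"
      by (simp add: phi_psi(2))
    finally show "mul C (Fo (R K) \<I>) (Cot C K (Fo A \<I>)) (Fo A \<I>) (Cun C K (Fo A \<I>)) (f K)
        = mul C (Fo (R K) \<I>) (Cot C K (Fo A \<I>)) (Fo A \<I>) (Cun C K (Fo A \<I>)) (phi K \<I>)"
      by (simp add: mul_unit_right)
  qed simp_all
  \<comment> \<open>Once \<open>f\<close> is \<open>phi\<close>, the naturality square of
    \<open>f\<close> solved for \<open>M\<close> is the formula for the comparison functor at
    \<open>\<I>\<close>.\<close>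
  have "EndPr V T C (cot X) (cot Y) \<I> \<cdot> Fh M X Y =
      conj_el C (Cot C X (Fo A \<I>)) (Fo (R X) \<I>) (Fo (R Y) \<I>) (Cot C Y (Fo A \<I>))
        (phi Y \<I>) (Fh (L \<I>) X Y) (psi X \<I>)"
    by (subst conj_el_eq_iff(2)[OF C _ _ _ _ phi_psi(1)[of \<I> X] phi_psi(1)[of \<I> Y], symmetric])
      (use nat[of X Y] in \<open>simp_all add: f_eq\<close>)
  also have "\<dots> = EndPr V T C (cot X) (cot Y) \<I> \<cdot> Fh to_commutant X Y"
    by (rule to_commutant_simps(3)[symmetric]) simp_all
  finally have "EndPr V T C (cot X) (cot Y) \<I> \<cdot> Fh M X Y = EndPr V T C (cot X) (cot Y) \<I> \<cdot> Fh to_commutant X Y" .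
  then have "Fh M X Y = Fh to_commutant X Y"
    by - (rule EndPr_unit_cancel[OF T unit_J admissible cot_algebra[of X] cot_algebra[of Y]], simp_all)
  moreover have "iso V (Fh M X Y)"
  proof (rule isoI[of "Fh N X Y"])
    show "Fh N X Y \<cdot> Fh M X Y = \<one> (Dom V (Fh M X Y))"
      using arg_cong[OF inv(1), of "\<lambda>F. Fh F X Y"] by (simp add: vfun_id_def)
    show "Fh M X Y \<cdot> Fh N X Y = \<one> (Cod V (Fh M X Y))"
      using arg_cong[OF inv(2), of "\<lambda>F. Fh F X Y"] by (simp add: vfun_id_def)
  qed simp_all
  ultimately show ?thesis by simp
qed

lemma iso_imp_commutant:
  assumes iso: "\<And>X Y. \<lbrakk>X \<in> J; Y \<in> J\<rbrakk> \<Longrightarrow> iso V (Fh to_commutant X Y)"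
  shows "algebra_isomorphic V J C (Fo A \<I>) (U, L \<I>) (commutant V J C (T, A))"
proof -
  \<comment> \<open>From here on \<open>P\<close> is known to be an enriched category.\<close>
  interpret M: id_on_obj_iso V U P to_commutant
    by unfold_locales (simp_all add: vfunctor_to_commutant iso P_Mu in_hom_iff)
  \<comment> \<open>The same locale for the inverse, so that the inverse preserves cotensors as
    well.\<close>
  interpret N: id_on_obj_iso V P U M.inv_vfun
    by (rule M.id_on_obj_iso_inv_vfun)
  let ?N = "M.inv_vfun" and ?f = "restrict (\<lambda>Y. phi Y \<I>) J" and ?g = "restrict (\<lambda>Y. psi Y \<I>) J"
  note P [simp] = M.vcategory_Y
  note [simp] = iso is_theory_simps(4)[OF U] Fo_L
  have Fo_N [simp]: "Fo ?N Y = Y" and Fh_N [simp]: "Fh ?N X Y = inv_arr V (Fh to_commutant X Y)"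
    if "X \<in> J" "Y \<in> J" for X Y
    using that M.inv_vfun_simps by simp_all
  have P_theory: "is_theory V J P"
    unfolding is_theory_def
  proof (intro conjI)
    have pres: "preserves_cotensors V J (arities_op V J) U (Str U)"
      using U by (simp add: is_theory_def)
    show "preserves_cotensors V J (arities_op V J) P (Str P)"
      unfolding Str_P
      by (rule preserves_cotensors_comp[OF pres M.preserves_cotensors_M is_theory_simps(3)[OF U] vfunctor_to_commutant])
    show "vfunctor V (arities_op V J) P (Str P)"
      unfolding Str_P
      by (rule vfunctor_comp[OF U'(1) P is_theory_simps(3)[OF U] vfunctor_to_commutant]) simp_all
  qed (simp_all add: Str_P)
  have LN: "vfunctor V P C (vfun_comp V P (L \<I>) ?N)"
    by (rule vfunctor_comp[OF U'(1) C M.vfunctor_inv_vfun L']) (simp_all add: P_Jd P_Mu)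
  have L_pres: "preserves_cotensors V J U C (L \<I>)"
    using L by (simp add: is_algebra_def)
  have LN_pres: "preserves_cotensors V J P C (vfun_comp V P (L \<I>) ?N)"
    by (rule preserves_cotensors_comp[OF N.preserves_cotensors_M L_pres M.vfunctor_inv_vfun L']) simp
  \<comment> \<open>The projection formula for the comparison, solved for the projection by
    invertibility.\<close>
  have EndPr_eq: "EndPr V T C (cot X) (cot Y) \<I> =
      conj_el C (Cot C X (Fo A \<I>)) (Fo (R X) \<I>) (Fo (R Y) \<I>) (Cot C Y (Fo A \<I>))
        (phi Y \<I>) (Fh (L \<I>) X Y \<cdot> inv_arr V (Fh to_commutant X Y)) (psi X \<I>)"
    if [simp]: "X \<in> J" "Y \<in> J" for X Y
    using comp_inv_right[OF to_commutant_simps(3)[of X Y \<I>]] by simp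
  \<comment> \<open>The commutant algebra is the right face, carried back along the inverse and
    conjugated by \<open>phi\<close>. Hence it is a functor and preserves cotensors.\<close>
  have conj1: "conjugate P C (vfun_comp V P (L \<I>) ?N) Aperp (\<lambda>Y. phi Y \<I>) (\<lambda>Y. psi Y \<I>)"
    unfolding conjugate_def using Aperp_mk phi_psi(1)[OF unit_J] EndPr_eq by simp
  have conj2: "conjugate U C (L \<I>) (vfun_comp V U Aperp to_commutant) (\<lambda>Y. phi Y \<I>) (\<lambda>Y. psi Y \<I>)"
    unfolding conjugate_def using phi_psi(1)[OF unit_J] by simp (simp add: vfun_comp_def)
  have Aperp: "is_algebra V J P C Aperp"
    using conjugate_vfunctor[OF P C LN conj1] conjugate_preserves_cotensors[OF P C LN conj1 LN_pres]
    by (simp add: is_algebra_def)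
  have NM: "vfun_comp V U ?N to_commutant = vfun_id V U"
    unfolding vfun_comp_def vfun_id_def by (rule mk_vfun_cong) simp_all
  have MN: "vfun_comp V P to_commutant ?N = vfun_id V P"
    unfolding vfun_comp_def vfun_id_def by (rule mk_vfun_cong) simp_all
  have N_Str: "vfun_comp V (arities_op V J) ?N (Str P) = Str U"
  proof -
    have "vfun_comp V (arities_op V J) ?N (Str P)
        = mk_vfun (Obj (arities_op V J)) (Fo (Str U)) (Fh (Str U))"
      unfolding Str_P vfun_comp_def[of _ _ "?N"]
      by (rule mk_vfun_cong) (simp_all add: Str_simps[OF U])
    then show ?thesis
      using vfunctor_mk[OF is_theory_simps(3)[OF U]] by simp
  qed
  have hom1: "(to_commutant, ?f) \<in> algebra_hom V J C (Fo A \<I>) (U, L \<I>) (P, Aperp)"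
    using conjugate_vnat_iso[OF U'(1) C L' conj2]
    by (simp add: algebra_hom_def theory_morphism_def vfunctor_to_commutant Str_P)
  have hom2: "(?N, ?g) \<in> algebra_hom V J C (Fo A \<I>) (P, Aperp) (U, L \<I>)"
    using conjugate_vnat_iso[OF P C conjugate_vfunctor[OF P C LN conj1] conjugate_sym[OF P C LN conj1]]
    by (simp add: algebra_hom_def theory_morphism_def M.vfunctor_inv_vfun N_Str)
  have comp1: "algebra_comp V C (U, L \<I>) (P, Aperp) (U, L \<I>) (?N, ?g) (to_commutant, ?f) = algebra_id V C (U, L \<I>)"
    unfolding algebra_comp_def algebra_id_def prod.case vnat_id_def NM
    by (subst vnat_comp_eq) (simp_all add: inverse_elements_simps(5)[OF phi_psi(1)] vfun_id_def cong: restrict_cong)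
  have comp2: "algebra_comp V C (P, Aperp) (U, L \<I>) (P, Aperp) (to_commutant, ?f) (?N, ?g) = algebra_id V C (P, Aperp)"
    unfolding algebra_comp_def algebra_id_def prod.case vnat_id_def MN
    by (subst vnat_comp_eq) (simp_all add: inverse_elements_simps(6)[OF phi_psi(1)] vfun_id_def cong: restrict_cong)
  show ?thesis
    unfolding algebra_isomorphic_def commutant_eq
  proof (intro conjI bexI)
    show "(U, L \<I>) \<in> algebras_on V J C (Fo A \<I>)" "(P, Aperp) \<in> algebras_on V J C (Fo A \<I>)"
      using U L P_theory Aperp by (simp_all add: algebras_on_def carrier_def)
  qed (rule comp1, rule comp2, rule hom2, rule hom1)
qed

theorem commutant_iff_fully_faithful:
  "algebra_isomorphic V J C (Fo A \<I>) (U, L \<I>) (commutant V J C (T, A))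
    \<longleftrightarrow> fully_faithful V U (Alg V J T C) transposed"
  using commutant_imp_iso iso_imp_commutant
  by (auto simp: fully_faithful_def vfunctor_transposed iso_transposed_iff)

text \<open>The law \<open>commute\<close> is its own mirror image: composing it with the inverse
  symmetry moves the symmetry to the other side.\<close>

lemma commuting_algebras_swap: "commuting_algebras V J C U T R L"
proof unfold_locales
  fix X X' Y Y' assume [simp]: "X \<in> J" "X' \<in> J" "Y \<in> J" "Y' \<in> J"
  have "mul C (Fo (R X) Y) (Fo (R X') Y) (Fo (R X') Y') (Fh (R X') Y Y') (Fh (L Y) X X') \<cdot> Sym V (Hom U X X') (Hom T Y Y')
    = (mul C (Fo (R X) Y) (Fo (R X) Y') (Fo (R X') Y') (Fh (L Y') X X') (Fh (R X) Y Y') \<cdot> Sym V (Hom T Y Y') (Hom U X X'))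
       \<cdot> Sym V (Hom U X X') (Hom T Y Y')"
    by (subst commute) simp_all
  then show "mul C (Fo (L Y) X) (Fo (L Y) X') (Fo (L Y') X') (Fh (R X') Y Y') (Fh (L Y) X X')
      \<cdot> Sym V (Hom U X X') (Hom T Y Y')
    = mul C (Fo (L Y) X) (Fo (L Y') X) (Fo (L Y') X') (Fh (L Y') X X') (Fh (R X) Y Y')"
    by (simp add: Fo_L)
qed (simp_all add: arities_J admissible T U L R Fo_L)

end

section \<open>Bifold algebras\<close>

context symmetric_monoidal_closed
begin

lemma tensor_vcat_simps [simp]:
  "Obj (tensor_vcat V X Y) = Obj X \<times> Obj Y"
  "Hom (tensor_vcat V X Y) (a, b) (a', b') = Hom X a a' \<otimes> Hom Y b b'"
  "Jd (tensor_vcat V X Y) (a, b) = (Jd X a \<odot> Jd Y b) \<cdot> inv_arr V (Lun V \<I>)"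
  "Mu (tensor_vcat V X Y) (a, b) (a', b') (a'', b'') = (Mu X a a' a'' \<odot> Mu Y b b' b'') \<cdot>
      mid4 V (Hom X a' a'') (Hom Y b' b'') (Hom X a a') (Hom Y b b')"
  by (simp_all add: tensor_vcat_def)

lemma mul_id_id:
  assumes "vcategory V X" "a \<in> Obj X" "b \<in> Obj X" "c \<in> Obj X"
  shows "mul X a b c (\<one> (Hom X b c)) (\<one> (Hom X a b)) = Mu X a b c"
  using assms by (simp add: mul_def)

context
  fixes X :: "('a, 'o, 'm, 'x) vcat_scheme" and Y :: "('b, 'o, 'm, 'y) vcat_scheme"
    and Z :: "('c, 'o, 'm, 'z) vcat_scheme" and D :: "('a \<times> 'b, 'c, 'm) vfun"
  assumes X [simp]: "vcategory V X" and Y [simp]: "vcategory V Y" and Z [simp]: "vcategory V Z"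
    and D: "vfunctor V (tensor_vcat V X Y) Z D"
begin

lemma bifunctor_simps [simp]:
  "\<lbrakk>a \<in> Obj X; b \<in> Obj Y\<rbrakk> \<Longrightarrow> Fo D (a, b) \<in> Obj Z"
  "\<lbrakk>a \<in> Obj X; b \<in> Obj Y; a' \<in> Obj X; b' \<in> Obj Y\<rbrakk> \<Longrightarrow> Dom V (Fh D (a, b) (a', b')) = Hom X a a' \<otimes> Hom Y b b'"
  "\<lbrakk>a \<in> Obj X; b \<in> Obj Y; a' \<in> Obj X; b' \<in> Obj Y\<rbrakk>
     \<Longrightarrow> Cod V (Fh D (a, b) (a', b')) = Hom Z (Fo D (a, b)) (Fo D (a', b'))"
  using vfunctor_simps[OF D] by simp_all

lemma partial_functor_simps [simp]:
  "a \<in> Obj X \<Longrightarrow> Fo (fix_right V X Y D b) a = Fo D (a, b)"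
  "b \<in> Obj Y \<Longrightarrow> Fo (fix_left V X Y D a) b = Fo D (a, b)"
  "\<lbrakk>a \<in> Obj X; a' \<in> Obj X\<rbrakk> \<Longrightarrow> Fh (fix_right V X Y D b) a a' =
     Fh D (a, b) (a', b) \<cdot> (\<one> (Hom X a a') \<odot> Jd Y b) \<cdot> inv_arr V (Run V (Hom X a a'))"
  "\<lbrakk>b \<in> Obj Y; b' \<in> Obj Y\<rbrakk> \<Longrightarrow> Fh (fix_left V X Y D a) b b' =
     Fh D (a, b) (a, b') \<cdot> (Jd X a \<odot> \<one> (Hom Y b b')) \<cdot> inv_arr V (Lun V (Hom Y b b'))"
  by (simp_all add: fix_right_def fix_left_def)

text \<open>The interchange law for \<open>D\<close>. The extra arrows \<open>k\<close> and
  \<open>l\<close> leave room for the inverse unit isomorphisms that occur in the partial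
  functors.\<close>

lemma bifunctor_mul:
  assumes "a \<in> Obj X" "a' \<in> Obj X" "a'' \<in> Obj X" "b \<in> Obj Y" "b' \<in> Obj Y" "b'' \<in> Obj Y"
    "Cod V f = Hom X a a'" "Cod V f' = Hom X a' a''" "Cod V g = Hom Y b b'" "Cod V g' = Hom Y b' b''"
    "Cod V k = Dom V f' \<otimes> Dom V g'" "Cod V l = Dom V f \<otimes> Dom V g"
  shows "mul Z (Fo D (a, b)) (Fo D (a', b')) (Fo D (a'', b''))
      (Fh D (a', b') (a'', b'') \<cdot> (f' \<odot> g') \<cdot> k) (Fh D (a, b) (a', b') \<cdot> (f \<odot> g) \<cdot> l)
    = Fh D (a, b) (a'', b'') \<cdot> (mul X a a' a'' f' f \<odot> mul Y b b' b'' g' g)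
        \<cdot> mid4 V (Dom V f') (Dom V g') (Dom V f) (Dom V g) \<cdot> (k \<odot> l)"
proof -
  have "mul Z (Fo D (a, b)) (Fo D (a', b')) (Fo D (a'', b''))
      (Fh D (a', b') (a'', b'') \<cdot> (f' \<odot> g') \<cdot> k) (Fh D (a, b) (a', b') \<cdot> (f \<odot> g) \<cdot> l)
    = mul Z (Fo D (a, b)) (Fo D (a', b')) (Fo D (a'', b'')) (Fh D (a', b') (a'', b'')) (Fh D (a, b) (a', b'))
        \<cdot> ((f' \<odot> g') \<odot> (f \<odot> g)) \<cdot> (k \<odot> l)"
    using assms by simp
  also have "mul Z (Fo D (a, b)) (Fo D (a', b')) (Fo D (a'', b'')) (Fh D (a', b') (a'', b'')) (Fh D (a, b) (a', b'))
    = Fh D (a, b) (a'', b'') \<cdot> (Mu X a a' a'' \<odot> Mu Y b b' b'')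
        \<cdot> mid4 V (Hom X a' a'') (Hom Y b' b'') (Hom X a a') (Hom Y b b')"
    using assms vfunctor_Mu[OF D, of "(a, b)" "(a', b')" "(a'', b'')"] by simp
  also have "\<dots> \<cdot> ((f' \<odot> g') \<odot> (f \<odot> g)) \<cdot> (k \<odot> l) = Fh D (a, b) (a'', b'') \<cdot> (Mu X a a' a'' \<odot> Mu Y b b' b'')
        \<cdot> (mid4 V (Hom X a' a'') (Hom Y b' b'') (Hom X a a') (Hom Y b b') \<cdot> ((f' \<odot> g') \<odot> (f \<odot> g))) \<cdot> (k \<odot> l)"
    using assms by (simp del: ten_merge ten_merge_comp)
  also have "\<dots> = Fh D (a, b) (a'', b'') \<cdot> (Mu X a a' a'' \<odot> Mu Y b b' b'')
        \<cdot> (((f' \<odot> f) \<odot> (g' \<odot> g)) \<cdot> mid4 V (Dom V f') (Dom V g') (Dom V f) (Dom V g)) \<cdot> (k \<odot> l)"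
    using mid4_nat[of f' g' f g] assms by (simp only:)
  finally show ?thesis using assms by (simp add: mul_def)
qed

lemma vfunctor_fix_right:
  assumes [simp]: "b \<in> Obj Y"
  shows "vfunctor V X Z (fix_right V X Y D b)"
  unfolding vfunctor_def in_hom_iff
proof (intro conjI ballI)
  show "fix_right V X Y D b = mk_vfun (Obj X) (Fo (fix_right V X Y D b)) (Fh (fix_right V X Y D b))"
    by (simp add: fix_right_def)
  fix a a' a'' assume [simp]: "a \<in> Obj X" "a' \<in> Obj X" "a'' \<in> Obj X"
  show "Fh (fix_right V X Y D b) a a \<cdot> Jd X a = Jd Z (Fo (fix_right V X Y D b) a)"
    using vfunctor_Jd[OF D, of "(a, b)"] inv_run_nat[of "Jd X a"]
    by (simp add: lun_unit_eq_run_unit)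
  let ?H = "Hom X a a'" and ?H' = "Hom X a' a''"
  \<comment> \<open>Solving \<open>mid4_units_24\<close> for the interchange shows that the two
    inserted units merge into one.\<close>
  have "(\<one> (?H' \<otimes> ?H) \<odot> Lun V \<I>) \<cdot> mid4 V ?H' \<I> ?H \<I> = inv_arr V (Run V (?H' \<otimes> ?H)) \<cdot> (Run V ?H' \<odot> Run V ?H)"
    by (simp flip: mid4_units_24)
  then have mid: "(\<one> (?H' \<otimes> ?H) \<odot> Lun V \<I>) \<cdot> mid4 V ?H' \<I> ?H \<I> \<cdot> (inv_arr V (Run V ?H') \<odot> inv_arr V (Run V ?H))
     = inv_arr V (Run V (?H' \<otimes> ?H))"
    by (subst comp_reassoc[of _ _ "inv_arr V (Run V (?H' \<otimes> ?H)) \<cdot> (Run V ?H' \<odot> Run V ?H)"]) simp_all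
  have "mul Z (Fo D (a, b)) (Fo D (a', b)) (Fo D (a'', b)) (Fh (fix_right V X Y D b) a' a'') (Fh (fix_right V X Y D b) a a')
    = Fh D (a, b) (a'', b) \<cdot> (Mu X a a' a'' \<odot> Jd Y b) \<cdot> (\<one> (?H' \<otimes> ?H) \<odot> Lun V \<I>)
      \<cdot> mid4 V ?H' \<I> ?H \<I> \<cdot> (inv_arr V (Run V ?H') \<odot> inv_arr V (Run V ?H))"
    by (simp add: bifunctor_mul mul_id_id mul_Jd lun_unit_eq_run_unit)
  also have "\<dots> = Fh D (a, b) (a'', b) \<cdot> (\<one> (Hom X a a'') \<odot> Jd Y b) \<cdot> (Mu X a a' a'' \<odot> \<one> \<I>) \<cdot> inv_arr V (Run V (?H' \<otimes> ?H))"
    by (simp only: mid) simp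
  also have "\<dots> = Fh (fix_right V X Y D b) a a'' \<cdot> Mu X a a' a''"
    using inv_run_nat[of "Mu X a a' a''"] by simp
  finally show "Fh (fix_right V X Y D b) a a'' \<cdot> Mu X a a' a'' =
       Mu Z (Fo (fix_right V X Y D b) a) (Fo (fix_right V X Y D b) a') (Fo (fix_right V X Y D b) a'') \<cdot>
       (Fh (fix_right V X Y D b) a' a'' \<odot> Fh (fix_right V X Y D b) a a')"
    by (simp add: mul_def)
qed simp_all

lemma vfunctor_fix_left:
  assumes [simp]: "a \<in> Obj X"
  shows "vfunctor V Y Z (fix_left V X Y D a)"
  unfolding vfunctor_def in_hom_iff
proof (intro conjI ballI)
  show "fix_left V X Y D a = mk_vfun (Obj Y) (Fo (fix_left V X Y D a)) (Fh (fix_left V X Y D a))"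
    by (simp add: fix_left_def)
  fix b b' b'' assume [simp]: "b \<in> Obj Y" "b' \<in> Obj Y" "b'' \<in> Obj Y"
  show "Fh (fix_left V X Y D a) b b \<cdot> Jd Y b = Jd Z (Fo (fix_left V X Y D a) b)"
    using vfunctor_Jd[OF D, of "(a, b)"] inv_lun_nat[of "Jd Y b"] by simp
  let ?H = "Hom Y b b'" and ?H' = "Hom Y b' b''"
  have "(Lun V \<I> \<odot> \<one> (?H' \<otimes> ?H)) \<cdot> mid4 V \<I> ?H' \<I> ?H = inv_arr V (Lun V (?H' \<otimes> ?H)) \<cdot> (Lun V ?H' \<odot> Lun V ?H)"
    by (simp flip: mid4_units_13)
  then have mid: "(Lun V \<I> \<odot> \<one> (?H' \<otimes> ?H)) \<cdot> mid4 V \<I> ?H' \<I> ?H \<cdot> (inv_arr V (Lun V ?H') \<odot> inv_arr V (Lun V ?H))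
     = inv_arr V (Lun V (?H' \<otimes> ?H))"
    by (subst comp_reassoc[of _ _ "inv_arr V (Lun V (?H' \<otimes> ?H)) \<cdot> (Lun V ?H' \<odot> Lun V ?H)"]) simp_all
  have "mul Z (Fo D (a, b)) (Fo D (a, b')) (Fo D (a, b'')) (Fh (fix_left V X Y D a) b' b'') (Fh (fix_left V X Y D a) b b')
    = Fh D (a, b) (a, b'') \<cdot> (Jd X a \<odot> Mu Y b b' b'') \<cdot> (Lun V \<I> \<odot> \<one> (?H' \<otimes> ?H))
      \<cdot> mid4 V \<I> ?H' \<I> ?H \<cdot> (inv_arr V (Lun V ?H') \<odot> inv_arr V (Lun V ?H))"
    by (simp add: bifunctor_mul mul_id_id mul_Jd lun_unit_eq_run_unit)
  also have "\<dots> = Fh D (a, b) (a, b'') \<cdot> (Jd X a \<odot> \<one> (Hom Y b b'')) \<cdot> (\<one> \<I> \<odot> Mu Y b b' b'') \<cdot> inv_arr V (Lun V (?H' \<otimes> ?H))"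
    by (simp only: mid) simp
  also have "\<dots> = Fh (fix_left V X Y D a) b b'' \<cdot> Mu Y b b' b''"
    using inv_lun_nat[of "Mu Y b b' b''"] by simp
  finally show "Fh (fix_left V X Y D a) b b'' \<cdot> Mu Y b b' b'' =
       Mu Z (Fo (fix_left V X Y D a) b) (Fo (fix_left V X Y D a) b') (Fo (fix_left V X Y D a) b'') \<cdot>
       (Fh (fix_left V X Y D a) b' b'' \<odot> Fh (fix_left V X Y D a) b b')"
    by (simp add: mul_def)
qed simp_all

text \<open>Both orders of composition give the action of \<open>D\<close>. With units in positions
  2 and 3 the interchange is trivial; in positions 1 and 4 it leaves a symmetry, which is the origin
  of the one in \<open>commute\<close>.\<close>

lemma partial_functors_mul:
  assumes [simp]: "a \<in> Obj X" "a' \<in> Obj X" "b \<in> Obj Y" "b' \<in> Obj Y"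
  shows "mul Z (Fo D (a, b)) (Fo D (a', b)) (Fo D (a', b'))
      (Fh (fix_left V X Y D a') b b') (Fh (fix_right V X Y D b) a a') \<cdot> Sym V (Hom X a a') (Hom Y b b')
      = Fh D (a, b) (a', b')" (is ?left)
    and "mul Z (Fo D (a, b)) (Fo D (a, b')) (Fo D (a', b'))
      (Fh (fix_right V X Y D b') a a') (Fh (fix_left V X Y D a) b b') = Fh D (a, b) (a', b')" (is ?right)
proof -
  let ?H = "Hom X a a'" and ?K = "Hom Y b b'"
  have "mul Z (Fo D (a, b)) (Fo D (a', b)) (Fo D (a', b'))
      (Fh (fix_left V X Y D a') b b') (Fh (fix_right V X Y D b) a a')
    = Fh D (a, b) (a', b') \<cdot> ((Lun V ?H \<odot> Run V ?K) \<cdot> mid4 V \<I> ?K ?H \<I>) \<cdot> (inv_arr V (Lun V ?K) \<odot> inv_arr V (Run V ?H))"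
    by (simp add: bifunctor_mul mul_Jd)
  also have "\<dots> = Fh D (a, b) (a', b') \<cdot> Sym V ?K ?H"
    by (simp only: mid4_units_14) simp
  finally show ?left by simp
  have "mul Z (Fo D (a, b)) (Fo D (a, b')) (Fo D (a', b'))
      (Fh (fix_right V X Y D b') a a') (Fh (fix_left V X Y D a) b b')
    = Fh D (a, b) (a', b') \<cdot> ((Run V ?H \<odot> Lun V ?K) \<cdot> mid4 V ?H \<I> \<I> ?K) \<cdot> (inv_arr V (Run V ?H) \<odot> inv_arr V (Lun V ?K))"
    by (simp add: bifunctor_mul mul_Jd)
  then show ?right
    by (simp only: mid4_units_23) simp
qed

end

lemma bifold_algebra_commuting:
  assumes "system_of_arities V J" "admissible V J C" "bifold_algebra V J C T U D"
  shows "commuting_algebras V J C T U (fix_left V T U D) (fix_right V T U D)"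
proof -
  from assms have T: "is_theory V J T" and U: "is_theory V J U" and C: "vcategory V C"
    and D: "vfunctor V (tensor_vcat V T U) C D"
    by (auto simp: bifold_algebra_def admissible_def)
  note TU = is_theory_simps(1,2)[OF T] is_theory_simps(1,2)[OF U]
  note [simp] = partial_functor_simps[OF TU(1,3) C D]
  show ?thesis
  proof unfold_locales
    show "is_algebra V J U C (fix_left V T U D X)" if "X \<in> J" for X
      using that assms(3) vfunctor_fix_left[OF TU(1,3) C D] TU by (auto simp: is_algebra_def bifold_algebra_def)
    show "is_algebra V J T C (fix_right V T U D Y)" if "Y \<in> J" for Y
      using that assms(3) vfunctor_fix_right[OF TU(1,3) C D] TU by (auto simp: is_algebra_def bifold_algebra_def)
    fix X X' Y Y' assume "X \<in> J" "X' \<in> J" "Y \<in> J" "Y' \<in> J"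
    then show "mul C (Fo (fix_right V T U D Y) X) (Fo (fix_right V T U D Y) X') (Fo (fix_right V T U D Y') X')
        (Fh (fix_left V T U D X') Y Y') (Fh (fix_right V T U D Y) X X') \<cdot> Sym V (Hom T X X') (Hom U Y Y')
      = mul C (Fo (fix_right V T U D Y) X) (Fo (fix_right V T U D Y') X) (Fo (fix_right V T U D Y') X')
        (Fh (fix_right V T U D Y') X X') (Fh (fix_left V T U D X) Y Y')"
      using partial_functors_mul[OF TU(1,3) C D, of X X' Y Y'] TU
      by (simp del: partial_functor_simps(3,4)[OF TU(1,3) C D])
  qed (use assms T U TU in simp_all)
qed

end

theorem theorem9p5:
  fixes V :: "('o, 'm) smc" and J :: "'o set" and C :: "('c, 'o, 'm) cvcat"
    and T U :: "('o, 'm) jtheory" and D :: "('o \<times> 'o, 'c, 'm) vfun"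
  assumes "symmetric_monoidal_closed V"
    and "has_pullbacks V"
    and "system_of_arities V J"
    and "admissible V J C"
    and "bifold_algebra V J C T U D"
  shows "(right_commutant V J C T U D \<longleftrightarrow>
            fully_faithful V U (Alg V J T C) (transpose_rl V C T U D)) \<and>
         (left_commutant V J C T U D \<longleftrightarrow>
            fully_faithful V T (Alg V J U C) (transpose_lr V C T U D))"
proof -
  interpret symmetric_monoidal_closed V by (rule assms(1))
  interpret right: commuting_algebras V J C T U "fix_left V T U D" "fix_right V T U D"
    using assms by (intro bifold_algebra_commuting)
  interpret left: commuting_algebras V J C U T "fix_right V T U D" "fix_left V T U D"
    by (rule right.commuting_algebras_swap)
  \<comment> \<open>Both faces live on the object \<open>D(\<I>, \<I>)\<close>, so both isomorphisms
    are taken in the same category of algebras.\<close>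
  have carrier: "Fo (fix_right V T U D (Unt V)) (Unt V) = bicarrier V D"
    "Fo (fix_left V T U D (Unt V)) (Unt V) = bicarrier V D"
    by (simp_all add: fix_right_def fix_left_def bicarrier_def)
  have "right.transposed = transpose_rl V C T U D" "left.transposed = transpose_lr V C T U D"
    by (simp_all add: right.transposed_def left.transposed_def transpose_rl_def transpose_lr_def)
  then show ?thesis
    using right.commutant_iff_fully_faithful left.commutant_iff_fully_faithful
    by (simp add: carrier right_commutant_def left_commutant_def right_face_def left_face_def)
qed

end
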